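(* Let $r\in(0,1)$ and let $g:[0,+\infty)\to[0,+\infty)$ be a continuous function for which there exist $a_1,a_2\geq0$ and $q\in[1,2^* )$ such that $$g(t)\leq a_1+a_2t^{q-1}\quad\text{for all } t\geq0.$$ For any $\mu>0$ let $k_\mu:[0,+\infty)\to\mathbb{R}$ be the function defined by $$k_\mu(t):=\frac{t^{2-r}-\mu c_{2^*}^{2^*}\,t^{2^*-r}}{c_{2^*}^{r}|\Omega|^{\frac{2^*-r}{2^*}}+a_1c_{2^*}|\Omega|^{\frac{2^*-1}{2^*}}t^{1-r}+a_2c_{2^*}^{q}|\Omega|^{\frac{2^*-q}{2^*}}t^{q-r}}\quad\text{for all } t\geq0.$$ Then, for all $\mu>0$ there exists a nonempty open interval $$\Lambda_\mu\subseteq\left(0,\max_{[0,+\infty)}k_\mu\right)$$ such that, for every $\lambda\in\Lambda_\mu$, the problem $$\begin{cases}-\mathcal{L}_Ku=\mu u^{2^*-1}+\lambda\left(u^{r-1}+g(u)\right)&\text{in }\Omega\\ u>0&\text{in }\Omega\\ u=0&\text{in }\mathbb{R}^n\setminus\Omega\end{cases}$$ admits a weak solution $\tilde u_{0,\lambda,\mu}\in X_0$.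
   Context: Standing assumptions: $s\in(0,1)$, $n$ is a positive integer with $n>2s$, $\Omega\subset\mathbb{R}^n$ is (nonempty) open, bounded, with Lipschitz boundary, $|\Omega|$ is its Lebesgue measure, $\Omega^c:=\mathbb{R}^n\setminus\Omega$, and $2^*:=\frac{2n}{n-2s}$. The kernel $K:\mathbb{R}^n\setminus\{0\}\to(0,+\infty)$ satisfies: $wK\in L^1(\mathbb{R}^n)$ with $w(x):=\min\{|x|^2,1\}$; and there exists $k_0>0$ such that $K(x)\geq k_0|x|^{-(n+2s)}$ for all $x\in\mathbb{R}^n\setminus\{0\}$. The operator is $$\mathcal{L}_Ku(x):=\int_{\mathbb{R}^n}(u(x+y)+u(x-y)-2u(x))K(y)\,dy.$$ Let $Q:=\mathbb{R}^{2n}\setminus(\Omega^c\times\Omega^c)$. $X$ is the linear space of Lebesgue measurable functions $u:\mathbb{R}^n\to\mathbb{R}$ such that $u|_\Omega\in L^2(\Omega)$ and $(x,y)\mapsto(u(x)-u(y))\sqrt{K(x-y)}$ belongs to $L^2(Q,dx\,dy)$; $X_0:=\{u\in X:u=0\text{ a.e. in }\Omega^c\}$, a Hilbert space with scalar product $$\langle u,v\rangle:=\int_Q(u(x)-u(y))(v(x)-v(y))K(x-y)\,dx\,dy$$ and norm $\|u\|:=\langle u,u\rangle^{1/2}$. The embedding $X_0\hookrightarrow L^{2^*}(\mathbb{R}^n)$ is continuous and $$c_{2^*}:=\sup_{u\in X_0\setminus\{0\}}\frac{\|u\|_{L^{2^*}(\mathbb{R}^n)}}{\|u\|}.$$ A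 weak solution of the problem is a function $u\in X_0$ such that: $u>0$ a.e. in $\Omega$; $u^{r-1}v\in L^1(\Omega)$ for every $v\in X_0$; and $\langle u,v\rangle-\mu\int_\Omega u^{2^*-1}v\,dx-\lambda\int_\Omega\left(u^{r-1}+g(u)\right)v\,dx=0$ for every $v\in X_0$. *)

theory Defs
  imports "HOL-Analysis.Analysis"
begin

text \<open>
  Euclidean space of dimension \<open>n\<close> is a type \<open>'a :: euclidean_space\<close> with \<open>n = DIM('a)\<close>.
  The kernel is a total function; its value at the origin is never constrained, and it is
  irrelevant for everything below.
\<close>

text \<open>
  Near each boundary point, after a rotation taking the last coordinate axis to the unit vector
  \<open>e\<close>, the set is the strict epigraph of a Lipschitz function of the remaining coordinates.
  The hyperplane of the remaining coordinates is the orthogonal complement of \<open>e\<close>, and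
  \<open>x - (x \<bullet> e) *\<^sub>R e\<close> is the orthogonal projection of \<open>x\<close> onto it.
\<close>
definition lipschitz_boundary :: "'a::euclidean_space set \<Rightarrow> bool" where
  "lipschitz_boundary \<Omega> \<longleftrightarrow>
     (\<forall>p\<in>frontier \<Omega>. \<exists>\<rho>>0. \<exists>e L \<gamma>. norm e = 1 \<and> L-lipschitz_on {y. y \<bullet> e = 0} \<gamma> \<and>
        \<Omega> \<inter> ball p \<rho> = {x \<in> ball p \<rho>. \<gamma> (x - (x \<bullet> e) *\<^sub>R e) < x \<bullet> e})"

definition L2_on :: "'a::euclidean_space set \<Rightarrow> ('a \<Rightarrow> real) \<Rightarrow> bool" where
  "L2_on S f \<longleftrightarrow>
     f \<in> borel_measurable (lebesgue_on S) \<and> integrable (lebesgue_on S) (\<lambda>x. (f x)\<^sup>2)"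

definition Qset :: "'a set \<Rightarrow> ('a \<times> 'a) set" where
  "Qset \<Omega> = - ((- \<Omega>) \<times> (- \<Omega>))"

definition X_space :: "('a::euclidean_space \<Rightarrow> real) \<Rightarrow> 'a set \<Rightarrow> ('a \<Rightarrow> real) set" where
  "X_space K \<Omega> = {u \<in> borel_measurable lebesgue.
     L2_on \<Omega> u \<and> L2_on (Qset \<Omega>) (\<lambda>(x, y). (u x - u y) * sqrt (K (x - y)))}"

definition X0_space :: "('a::euclidean_space \<Rightarrow> real) \<Rightarrow> 'a set \<Rightarrow> ('a \<Rightarrow> real) set" where
  "X0_space K \<Omega> = {u \<in> X_space K \<Omega>. AE x in lebesgue. x \<notin> \<Omega> \<longrightarrow> u x = 0}"

definition X0_inner ::
  "('a::euclidean_space \<Rightarrow> real) \<Rightarrow> 'a set \<Rightarrow> ('a \<Rightarrow> real) \<Rightarrow> ('a \<Rightarrow> real) \<Rightarrow> real" where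
  "X0_inner K \<Omega> u v =
     (\<integral>(x, y). (u x - u y) * (v x - v y) * K (x - y) \<partial>lebesgue_on (Qset \<Omega>))"

definition X0_norm :: "('a::euclidean_space \<Rightarrow> real) \<Rightarrow> 'a set \<Rightarrow> ('a \<Rightarrow> real) \<Rightarrow> real" where
  "X0_norm K \<Omega> u = sqrt (X0_inner K \<Omega> u u)"

definition Lp_norm :: "real \<Rightarrow> ('a::euclidean_space \<Rightarrow> real) \<Rightarrow> real" where
  "Lp_norm p u = (\<integral>x. \<bar>u x\<bar> powr p \<partial>lebesgue) powr (1 / p)"

definition crit_exp :: "nat \<Rightarrow> real \<Rightarrow> real" where
  "crit_exp n s = 2 * real n / (real n - 2 * s)"

text \<open>
  Elements of the spaces are functions rather than equivalence classes, so the nonzero elements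
  are those that do not vanish almost everywhere. For \<open>p = crit_exp DIM('a) s\<close> the fractional
  Sobolev inequality makes the integral in \<open>Lp_norm\<close> finite and the supremum a real number.
\<close>
definition embedding_const :: "('a::euclidean_space \<Rightarrow> real) \<Rightarrow> 'a set \<Rightarrow> real \<Rightarrow> real" where
  "embedding_const K \<Omega> p =
     (SUP u \<in> {u \<in> X0_space K \<Omega>. \<not> (AE x in lebesgue. u x = 0)}. Lp_norm p u / X0_norm K \<Omega> u)"

text \<open>
  Real power of a nonnegative base with \<open>t\<^sup>0 = 1\<close> also for \<open>t = 0\<close>, where \<open>0 powr 0 = 0\<close>.
\<close>
definition rpow :: "real \<Rightarrow> real \<Rightarrow> real" where
  "rpow t p = (if p = 0 then 1 else t powr p)"

text \<open>
  Here \<open>p\<close> is the critical exponent, \<open>c\<close> the embedding constant and \<open>V\<close> the volume of the domain.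
\<close>
definition k_fun ::
  "real \<Rightarrow> real \<Rightarrow> real \<Rightarrow> real \<Rightarrow> real \<Rightarrow> real \<Rightarrow> real \<Rightarrow> real \<Rightarrow> real \<Rightarrow> real" where
  "k_fun p c V r q a1 a2 \<mu> t =
     (t powr (2 - r) - \<mu> * c powr p * t powr (p - r)) /
     (c powr r * V powr ((p - r) / p)
      + a1 * c * V powr ((p - 1) / p) * t powr (1 - r)
      + a2 * c powr q * V powr ((p - q) / p) * t powr (q - r))"

definition weak_solution ::
  "('a::euclidean_space \<Rightarrow> real) \<Rightarrow> 'a set \<Rightarrow> real \<Rightarrow> real \<Rightarrow> (real \<Rightarrow> real) \<Rightarrow> real \<Rightarrow> real
    \<Rightarrow> ('a \<Rightarrow> real) \<Rightarrow> bool" where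
  "weak_solution K \<Omega> p r g \<mu> l u \<longleftrightarrow>
     u \<in> X0_space K \<Omega> \<and>
     (AE x in lebesgue. x \<in> \<Omega> \<longrightarrow> 0 < u x) \<and>
     (\<forall>v\<in>X0_space K \<Omega>. integrable (lebesgue_on \<Omega>) (\<lambda>x. u x powr (r - 1) * v x)) \<and>
     (\<forall>v\<in>X0_space K \<Omega>.
        X0_inner K \<Omega> u v
        - \<mu> * (\<integral>x. u x powr (p - 1) * v x \<partial>lebesgue_on \<Omega>)
        - l * (\<integral>x. (u x powr (r - 1) + g (u x)) * v x \<partial>lebesgue_on \<Omega>) = 0)"

end

theory Submission
  imports Defs "HOL-Complex_Analysis.Great_Picard"
begin

text \<open>
  Write \<open>p\<close> for the critical exponent and \<open>\<parallel>u\<parallel>\<close> for the norm of the function space. The interval of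
  parameters may lie as close to \<open>0\<close> as one likes, so two things are needed: the function \<open>k\<close> attains
  a positive maximum (\<open>k_fun_attains_max\<close>), and the problem has a weak solution for every sufficiently
  small \<open>l > 0\<close> (\<open>small_parameter_solution\<close>).

  The solution is a minimiser of the energy functional
  \<open>\<parallel>u\<parallel>\<^sup>2 / 2 - \<mu> / p * \<integral>\<bar>u\<bar>\<^sup>p - l * \<integral>N(u)\<close> with \<open>N(t) = t\<^sup>r / r + \<integral>\<^sub>0\<^sup>t g\<close>, among the nonnegative
  functions in a ball whose radius is small in terms of \<open>\<mu>\<close> only.

  The minimiser exists although the critical embedding is not compact. A minimising sequence \<open>U\<^sub>j\<close> has a
  subsequence that converges almost everywhere to some \<open>u\<close> (\<open>bounded_energy_AE_Cauchy_subsequence\<close>).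
  With \<open>W\<^sub>j = U\<^sub>j - u\<close> one has \<open>\<parallel>U\<^sub>j\<parallel>\<^sup>2 = \<parallel>u\<parallel>\<^sup>2 + \<parallel>W\<^sub>j\<parallel>\<^sup>2 + o(1)\<close> (\<open>weakly_null_form\<close>), the same splitting
  for \<open>\<integral>\<bar>U\<^sub>j\<bar>\<^sup>p\<close> (\<open>brezis_lieb\<close>), and \<open>\<integral>N(U\<^sub>j) = \<integral>N(u) + o(1)\<close> (\<open>subcritical_convergence\<close>). So the
  functional at \<open>U\<^sub>j\<close> exceeds its value at \<open>u\<close> by \<open>\<parallel>W\<^sub>j\<parallel>\<^sup>2 / 2 - \<mu> / p * \<integral>\<bar>W\<^sub>j\<bar>\<^sup>p + o(1)\<close>, and in a small
  ball the Sobolev inequality makes this difference nonnegative. For small \<open>l\<close> the functional is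
  positive on the boundary of the ball, whereas it vanishes at \<open>0\<close>; hence the minimiser lies in the
  interior.

  The singular power enters through its infinite slope at \<open>0\<close>. Comparing \<open>u\<close> with \<open>u + t v\<close> for
  \<open>v \<ge> 0\<close> bounds \<open>\<integral>(u + t v)\<^sup>r\<^sup>-\<^sup>1 v\<close> uniformly in \<open>t\<close>, which forces \<open>u > 0\<close> and the integrability of
  \<open>u\<^sup>r\<^sup>-\<^sup>1 v\<close> (\<open>minimiser_positive\<close>). Comparing \<open>u\<close> with the positive part of \<open>u + t v\<close> for arbitrary \<open>v\<close>
  then gives difference quotients with an integrable majorant that contains \<open>u\<^sup>r\<^sup>-\<^sup>1 \<bar>v\<bar>\<close>; their limit is
  one inequality of the weak formulation, and replacing \<open>v\<close> by \<open>- v\<close> gives the other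
  (\<open>euler_lagrange\<close>).

  The Sobolev inequality is the integral of a pointwise estimate (\<open>pointwise_sobolev\<close>), and compactness
  comes from comparing \<open>u x\<close> with means of \<open>u\<close> over finitely many small balls, at an error that the
  energy controls (\<open>pointwise_bound_by_ball_integral\<close>).
\<close>

section \<open>Lebesgue measurability and null sets on the product space\<close>

lemma lebesgue_ex_borel:
  fixes u :: "'a::euclidean_space \<Rightarrow> real"
  assumes "u \<in> borel_measurable lebesgue"
  obtains u' where "u' \<in> borel_measurable borel" "AE x in lebesgue. u x = u' x"
proof -
  obtain u' where "u' \<in> borel_measurable lborel" "AE x in lborel. u x = u' x"
    using completion_ex_borel_measurable_real[OF assms] by blast
  then show thesis using that by (simp add: AE_completion_iff)
qed

lemma borel_measurable_coordinates:
  shows borel_measurable_fst: "fst \<in> measurable (borel :: ('a::euclidean_space \<times> 'a) measure) borel"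
    and borel_measurable_snd: "snd \<in> measurable (borel :: ('a::euclidean_space \<times> 'a) measure) borel"
    and borel_measurable_fst_minus_snd:
      "(\<lambda>z. fst z - snd z) \<in> measurable (borel :: ('a::euclidean_space \<times> 'a) measure) borel"
  by (intro borel_measurable_continuous_onI continuous_intros)+

text \<open>
  Lebesgue measure on the product is the completion of the Borel product measure, not a product of
  completions, so null sets are transported by enclosing them in Borel null sets and applying Fubini's
  theorem to those.
\<close>

lemma AE_lebesgue_coordinates:
  fixes P :: "'a::euclidean_space \<Rightarrow> bool"
  assumes "AE x in lebesgue. P x"
  shows AE_lebesgue_fst: "AE z in lebesgue. P (fst (z :: 'a \<times> 'a))"
    and AE_lebesgue_snd: "AE z in lebesgue. P (snd (z :: 'a \<times> 'a))"
    and AE_lebesgue_diff: "AE z in lebesgue. P (fst (z :: 'a \<times> 'a) - snd z)"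
proof -
  have "AE x in lborel. P x" using assms by (simp add: AE_completion_iff)
  then obtain N where N: "N \<in> null_sets lborel" "{x. \<not> P x} \<subseteq> N"
    by (auto elim!: AE_E simp: null_sets_def)
  have [measurable]: "N \<in> sets borel" using N by auto
  note [measurable] = borel_measurable_coordinates
  have prod: "AE z in lebesgue. Q (z :: 'a \<times> 'a)"
    if "AE y in lborel. AE x in lborel. Q (x, y)" "Measurable.pred borel Q" for Q
  proof -
    \<comment> \<open>The sections are taken for fixed second coordinate, so the coordinates are swapped twice.\<close>
    have "{x \<in> space (lborel \<Otimes>\<^sub>M lborel). Q (snd x, fst x)} \<in> sets (lborel \<Otimes>\<^sub>M lborel)"
    proof -
      have "(\<lambda>x. Q (snd x, fst x)) \<in> measurable (borel :: ('a \<times> 'a) measure) (count_space UNIV)"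
        by (rule measurable_compose[OF _ that(2)]) (simp add: borel_prod[symmetric])
      then show ?thesis unfolding lborel_prod by (simp add: pred_def)
    qed
    then have "AE z in lborel \<Otimes>\<^sub>M lborel. Q (snd z, fst z)"
      using that(1) by (intro lborel_pair.AE_pair_measure) auto
    moreover have mQ: "{x \<in> space (lborel \<Otimes>\<^sub>M lborel). Q (fst x, snd x)} \<in> sets (lborel \<Otimes>\<^sub>M lborel)"
      using that(2) unfolding lborel_prod by (simp add: pred_def)
    moreover have "{x \<in> space (lborel \<Otimes>\<^sub>M lborel). Q (snd x, fst x)} \<in> sets (lborel \<Otimes>\<^sub>M lborel)" by fact
    ultimately have "AE x in lborel. AE y in lborel. Q (x, y)"
      using that(1) lborel_pair.AE_commute[of "\<lambda>x y. Q (x, y)"] by simp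
    then have "AE z in lborel \<Otimes>\<^sub>M lborel. Q z"
      using mQ by (intro lborel_pair.AE_pair_measure) auto
    then show ?thesis unfolding lborel_prod by (simp add: AE_completion_iff)
  qed
  have n: "AE x in lborel. x \<notin> N" using N(1) by (rule AE_not_in)
  have "AE z in lebesgue. fst (z :: 'a \<times> 'a) \<notin> N"
    using n by (intro prod) auto
  then show "AE z in lebesgue. P (fst (z :: 'a \<times> 'a))" using N by (auto elim!: eventually_mono)
  have "AE z in lebesgue. snd (z :: 'a \<times> 'a) \<notin> N"
    using n by (intro prod) auto
  then show "AE z in lebesgue. P (snd (z :: 'a \<times> 'a))" using N by (auto elim!: eventually_mono)
  have "AE x in lborel. x - y \<notin> N" for y
  proof -
    have "AE x in distr lborel borel ((+) (-y)). x \<notin> N"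
      using n unfolding lborel_distr_plus .
    then show ?thesis by (subst (asm) AE_distr_iff) auto
  qed
  then have "AE z in lebesgue. fst (z :: 'a \<times> 'a) - snd z \<notin> N"
    by (intro prod) auto
  then show "AE z in lebesgue. P (fst (z :: 'a \<times> 'a) - snd z)" using N by (auto elim!: eventually_mono)
qed

lemma borel_measurable_lebesgue_coordinates:
  fixes u :: "'a::euclidean_space \<Rightarrow> real"
  assumes "u \<in> borel_measurable lebesgue"
  shows borel_measurable_lebesgue_fst: "(\<lambda>z. u (fst (z :: 'a \<times> 'a))) \<in> borel_measurable lebesgue"
    and borel_measurable_lebesgue_snd: "(\<lambda>z. u (snd (z :: 'a \<times> 'a))) \<in> borel_measurable lebesgue"
    and borel_measurable_lebesgue_diff: "(\<lambda>z. u (fst (z :: 'a \<times> 'a) - snd z)) \<in> borel_measurable lebesgue"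
proof -
  obtain u' where u': "u' \<in> borel_measurable borel" "AE x in lebesgue. u' x = u x"
    by (rule lebesgue_ex_borel[OF assms]) (auto simp: eq_commute)
  have comp: "(\<lambda>z. u' (c z)) \<in> borel_measurable lebesgue"
    if "c \<in> measurable borel borel" for c :: "'a \<times> 'a \<Rightarrow> 'a"
    using measurable_compose[OF that u'(1)] by (intro measurable_completion) simp
  show "(\<lambda>z. u (fst (z :: 'a \<times> 'a))) \<in> borel_measurable lebesgue"
    by (rule borel_measurable_AE[OF comp AE_lebesgue_fst[OF u'(2)]]) (rule borel_measurable_coordinates)
  show "(\<lambda>z. u (snd (z :: 'a \<times> 'a))) \<in> borel_measurable lebesgue"
    by (rule borel_measurable_AE[OF comp AE_lebesgue_snd[OF u'(2)]]) (rule borel_measurable_coordinates)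
  show "(\<lambda>z. u (fst (z :: 'a \<times> 'a) - snd z)) \<in> borel_measurable lebesgue"
    by (rule borel_measurable_AE[OF comp AE_lebesgue_diff[OF u'(2)]]) (rule borel_measurable_coordinates)
qed

text \<open>
  Only Borel integrands are covered; hence the passage to Borel representatives below.
\<close>

lemma nn_integral_lebesgue_pair:
  fixes f :: "'a::euclidean_space \<times> 'a \<Rightarrow> ennreal"
  assumes "f \<in> borel_measurable borel"
  shows "(\<integral>\<^sup>+z. f z \<partial>lebesgue) = (\<integral>\<^sup>+x. \<integral>\<^sup>+y. f (x, y) \<partial>lborel \<partial>lborel)"
proof -
  have "f \<in> borel_measurable (lborel \<Otimes>\<^sub>M lborel)" using assms unfolding lborel_prod by simp
  from lborel.nn_integral_fst[OF this] show ?thesis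
    unfolding lborel_prod by (simp add: nn_integral_completion)
qed

lemma nn_integral_lborel_reflect:
  fixes f :: "'a::euclidean_space \<Rightarrow> ennreal"
  assumes [measurable]: "f \<in> borel_measurable borel"
  shows "(\<integral>\<^sup>+y. f (x - y) \<partial>lborel) = (\<integral>\<^sup>+y. f y \<partial>lborel)"
proof -
  have "lborel = distr lborel borel (\<lambda>y. x + (-1) *\<^sub>R y)"
    using lborel_affine[of "-1" x] by (simp add: density_1)
  then have "(\<integral>\<^sup>+y. f y \<partial>lborel) = (\<integral>\<^sup>+y. f y \<partial>distr lborel borel (\<lambda>y. x + (-1) *\<^sub>R y))"
    by simp
  also have "\<dots> = (\<integral>\<^sup>+y. f (x + (-1) *\<^sub>R y) \<partial>lborel)"
    by (rule nn_integral_distr) auto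
  finally show ?thesis by simp
qed

lemma nn_integral_lborel_translate:
  fixes f :: "'a::euclidean_space \<Rightarrow> ennreal"
  assumes [measurable]: "f \<in> borel_measurable borel"
  shows "(\<integral>\<^sup>+x. f (x - y) \<partial>lborel) = (\<integral>\<^sup>+x. f x \<partial>lborel)"
proof -
  have "(\<integral>\<^sup>+x. f x \<partial>lborel) = (\<integral>\<^sup>+x. f x \<partial>distr lborel borel ((+) (- y)))"
    by (simp add: lborel_distr_plus)
  also have "\<dots> = (\<integral>\<^sup>+x. f (- y + x) \<partial>lborel)"
    by (rule nn_integral_distr) auto
  finally show ?thesis by simp
qed

section \<open>Limits of almost dominated integrals\<close>

lemma nn_integral_Fatou_bound:
  fixes f :: "nat \<Rightarrow> 'b \<Rightarrow> real"
  assumes m: "\<And>j. f j \<in> borel_measurable M" and lim: "AE x in M. (\<lambda>j. f j x) \<longlonglongrightarrow> g x"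
    and bd: "\<forall>\<^sub>F j in sequentially. (\<integral>\<^sup>+x. ennreal (f j x) \<partial>M) \<le> B"
  shows "(\<integral>\<^sup>+x. ennreal (g x) \<partial>M) \<le> B"
proof -
  have "(\<integral>\<^sup>+x. ennreal (g x) \<partial>M) \<le> (\<integral>\<^sup>+x. liminf (\<lambda>j. ennreal (f j x)) \<partial>M)"
  proof (rule nn_integral_mono_AE)
    show "AE x in M. ennreal (g x) \<le> liminf (\<lambda>j. ennreal (f j x))"
      using lim
    proof eventually_elim
      case (elim x)
      from lim_imp_Liminf[OF _ tendsto_ennrealI[OF elim]] show ?case by simp
    qed
  qed
  also have "\<dots> \<le> liminf (\<lambda>j. \<integral>\<^sup>+x. ennreal (f j x) \<partial>M)"
    using m by (intro nn_integral_liminf) simp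
  also have "\<dots> \<le> B" using bd by (intro Liminf_le) auto
  finally show ?thesis .
qed

text \<open>
  Dominated convergence up to a small multiple of functions with bounded integrals: the positive part
  of \<open>\<bar>W j\<bar> - e * P j\<close> is dominated by \<open>R\<close> and tends to \<open>0\<close>, and the remainder has integral at most
  \<open>e * C\<close>. The splitting of the norm, the Brezis-Lieb lemma and the convergence of subcritical terms
  are all instances.
\<close>

lemma almost_dominated_convergence:
  fixes W P :: "nat \<Rightarrow> 'b \<Rightarrow> real"
  assumes W: "\<And>j. W j \<in> borel_measurable M"
    and lim: "AE x in M. (\<lambda>j. W j x) \<longlonglongrightarrow> 0"
    and P: "\<And>j. integrable M (P j)" "\<And>j. (\<integral>x. P j x \<partial>M) \<le> C" "\<And>j x. 0 \<le> P j x"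
    and dom: "\<And>e. e > 0 \<Longrightarrow> \<exists>R. integrable M R \<and> (\<forall>j. AE x in M. \<bar>W j x\<bar> \<le> e * P j x + R x)"
  shows "\<And>j. integrable M (W j)" "(\<lambda>j. \<integral>x. W j x \<partial>M) \<longlonglongrightarrow> 0"
proof -
  show int: "integrable M (W j)" for j
  proof -
    obtain R where R: "integrable M R" "\<forall>j. AE x in M. \<bar>W j x\<bar> \<le> 1 * P j x + R x"
      using dom[of 1] by auto
    have "AE x in M. norm (W j x) \<le> norm (1 * P j x + R x)"
      using R(2)[rule_format, of j] by (auto elim!: eventually_mono)
    moreover have "integrable M (\<lambda>x. 1 * P j x + R x)" using R P by auto
    ultimately show ?thesis
      by (intro Bochner_Integration.integrable_bound[OF _ W])
  qed
  have meas[measurable]: "P j \<in> borel_measurable M" "W j \<in> borel_measurable M" for j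
    using P W by auto
  have "0 \<le> (\<integral>x. P 0 x \<partial>M)" using P(3) by simp
  then have C: "C \<ge> 0" using P(2)[of 0] by linarith
  show "(\<lambda>j. \<integral>x. W j x \<partial>M) \<longlonglongrightarrow> 0"
  proof (rule LIMSEQ_I)
    fix \<eta> :: real assume \<eta>: "\<eta> > 0"
    define e where "e = \<eta> / (2 * (C + 1))"
    have e: "e > 0" using \<eta> C by (auto simp: e_def)
    have eC: "e * C \<le> \<eta> / 2"
    proof -
      have "e * C \<le> e * (C + 1)" using e by (intro mult_left_mono) auto
      also have "\<dots> = \<eta> / 2" using C by (simp add: e_def field_simps)
      finally show ?thesis .
    qed
    \<comment> \<open>the part of \<open>W j\<close> beyond \<open>e * P j\<close>, to which dominated convergence applies\<close>
    obtain R where R: "integrable M R" "\<And>j. AE x in M. \<bar>W j x\<bar> \<le> e * P j x + R x"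
      using dom[OF e] by auto
    define T where "T j x = max 0 (\<bar>W j x\<bar> - e * P j x)" for j x
    have Tint: "integrable M (T j)" for j
      using int P unfolding T_def by auto
    have "(\<lambda>j. \<integral>x. T j x \<partial>M) \<longlonglongrightarrow> (\<integral>x. 0 \<partial>M)"
    proof (rule integral_dominated_convergence[where w = "\<lambda>x. \<bar>R x\<bar>"])
      show "AE x in M. norm (T j x) \<le> \<bar>R x\<bar>" for j
        using R(2)[of j] by eventually_elim (auto simp: T_def)
      show "AE x in M. (\<lambda>j. T j x) \<longlonglongrightarrow> 0"
        using lim
      proof eventually_elim
        case (elim x)
        have "(\<lambda>j. \<bar>W j x\<bar>) \<longlonglongrightarrow> 0" using elim by (rule tendsto_rabs_zero)
        moreover have "norm (T j x) \<le> \<bar>W j x\<bar> * 1" for j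
          using P(3)[of j x] e by (auto simp: T_def)
        ultimately show ?case using tendsto_0_le[of "\<lambda>j. \<bar>W j x\<bar>" sequentially "\<lambda>j. T j x" 1] by simp
      qed
    qed (use R in \<open>auto simp: T_def\<close>)
    then have "\<forall>\<^sub>F j in sequentially. (\<integral>x. T j x \<partial>M) < \<eta> / 2"
      using \<eta> by (intro order_tendstoD) auto
    then obtain no where no: "\<And>j. j \<ge> no \<Longrightarrow> (\<integral>x. T j x \<partial>M) < \<eta> / 2"
      by (auto simp: eventually_sequentially)
    have "norm ((\<integral>x. W j x \<partial>M) - 0) < \<eta>" if "j \<ge> no" for j
    proof -
      have "norm (\<integral>x. W j x \<partial>M) \<le> (\<integral>x. norm (W j x) \<partial>M)" by (rule integral_norm_bound)
      also have "\<dots> \<le> (\<integral>x. T j x + e * P j x \<partial>M)"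
        using int[of j] Tint[of j] P(1)[of j] by (intro integral_mono) (auto simp: T_def)
      also have "\<dots> = (\<integral>x. T j x \<partial>M) + e * (\<integral>x. P j x \<partial>M)"
        using Tint[of j] P(1)[of j] by simp
      also have "\<dots> < \<eta> / 2 + \<eta> / 2"
        using no[OF that] mult_left_mono[OF P(2)[of j], of e] e eC by linarith
      finally show ?thesis by simp
    qed
    then show "\<exists>no. \<forall>n\<ge>no. norm ((\<integral>x. W n x \<partial>M) - 0) < \<eta>" by blast
  qed
qed

section \<open>Inequalities for real powers\<close>

lemma powr_le_powr_iff:
  fixes a b p :: real
  assumes "0 \<le> a" "0 \<le> b" "0 < p"
  shows "a powr p \<le> b powr p \<longleftrightarrow> a \<le> b"
  using assms by (meson not_less powr_less_mono2 powr_mono2 less_imp_le)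

lemma powr_mult_self: "0 \<le> (x::real) \<Longrightarrow> x powr (p - 1) * x = x powr p"
  by (cases "x = 0") (auto simp: powr_diff)

text \<open>
  The mean value theorem has to be applied up to the endpoint \<open>0\<close>, where the power need not be
  differentiable.
\<close>

lemma powr_mvt:
  fixes a b e :: real
  assumes "0 \<le> a" "a < b" "0 < e"
  obtains z where "a < z" "z < b" "b powr e - a powr e = e * z powr (e - 1) * (b - a)"
proof -
  have cont: "continuous_on {a..b} (\<lambda>z. z powr e)"
    using assms by (intro continuous_on_powr' continuous_intros) auto
  have "((\<lambda>z. z powr e) has_real_derivative e * z powr (e - 1)) (at z)" if "a < z" "z < b" for z
    using that assms by (auto intro!: derivative_eq_intros)
  then have D: "((\<lambda>z. z powr e) has_derivative (\<lambda>h. e * z powr (e - 1) * h)) (at z)" if "a < z" "z < b" for z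
    using that unfolding has_field_derivative_def by blast
  show thesis
    by (rule mvt[OF \<open>a < b\<close> cont D]) (use that in blast)+
qed

lemma powr_diff_le:
  fixes x y p :: real
  assumes "0 \<le> x" "0 \<le> y" "1 \<le> p"
  shows "\<bar>x powr p - y powr p\<bar> \<le> p * (max x y) powr (p - 1) * \<bar>x - y\<bar>"
proof -
  have main: "b powr p - a powr p \<le> p * b powr (p - 1) * (b - a)" if ab: "0 \<le> a" "a < b" for a b :: real
  proof -
    have "0 < p" using assms by simp
    from powr_mvt[OF ab this]
    obtain z where z: "a < z" "z < b" "b powr p - a powr p = p * z powr (p - 1) * (b - a)" .
    have "z powr (p - 1) \<le> b powr (p - 1)" using z ab assms by (intro powr_mono2) auto
    then have "p * z powr (p - 1) * (b - a) \<le> p * b powr (p - 1) * (b - a)"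
      using ab assms by (intro mult_right_mono mult_left_mono) auto
    then show ?thesis using z by simp
  qed
  consider "x < y" | "x = y" | "y < x" by linarith
  then show ?thesis
  proof cases
    case 1
    then have "x powr p \<le> y powr p" using assms by (intro powr_mono2) auto
    then show ?thesis using 1 main[of x y] assms by (simp add: max_def)
  next
    case 3
    then have "y powr p \<le> x powr p" using assms by (intro powr_mono2) auto
    then show ?thesis using 3 main[of y x] assms by (simp add: max_def)
  qed simp
qed

lemma powr_concave_lower:
  fixes a h r :: real
  assumes "0 \<le> a" "0 \<le> h" "0 < r" "r < 1"
  shows "r * (a + h) powr (r - 1) * h \<le> (a + h) powr r - a powr r"
proof (cases "h = 0")
  case False
  then have h: "0 < h" using assms by simp
  then obtain z where z: "a < z" "z < a + h" "(a + h) powr r - a powr r = r * z powr (r - 1) * (a + h - a)"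
    using powr_mvt[of a "a + h" r] assms by auto
  have "(a + h) powr (r - 1) \<le> z powr (r - 1)" using z assms by (intro powr_mono2') auto
  then have "r * (a + h) powr (r - 1) * h \<le> r * z powr (r - 1) * h"
    using assms h by (intro mult_right_mono mult_left_mono) auto
  then show ?thesis using z by simp
qed simp

text \<open>
  The factor \<open>a powr (r - 1)\<close> on the right is what makes the difference quotients of the singular term
  dominated: it holds for positive and negative \<open>h\<close>, even when \<open>a + h\<close> is cut off at \<open>0\<close>. For negative
  \<open>h\<close> it rests on \<open>x \<le> x powr r\<close> for \<open>x\<close> between \<open>0\<close> and \<open>1\<close>.
\<close>

lemma powr_concave_upper:
  fixes a h r :: real
  assumes "0 < a" "0 < r" "r < 1"
  shows "\<bar>(max 0 (a + h)) powr r - a powr r\<bar> \<le> a powr (r - 1) * \<bar>h\<bar>"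
proof (cases "0 < h")
  case True
  obtain z where z: "a < z" "z < a + h" "(a + h) powr r - a powr r = r * z powr (r - 1) * (a + h - a)"
    using powr_mvt[of a "a + h" r] assms True by auto
  have "z powr (r - 1) \<le> a powr (r - 1)" using z assms by (intro powr_mono2') auto
  then have "r * z powr (r - 1) * h \<le> 1 * a powr (r - 1) * h"
    using assms True by (intro mult_right_mono mult_mono) auto
  moreover have "0 \<le> r * z powr (r - 1) * h" using assms True by simp
  moreover have "max 0 (a + h) = a + h" using True assms by simp
  ultimately show ?thesis using z True by simp
next
  case False
  define m where "m = max 0 (a + h)"
  have m: "0 \<le> m" "m \<le> a" "a - m \<le> \<bar>h\<bar>" using False assms by (auto simp: m_def)
  have le: "m powr r \<le> a powr r" using m assms by (intro powr_mono2) auto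
  have "m / a \<le> (m / a) powr r"
  proof (cases "m = 0")
    case False
    then have "(m / a) powr 1 \<le> (m / a) powr r"
      using m assms by (intro powr_mono') auto
    then show ?thesis using m assms by simp
  qed simp
  then have "m / a * a powr r \<le> (m / a) powr r * a powr r" by (intro mult_right_mono) auto
  also have "\<dots> = m powr r" using assms by (simp add: powr_divide)
  finally have "m / a * a powr r \<le> m powr r" .
  moreover have "a powr r = a powr (r - 1) * a" using assms by (simp add: powr_mult_self)
  ultimately have "a powr r - m powr r \<le> a powr (r - 1) * (a - m)"
    using assms by (simp add: field_simps)
  also have "\<dots> \<le> a powr (r - 1) * \<bar>h\<bar>" using m by (intro mult_left_mono) auto
  finally show ?thesis using le unfolding m_def by linarith
qed

lemma powr_subcritical:
  fixes e p \<epsilon> :: real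
  assumes "0 < e" "e < p" "0 < \<epsilon>"
  obtains C where "\<And>t. 0 \<le> t \<Longrightarrow> t powr e \<le> \<epsilon> * t powr p + C" "0 \<le> C"
proof (rule that)
  \<comment> \<open>beyond \<open>T\<close> the power \<open>p\<close> dominates\<close>
  define T where "T = (1 / \<epsilon>) powr (1 / (p - e))"
  show "t powr e \<le> \<epsilon> * t powr p + T powr e" if t: "0 \<le> t" for t
  proof (cases "t \<le> T")
    case True
    then have "t powr e \<le> T powr e" using t assms by (intro powr_mono2) auto
    then show ?thesis using assms by (simp add: add_increasing)
  next
    case False
    have "0 \<le> T" by (simp add: T_def)
    with False have tT: "T < t" "0 < t" by auto
    have "1 / \<epsilon> = T powr (p - e)" using assms by (simp add: T_def powr_powr)
    also have "\<dots> \<le> t powr (p - e)" using tT assms by (intro powr_mono2) (auto simp: T_def)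
    finally have "1 \<le> \<epsilon> * t powr (p - e)" using assms by (simp add: field_simps)
    then have "t powr e * 1 \<le> t powr e * (\<epsilon> * t powr (p - e))" by (intro mult_left_mono) auto
    also have "\<dots> = \<epsilon> * (t powr e * t powr (p - e))" by simp
    also have "t powr e * t powr (p - e) = t powr p" using tT by (simp add: powr_add[symmetric])
    finally show ?thesis by (simp add: add_increasing2)
  qed
  show "0 \<le> T powr e" by simp
qed

text \<open>
  The mean value bound gives \<open>p * (\<bar>a\<bar> + \<bar>b\<bar>) powr (p - 1) * \<bar>a\<bar>\<close>. If \<open>\<bar>a\<bar>\<close> is a small fraction of
  \<open>\<bar>b\<bar>\<close>, this is a small multiple of \<open>\<bar>b\<bar> powr p\<close>; otherwise \<open>\<bar>a\<bar> powr p\<close> absorbs it.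
\<close>

lemma brezis_lieb_scalar:
  fixes p e :: real
  assumes p: "1 \<le> p" and e: "0 < e"
  obtains C where "0 \<le> C" "\<And>a b. \<bar>\<bar>a + b\<bar> powr p - \<bar>a\<bar> powr p - \<bar>b\<bar> powr p\<bar> \<le> e * \<bar>b\<bar> powr p + C * \<bar>a\<bar> powr p"
proof -
  \<comment> \<open>the threshold for \<open>\<bar>a\<bar> / \<bar>b\<bar>\<close>; below it, \<open>\<bar>a\<bar> + \<bar>b\<bar> \<le> 2 * \<bar>b\<bar>\<close>\<close>
  define \<delta> where "\<delta> = min 1 (e / (p * 2 powr (p - 1)))"
  have pp: "0 < p * 2 powr (p - 1)" using p by simp
  have \<delta>: "0 < \<delta>" "\<delta> \<le> 1" "p * 2 powr (p - 1) * \<delta> \<le> e"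
  proof -
    show "0 < \<delta>" "\<delta> \<le> 1" using pp e by (auto simp: \<delta>_def)
    have "\<delta> \<le> e / (p * 2 powr (p - 1))" by (simp add: \<delta>_def)
    then show "p * 2 powr (p - 1) * \<delta> \<le> e" using pp by (simp add: pos_le_divide_eq mult.commute)
  qed
  define C where "C = p * (1 + 1 / \<delta>) powr (p - 1) + 1"
  have C: "0 \<le> C" using p by (simp add: C_def)
  have "\<bar>\<bar>a + b\<bar> powr p - \<bar>a\<bar> powr p - \<bar>b\<bar> powr p\<bar> \<le> e * \<bar>b\<bar> powr p + C * \<bar>a\<bar> powr p" for a b
  proof -
    have "\<bar>\<bar>a + b\<bar> powr p - \<bar>b\<bar> powr p\<bar> \<le> p * (max \<bar>a + b\<bar> \<bar>b\<bar>) powr (p - 1) * \<bar>\<bar>a + b\<bar> - \<bar>b\<bar>\<bar>"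
      using p by (intro powr_diff_le) auto
    also have "\<dots> \<le> p * (\<bar>a\<bar> + \<bar>b\<bar>) powr (p - 1) * \<bar>a\<bar>"
      using p by (intro mult_mono powr_mono2) auto
    also have "\<dots> \<le> e * \<bar>b\<bar> powr p + (C - 1) * \<bar>a\<bar> powr p"
    proof (cases "\<bar>a\<bar> \<le> \<delta> * \<bar>b\<bar>")
      case True
      then have "\<bar>a\<bar> + \<bar>b\<bar> \<le> 2 * \<bar>b\<bar>" using \<delta> mult_right_mono[of \<delta> 1 "\<bar>b\<bar>"] by simp
      then have "p * (\<bar>a\<bar> + \<bar>b\<bar>) powr (p - 1) * \<bar>a\<bar> \<le> p * (2 * \<bar>b\<bar>) powr (p - 1) * (\<delta> * \<bar>b\<bar>)"
        using p True by (intro mult_mono powr_mono2) auto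
      also have "\<dots> = (p * 2 powr (p - 1) * \<delta>) * (\<bar>b\<bar> powr (p - 1) * \<bar>b\<bar>)"
        by (simp add: powr_mult)
      also have "\<dots> \<le> e * (\<bar>b\<bar> powr (p - 1) * \<bar>b\<bar>)"
        using \<delta> by (intro mult_right_mono) auto
      also have "\<dots> = e * \<bar>b\<bar> powr p" by (simp add: powr_mult_self)
      also have "\<dots> \<le> e * \<bar>b\<bar> powr p + (C - 1) * \<bar>a\<bar> powr p" using p by (simp add: C_def)
      finally show ?thesis .
    next
      case False
      then have "\<bar>b\<bar> * \<delta> \<le> \<bar>a\<bar>" by (simp add: mult.commute)
      then have "\<bar>b\<bar> \<le> \<bar>a\<bar> / \<delta>" using pos_le_divide_eq[OF \<delta>(1)] by blast
      then have ab: "\<bar>a\<bar> + \<bar>b\<bar> \<le> (1 + 1 / \<delta>) * \<bar>a\<bar>" by (simp add: distrib_right)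
      have "(\<bar>a\<bar> + \<bar>b\<bar>) powr (p - 1) \<le> ((1 + 1 / \<delta>) * \<bar>a\<bar>) powr (p - 1)"
        using p by (intro powr_mono2[OF _ _ ab]) simp_all
      then have "p * (\<bar>a\<bar> + \<bar>b\<bar>) powr (p - 1) * \<bar>a\<bar> \<le> p * ((1 + 1 / \<delta>) * \<bar>a\<bar>) powr (p - 1) * \<bar>a\<bar>"
        using p by (intro mult_right_mono mult_left_mono) simp_all
      also have "\<dots> = (C - 1) * (\<bar>a\<bar> powr (p - 1) * \<bar>a\<bar>)"
      proof -
        have "((1 + 1 / \<delta>) * \<bar>a\<bar>) powr (p - 1) = (1 + 1 / \<delta>) powr (p - 1) * \<bar>a\<bar> powr (p - 1)"
          by (rule powr_mult)
        then show ?thesis by (simp only: C_def) simp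
      qed
      also have "\<dots> = (C - 1) * \<bar>a\<bar> powr p" by (simp only: powr_mult_self[OF abs_ge_zero])
      also have "\<dots> \<le> e * \<bar>b\<bar> powr p + (C - 1) * \<bar>a\<bar> powr p"
        using mult_nonneg_nonneg[OF less_imp_le[OF e] powr_ge_zero] by (rule add_increasing) simp
      finally show ?thesis .
    qed
    also have "(C - 1) * \<bar>a\<bar> powr p = C * \<bar>a\<bar> powr p - \<bar>a\<bar> powr p"
      by (simp only: left_diff_distrib mult_1)
    finally have "\<bar>\<bar>a + b\<bar> powr p - \<bar>b\<bar> powr p\<bar> \<le> e * \<bar>b\<bar> powr p + (C * \<bar>a\<bar> powr p - \<bar>a\<bar> powr p)" .
    moreover have "\<bar>X - A - B\<bar> \<le> P + Q" if "\<bar>X - B\<bar> \<le> P + (Q - A)" "0 \<le> A" for X A B P Q :: real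
      using that by linarith
    ultimately show ?thesis using powr_ge_zero by blast
  qed
  with C show thesis by (rule that)
qed

section \<open>The fractional Sobolev inequality\<close>

text \<open>
  By Markov's inequality the set \<open>{\<bar>u\<bar> \<ge> t / 2}\<close> has measure at most \<open>2 powr p * \<integral>\<bar>u\<bar> powr p / t powr p\<close>,
  which is at most half of the ball.
\<close>

lemma half_ball_far:
  fixes u :: "'a::euclidean_space \<Rightarrow> real"
  assumes u[measurable]: "u \<in> borel_measurable borel"
    and int: "integrable lborel (\<lambda>x. \<bar>u x\<bar> powr p)" and pt: "0 < p" "0 < t"
    and R: "2 * (2 powr p * (\<integral>x. \<bar>u x\<bar> powr p \<partial>lborel) / t powr p) \<le> measure lborel (ball x R)"
  shows "ennreal (measure lborel (ball x R) / 2) \<le> emeasure lborel {y \<in> ball x R. \<bar>u y\<bar> \<le> t / 2}"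
proof -
  let ?A = "{y. t / 2 \<le> \<bar>u y\<bar>}" and ?B = "ball x R" and ?S = "{y \<in> ball x R. \<bar>u y\<bar> \<le> t / 2}"
  let ?I = "\<integral>x. \<bar>u x\<bar> powr p \<partial>lborel" and ?c = "inverse ((t / 2) powr p)"
  have "1 \<le> ennreal ?c * ennreal (\<bar>u y\<bar> powr p) \<longleftrightarrow> (t / 2) powr p \<le> \<bar>u y\<bar> powr p" for y
    using pt by (simp add: ennreal_mult[symmetric] field_simps)
  then have "?A = {y \<in> space lborel. 1 \<le> ennreal ?c * ennreal (\<bar>u y\<bar> powr p)}"
    using pt by (simp add: powr_le_powr_iff)
  also have "emeasure lborel \<dots> \<le> ennreal ?c * (\<integral>\<^sup>+x. ennreal (\<bar>u x\<bar> powr p) * indicator (space lborel) x \<partial>lborel)"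
    by (intro nn_integral_Markov_inequality) auto
  also have "\<dots> = ennreal (?c * ?I)"
    using int by (simp add: nn_integral_eq_integral ennreal_mult')
  finally have A: "emeasure lborel ?A \<le> ennreal (?c * ?I)" .
  then have "emeasure lborel ?A < \<infinity>" by (rule le_less_trans) simp
  then have fmA: "?A \<in> fmeasurable lborel" by (simp add: fmeasurable_def)
  have "measure lborel ?A \<le> ?c * ?I"
    using A unfolding emeasure_eq_measure2[OF fmA] by (subst (asm) ennreal_le_iff) simp_all
  also have "?c * ?I = 2 powr p * ?I / t powr p" by (simp add: powr_divide)
  also have "\<dots> \<le> measure lborel ?B / 2" using R by linarith
  finally have half: "measure lborel ?A \<le> measure lborel ?B / 2" .
  have Sm: "?S \<in> sets lborel" by measurable
  have Bf: "?B \<in> fmeasurable lborel" using emeasure_lborel_ball_finite[of x R] by (simp add: fmeasurable_def)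
  have fm1: "?S \<in> fmeasurable lborel" by (rule fmeasurableI2[OF Bf _ Sm]) blast
  have fm2: "?B - ?S \<in> fmeasurable lborel" by (rule fmeasurable_Diff[OF Bf Sm])
  have "?S \<union> ?B = ?B" by blast
  then have "measure lborel ?B = measure lborel ?S + measure lborel (?B - ?S)"
    using measure_Un2[OF fm1 Bf] by simp
  also have "measure lborel (?B - ?S) \<le> measure lborel ?A"
    by (rule measure_mono_fmeasurable[OF _ fmeasurableD[OF fm2] fmA]) auto
  finally have "measure lborel ?B / 2 \<le> measure lborel ?S" using half by linarith
  then have "ennreal (measure lborel ?B / 2) \<le> ennreal (measure lborel ?S)" by (rule ennreal_leI)
  then show ?thesis using fm1 by (simp add: emeasure_eq_measure2)
qed

text \<open>
  The dimension and the critical exponent are parameters so that they can be written without mentioning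
  the type of the points. At the origin the lower bound reads \<open>0 \<le> K 0\<close>.
\<close>

locale fractional_kernel =
  fixes s n p k0 :: real and \<Omega> :: "'a::euclidean_space set" and K :: "'a \<Rightarrow> real"
  assumes s01: "0 < s" "s < 1"
    and n_eq: "n = real DIM('a)" and p_crit: "p = crit_exp DIM('a) s" and dim: "2 * s < n"
    and \<Omega>_open: "open \<Omega>" and \<Omega>_bounded: "bounded \<Omega>" and \<Omega>_ne: "\<Omega> \<noteq> {}"
    and K_borel[measurable]: "K \<in> borel_measurable borel"
    and k0_pos: "0 < k0"
    and K_lower: "\<And>z. k0 * norm z powr - (n + 2 * s) \<le> K z"
    and K_int: "integrable lebesgue (\<lambda>x. min ((norm x)\<^sup>2) 1 * K x)"

begin

lemma n_pos: "0 < n" by (simp add: n_eq)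

lemma p_eq: "p = 2 * n / (n - 2 * s)" by (simp add: crit_exp_def n_eq p_crit)

lemma p_gt2: "2 < p" using dim s01 by (simp add: p_eq field_simps)

lemma p_exponent: "2 + 2 * s * p / n = p"
proof -
  have "n - 2 * s \<noteq> 0" "n \<noteq> 0" using dim n_pos by auto
  then show ?thesis by (simp add: p_eq divide_simps)
qed

lemma p_half: "1 - 2 * s / n = 2 / p"
proof -
  have "n - 2 * s \<noteq> 0" "n \<noteq> 0" using dim n_pos by auto
  then show ?thesis by (simp add: p_eq divide_simps)
qed

lemma K_nonneg: "0 \<le> K z"
  using K_lower[of z] k0_pos by (smt (verit) mult_nonneg_nonneg powr_ge_zero)

lemma \<Omega>_sets[measurable]: "\<Omega> \<in> sets borel" using \<Omega>_open by auto

lemma \<Omega>_fin: "emeasure lborel \<Omega> < \<infinity>" using \<Omega>_bounded emeasure_bounded_finite by blast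

text \<open>
  The part of the Gagliardo energy that belongs to \<open>x\<close>; integrating over \<open>x\<close> gives the whole energy.
\<close>

definition local_energy :: "('a \<Rightarrow> real) \<Rightarrow> 'a \<Rightarrow> ennreal" where
  "local_energy u x = (\<integral>\<^sup>+y. ennreal ((u x - u y)\<^sup>2 * K (x - y)) \<partial>lborel)"

lemma local_energy_measurable[measurable]:
  assumes [measurable]: "u \<in> borel_measurable borel"
  shows "local_energy u \<in> borel_measurable borel"
  unfolding local_energy_def by measurable

lemma K_ball_lower:
  assumes "dist x y \<le> R" "x \<noteq> y"
  shows "k0 * R powr - (n + 2 * s) \<le> K (x - y)"
proof -
  have "R powr - (n + 2 * s) \<le> norm (x - y) powr - (n + 2 * s)"
    using assms s01 n_pos by (intro powr_mono2') (auto simp: dist_norm)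
  then show ?thesis using K_lower[of "x - y"] k0_pos by (meson mult_left_mono less_imp_le order_trans)
qed

lemma local_energy_ge_far:
  assumes [measurable]: "u \<in> borel_measurable borel" "A \<in> sets borel"
    and A: "\<And>y. y \<in> A \<Longrightarrow> dist x y \<le> R \<and> \<delta> \<le> \<bar>u x - u y\<bar>" and "0 < \<delta>"
  shows "ennreal (\<delta>\<^sup>2 * (k0 * R powr - (n + 2 * s))) * emeasure lborel A \<le> local_energy u x"
proof -
  have "ennreal (\<delta>\<^sup>2 * (k0 * R powr - (n + 2 * s))) * emeasure lborel A
      = (\<integral>\<^sup>+y. ennreal (\<delta>\<^sup>2 * (k0 * R powr - (n + 2 * s))) * indicator A y \<partial>lborel)"
    by (subst nn_integral_cmult_indicator) auto
  also have "\<dots> \<le> local_energy u x"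
    unfolding local_energy_def
  proof (rule nn_integral_mono)
    fix y
    have "\<delta>\<^sup>2 * (k0 * R powr - (n + 2 * s)) \<le> (u x - u y)\<^sup>2 * K (x - y)" if "y \<in> A"
    proof -
      have "x \<noteq> y" using A[OF that] \<open>0 < \<delta>\<close> by auto
      then have "k0 * R powr - (n + 2 * s) \<le> K (x - y)" using A[OF that] K_ball_lower by auto
      moreover have "\<delta>\<^sup>2 \<le> (u x - u y)\<^sup>2" using A[OF that] \<open>0 < \<delta>\<close> by (simp add: abs_le_square_iff[symmetric])
      ultimately show ?thesis using k0_pos by (intro mult_mono) auto
    qed
    then show "ennreal (\<delta>\<^sup>2 * (k0 * R powr - (n + 2 * s))) * indicator A y \<le> ennreal ((u x - u y)\<^sup>2 * K (x - y))"
      by (auto simp: indicator_def ennreal_leI)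
  qed
  finally show ?thesis .
qed

lemma unit_ball_pos: "0 < measure lborel (ball (0::'a) 1)"
  by (rule content_ball_pos) auto

text \<open>
  The constant that the choice of the radius in \<open>pointwise_sobolev\<close> leaves.
\<close>

definition c_sob :: real where
  "c_sob = k0 * measure lborel (ball (0::'a) 1) / 8 *
     (2 * 2 powr p / measure lborel (ball (0::'a) 1)) powr (- 2 * s / n)"

lemma c_sob_pos: "0 < c_sob"
  unfolding c_sob_def using k0_pos unit_ball_pos
  by (intro mult_pos_pos divide_pos_pos) auto

text \<open>
  Let \<open>t = \<bar>u x\<bar>\<close>, and choose \<open>R\<close> so that the ball of radius \<open>R\<close> around \<open>x\<close> has twice the measure that
  \<open>{\<bar>u\<bar> \<ge> t / 2}\<close> can have. On at least half of it \<open>\<bar>u x - u y\<bar> \<ge> t / 2\<close>, so the local energy is at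
  least of order \<open>t\<^sup>2 * R powr (- 2 * s)\<close>. As \<open>R powr n\<close> is of order \<open>I / t powr p\<close>, this is of order
  \<open>I powr (- 2 * s / n) * t powr p\<close> by the relation \<open>2 + 2 * s * p / n = p\<close>.
\<close>

lemma pointwise_sobolev:
  assumes u[measurable]: "u \<in> borel_measurable borel" and int: "integrable lborel (\<lambda>x. \<bar>u x\<bar> powr p)"
    and I: "I = (\<integral>x. \<bar>u x\<bar> powr p \<partial>lborel)" "0 < I"
  shows "ennreal (c_sob * I powr (- 2 * s / n) * \<bar>u x\<bar> powr p) \<le> local_energy u x"
proof (cases "u x = 0")
  case False
  define t where "t = \<bar>u x\<bar>"
  have t: "t > 0" using False by (simp add: t_def)
  define \<omega> where "\<omega> = measure lborel (ball (0::'a) 1)"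
  have \<omega>: "\<omega> > 0" using unit_ball_pos by (simp add: \<omega>_def)
  \<comment> \<open>\<open>X\<close> is the \<open>n\<close>-th power of the radius: the ball has measure \<open>X * \<omega>\<close>\<close>
  define X where "X = 2 * (2 powr p * I / t powr p) / \<omega>"
  have X: "X > 0" using I t \<omega> by (simp add: X_def)
  define R where "R = X powr (1 / n)"
  have R: "R > 0" using X by (simp add: R_def)
  have "R ^ DIM('a) = X"
    using X by (simp add: R_def powr_realpow[symmetric] powr_powr n_eq)
  then have B: "measure lborel (ball x R) = X * \<omega>"
    using R content_ball_conv_unit_ball[of R x] by (simp add: \<omega>_def)
  let ?A = "{y \<in> ball x R. \<bar>u y\<bar> \<le> t / 2}"
  have "ennreal (measure lborel (ball x R) / 2) \<le> emeasure lborel ?A"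
    using t p_gt2 \<omega> B by (intro half_ball_far[OF u int]) (auto simp: X_def I(1))
  then have "ennreal ((t/2)\<^sup>2 * (k0 * R powr - (n + 2 * s))) * ennreal (X * \<omega> / 2)
     \<le> ennreal ((t/2)\<^sup>2 * (k0 * R powr - (n + 2 * s))) * emeasure lborel ?A"
    unfolding B by (rule mult_left_mono) simp
  also have "\<dots> \<le> local_energy u x"
  proof (rule local_energy_ge_far)
    fix y assume "y \<in> ?A"
    then show "dist x y \<le> R \<and> t / 2 \<le> \<bar>u x - u y\<bar>"
      unfolding t_def mem_Collect_eq mem_ball by linarith
  qed (use t in auto)
  finally have *: "ennreal ((t/2)\<^sup>2 * (k0 * R powr - (n + 2 * s)) * (X * \<omega> / 2)) \<le> local_energy u x"
    using k0_pos ennreal_mult'[of "(t/2)\<^sup>2 * (k0 * R powr - (n + 2 * s))" "X * \<omega> / 2"] by simp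
  have Rp: "R powr - (n + 2 * s) = X powr (-2 * s / n) / X"
  proof -
    have "R powr - (n + 2 * s) = X powr (-2 * s / n + - 1)"
      unfolding R_def powr_powr by (rule arg_cong[where f="\<lambda>e. X powr e"]) (use n_pos in \<open>simp add: field_simps\<close>)
    also have "\<dots> = X powr (-2 * s / n) / X" using X by (subst powr_add) (simp add: powr_minus_divide)
    finally show ?thesis .
  qed
  have Xp: "X powr (-2 * s / n) = (2 * 2 powr p / \<omega>) powr (- 2 * s / n) * I powr (- 2 * s / n) * t powr (2 * s * p / n)"
  proof -
    have "X = (2 * 2 powr p / \<omega>) * I * t powr (- p)" by (simp add: X_def powr_minus field_simps)
    then have "X powr (-2 * s / n) = (2 * 2 powr p / \<omega>) powr (-2 * s / n) * I powr (-2 * s / n) * (t powr (- p)) powr (-2 * s / n)"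
      using \<omega> I(2) by (simp only: powr_mult)
    then show ?thesis by (simp only: powr_powr) (simp add: mult.commute)
  qed
  have tp: "t\<^sup>2 * t powr (2 * s * p / n) = t powr p"
    using t by (subst p_exponent[symmetric]) (simp add: powr_add)
  have "(t/2)\<^sup>2 * (k0 * R powr - (n + 2 * s)) * (X * \<omega> / 2) = k0 * \<omega> / 8 * (t\<^sup>2 * X powr (-2 * s / n))"
    unfolding Rp using X by (simp add: power2_eq_square)
  also have "t\<^sup>2 * X powr (-2 * s / n) = (2 * 2 powr p / \<omega>) powr (- 2 * s / n) * I powr (- 2 * s / n) * (t\<^sup>2 * t powr (2 * s * p / n))"
    unfolding Xp by simp
  finally have "(t/2)\<^sup>2 * (k0 * R powr - (n + 2 * s)) * (X * \<omega> / 2) = c_sob * I powr (- 2 * s / n) * t powr p"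
    unfolding tp c_sob_def \<omega>_def by simp
  then show ?thesis using * by (simp add: t_def)
qed simp

text \<open>
  Integrating the pointwise estimate over \<open>x\<close> bounds \<open>I powr (1 - 2 * s / n)\<close>, that is
  \<open>I powr (2 / p)\<close>, by the energy. Dividing by a power of \<open>I\<close> requires \<open>I\<close> to be finite.
\<close>

lemma sobolev_integrable:
  assumes u[measurable]: "u \<in> borel_measurable borel" and int: "integrable lborel (\<lambda>x. \<bar>u x\<bar> powr p)"
    and e: "(\<integral>\<^sup>+x. local_energy u x \<partial>lborel) \<le> ennreal e" "0 \<le> e"
  shows "(\<integral>x. \<bar>u x\<bar> powr p \<partial>lborel) \<le> (e / c_sob) powr (p / 2)"
proof -
  define I where "I = (\<integral>x. \<bar>u x\<bar> powr p \<partial>lborel)"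
  have "0 \<le> I" by (simp add: I_def)
  show ?thesis
  proof (cases "I = 0")
    case False
    then have I: "0 < I" using \<open>0 \<le> I\<close> by simp
    have "ennreal (c_sob * I powr (- 2 * s / n) * I) = ennreal (c_sob * I powr (- 2 * s / n)) * ennreal I"
      using c_sob_pos I by (subst ennreal_mult) auto
    also have "ennreal I = (\<integral>\<^sup>+x. ennreal (\<bar>u x\<bar> powr p) \<partial>lborel)"
      unfolding I_def using int by (subst nn_integral_eq_integral) auto
    also have "ennreal (c_sob * I powr (- 2 * s / n)) * \<dots> =
       (\<integral>\<^sup>+x. ennreal (c_sob * I powr (- 2 * s / n) * \<bar>u x\<bar> powr p) \<partial>lborel)"
      using c_sob_pos by (subst nn_integral_cmult[symmetric]) (auto simp: ennreal_mult)
    also have "\<dots> \<le> (\<integral>\<^sup>+x. local_energy u x \<partial>lborel)"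
      using pointwise_sobolev[OF u int I_def I] by (intro nn_integral_mono) auto
    also have "\<dots> \<le> ennreal e" by fact
    finally have "c_sob * I powr (- 2 * s / n) * I \<le> e" using e by simp
    moreover have "I powr (- 2 * s / n) * I = I powr (2 / p)"
      using I p_half powr_add[of I "- 2 * s / n" 1] by simp
    ultimately have "c_sob * I powr (2 / p) \<le> e"
      by (simp add: mult.assoc)
    then have "I powr (2 / p) \<le> e / c_sob"
      using c_sob_pos by (simp add: field_simps)
    then have "(I powr (2 / p)) powr (p / 2) \<le> (e / c_sob) powr (p / 2)"
      using p_gt2 by (intro powr_mono2) auto
    then show ?thesis using I p_gt2 by (simp add: powr_powr I_def)
  qed (simp flip: I_def)
qed

text \<open>
  Bounded truncations have finite integrals because \<open>\<Omega>\<close> has finite measure, and truncation does not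
  increase the energy; Fatou's lemma removes the truncation.
\<close>

lemma sobolev_borel:
  assumes u[measurable]: "u \<in> borel_measurable borel" and off: "\<And>x. x \<notin> \<Omega> \<Longrightarrow> u x = 0"
    and e: "(\<integral>\<^sup>+x. local_energy u x \<partial>lborel) \<le> ennreal e" "0 \<le> e"
  shows "integrable lborel (\<lambda>x. \<bar>u x\<bar> powr p)"
    and "(\<integral>x. \<bar>u x\<bar> powr p \<partial>lborel) \<le> (e / c_sob) powr (p / 2)"
proof -
  define w where "w m x = max (- real m) (min (real m) (u x))" for m x
  have [measurable]: "w m \<in> borel_measurable borel" for m unfolding w_def[abs_def] by measurable
  have bound: "\<bar>w m x\<bar> powr p \<le> indicator \<Omega> x * real m powr p" for m x
    using off[of x] p_gt2 by (auto simp: w_def indicator_def intro!: powr_mono2)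
  have wint: "integrable lborel (\<lambda>x. \<bar>w m x\<bar> powr p)" for m
  proof (rule Bochner_Integration.integrable_bound)
    show "integrable lborel (\<lambda>x. indicator \<Omega> x * real m powr p)" using \<Omega>_fin by simp
    show "AE x in lborel. norm (\<bar>w m x\<bar> powr p) \<le> norm (indicator \<Omega> x * real m powr p)"
      using bound by (auto intro!: AE_I2 order_trans[OF bound])
  qed simp
  have "(\<integral>\<^sup>+x. local_energy (w m) x \<partial>lborel) \<le> ennreal e" for m
  proof (rule order_trans[OF _ e(1)])
    have "\<bar>w m x - w m y\<bar> \<le> \<bar>u x - u y\<bar>" for x y unfolding w_def by linarith
    then have "(w m x - w m y)\<^sup>2 \<le> (u x - u y)\<^sup>2" for x y by (simp add: abs_le_square_iff)
    then show "(\<integral>\<^sup>+x. local_energy (w m) x \<partial>lborel) \<le> (\<integral>\<^sup>+x. local_energy u x \<partial>lborel)"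
      unfolding local_energy_def by (intro nn_integral_mono ennreal_leI mult_right_mono K_nonneg) auto
  qed
  then have b: "(\<integral>x. \<bar>w m x\<bar> powr p \<partial>lborel) \<le> (e / c_sob) powr (p / 2)" for m
    using sobolev_integrable[OF _ wint _ e(2)] by auto
  have *: "(\<integral>\<^sup>+x. ennreal (\<bar>u x\<bar> powr p) \<partial>lborel) \<le> ennreal ((e / c_sob) powr (p / 2))"
  proof (rule nn_integral_Fatou_bound[where f = "\<lambda>m x. \<bar>w m x\<bar> powr p"])
    show "AE x in lborel. (\<lambda>m. \<bar>w m x\<bar> powr p) \<longlonglongrightarrow> \<bar>u x\<bar> powr p"
    proof (intro AE_I2)
      fix x
      have "\<forall>\<^sub>F m in sequentially. w m x = u x"
        using eventually_ge_at_top[of "nat \<lceil>\<bar>u x\<bar>\<rceil>"] by eventually_elim (auto simp: w_def; linarith)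
      then show "(\<lambda>m. \<bar>w m x\<bar> powr p) \<longlonglongrightarrow> \<bar>u x\<bar> powr p"
        by (intro tendsto_eventually) (auto elim: eventually_mono)
    qed
    show "\<forall>\<^sub>F m in sequentially. (\<integral>\<^sup>+x. ennreal (\<bar>w m x\<bar> powr p) \<partial>lborel) \<le> ennreal ((e / c_sob) powr (p / 2))"
      using b wint by (auto simp: nn_integral_eq_integral intro!: always_eventually ennreal_leI)
  qed simp
  then show int: "integrable lborel (\<lambda>x. \<bar>u x\<bar> powr p)"
    by (intro integrableI_bounded) (auto simp: le_less_trans)
  show "(\<integral>x. \<bar>u x\<bar> powr p \<partial>lborel) \<le> (e / c_sob) powr (p / 2)"
    using * int by (simp add: nn_integral_eq_integral)
qed

section \<open>Functions of finite energy\<close>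

text \<open>
  The scalar product of the problem is the \<open>L\<^sup>2\<close> product of increments for this measure.
\<close>

definition K_measure :: "('a \<times> 'a) measure" where
  "K_measure = density lebesgue (\<lambda>z. ennreal (K (fst z - snd z)))"

definition incr :: "('a \<Rightarrow> real) \<Rightarrow> 'a \<times> 'a \<Rightarrow> real" where
  "incr u z = u (fst z) - u (snd z)"

text \<open>
  Square integrability of \<open>u\<close> is left out, since the Sobolev inequality implies it.
\<close>

definition X0 :: "('a \<Rightarrow> real) set" where
  "X0 = {u \<in> borel_measurable lebesgue. (AE x in lebesgue. x \<notin> \<Omega> \<longrightarrow> u x = 0) \<and>
     integrable K_measure (\<lambda>z. (incr u z)\<^sup>2)}"

definition form :: "('a \<Rightarrow> real) \<Rightarrow> ('a \<Rightarrow> real) \<Rightarrow> real" where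
  "form u v = (\<integral>z. incr u z * incr v z \<partial>K_measure)"

definition energy :: "('a \<Rightarrow> real) \<Rightarrow> real" where
  "energy u = (\<integral>z. (incr u z)\<^sup>2 \<partial>K_measure)"

lemma energy_form: "form u u = energy u"
  by (simp add: form_def energy_def power2_eq_square)

lemma energy_nonneg: "0 \<le> energy u"
  by (simp add: energy_def)

lemma K_difference_measurable: "(\<lambda>z. K (fst z - snd z)) \<in> borel_measurable (borel :: ('a \<times> 'a) measure)"
  by (rule measurable_compose[OF borel_measurable_fst_minus_snd K_borel])

lemma K_difference_lebesgue: "(\<lambda>z. K (fst z - snd z)) \<in> borel_measurable (lebesgue :: ('a \<times> 'a) measure)"
  using K_difference_measurable by (intro measurable_completion) simp

lemma K_difference_ennreal: "(\<lambda>z. ennreal (K (fst z - snd z))) \<in> borel_measurable (lebesgue :: ('a \<times> 'a) measure)"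
  using K_difference_lebesgue by simp

lemma sets_K_measure[measurable_cong, simp]: "sets K_measure = sets lebesgue"
  by (simp add: K_measure_def)

lemma measurable_K_measure: "f \<in> borel_measurable lebesgue \<Longrightarrow> f \<in> borel_measurable K_measure"
  by (simp add: K_measure_def)

lemma incr_measurable[measurable]:
  "u \<in> borel_measurable lebesgue \<Longrightarrow> incr u \<in> borel_measurable K_measure"
  unfolding incr_def[abs_def]
  by (intro borel_measurable_diff measurable_K_measure borel_measurable_lebesgue_fst borel_measurable_lebesgue_snd)

lemma AE_K_measure: "AE z in lebesgue. P z \<Longrightarrow> AE z in K_measure. P z"
  unfolding K_measure_def by (subst AE_density[OF K_difference_ennreal]) (auto elim: eventually_mono)

lemma AE_K_measure_pair:
  assumes "AE x in lebesgue. P x"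
  shows "AE z in K_measure. P (fst z) \<and> P (snd z)"
  using AE_K_measure[OF AE_lebesgue_fst[OF assms]] AE_K_measure[OF AE_lebesgue_snd[OF assms]] by eventually_elim simp

lemma X0_measurable: "u \<in> X0 \<Longrightarrow> u \<in> borel_measurable lebesgue" by (simp add: X0_def)

lemma X0_off: "u \<in> X0 \<Longrightarrow> AE x in lebesgue. x \<notin> \<Omega> \<longrightarrow> u x = 0" by (simp add: X0_def)

lemma X0_integrable: "u \<in> X0 \<Longrightarrow> integrable K_measure (\<lambda>z. (incr u z)\<^sup>2)" by (simp add: X0_def)

lemma nn_energy:
  "u \<in> X0 \<Longrightarrow> (\<integral>\<^sup>+z. ennreal ((incr u z)\<^sup>2) \<partial>K_measure) = ennreal (energy u)"
  unfolding energy_def using X0_integrable by (intro nn_integral_eq_integral) auto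

lemma nn_energy_eq_local_energy:
  assumes [measurable]: "u \<in> borel_measurable borel"
  shows "(\<integral>\<^sup>+z. ennreal ((incr u z)\<^sup>2) \<partial>K_measure) = (\<integral>\<^sup>+x. local_energy u x \<partial>lborel)"
proof -
  have m: "incr u \<in> borel_measurable borel"
    unfolding incr_def[abs_def]
    by (intro borel_measurable_diff measurable_compose[OF borel_measurable_fst assms]
        measurable_compose[OF borel_measurable_snd assms])
  have gm: "(\<lambda>z. ennreal ((incr u z)\<^sup>2 * K (fst z - snd z))) \<in> borel_measurable borel"
    by (intro measurable_compose[OF _ measurable_ennreal] borel_measurable_times
        borel_measurable_power m K_difference_measurable)
  have "(\<integral>\<^sup>+z. ennreal ((incr u z)\<^sup>2) \<partial>K_measure)
      = (\<integral>\<^sup>+z. ennreal (K (fst z - snd z)) * ennreal ((incr u z)\<^sup>2) \<partial>lebesgue)"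
    unfolding K_measure_def using m
    by (intro nn_integral_density[OF K_difference_ennreal] measurable_completion) auto
  also have "\<dots> = (\<integral>\<^sup>+z. ennreal ((incr u z)\<^sup>2 * K (fst z - snd z)) \<partial>lebesgue)"
    using K_nonneg by (simp add: ennreal_mult mult.commute)
  also have "\<dots> = (\<integral>\<^sup>+x. local_energy u x \<partial>lborel)"
    using nn_integral_lebesgue_pair[OF gm] by (simp add: local_energy_def incr_def)
  finally show ?thesis .
qed

lemma X0_borel_representative:
  assumes u: "u \<in> X0"
  obtains u' where "u' \<in> borel_measurable borel" "\<And>x. x \<notin> \<Omega> \<Longrightarrow> u' x = 0"
    "AE x in lebesgue. u x = u' x" "(\<integral>\<^sup>+x. local_energy u' x \<partial>lborel) = ennreal (energy u)"
proof -
  obtain v where v[measurable]: "v \<in> borel_measurable borel" and uv: "AE x in lebesgue. u x = v x"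
    using lebesgue_ex_borel[OF X0_measurable[OF u]] by blast
  define u' where "u' x = v x * indicator \<Omega> x" for x
  have m[measurable]: "u' \<in> borel_measurable borel" unfolding u'_def[abs_def] by measurable
  have ae: "AE x in lebesgue. u x = u' x"
    using uv X0_off[OF u] by eventually_elim (auto simp: u'_def indicator_def)
  have "(\<integral>\<^sup>+z. ennreal ((incr u z)\<^sup>2) \<partial>K_measure) = (\<integral>\<^sup>+z. ennreal ((incr u' z)\<^sup>2) \<partial>K_measure)"
  proof (rule nn_integral_cong_AE)
    show "AE z in K_measure. ennreal ((incr u z)\<^sup>2) = ennreal ((incr u' z)\<^sup>2)"
      using AE_K_measure_pair[OF ae] by eventually_elim (simp add: incr_def)
  qed
  then have "(\<integral>\<^sup>+x. local_energy u' x \<partial>lborel) = ennreal (energy u)"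
    using nn_energy[OF u] nn_energy_eq_local_energy[OF m] by simp
  then show thesis using that[OF m _ ae] by (metis mult_zero_right u'_def indicator_simps(2))
qed

lemma sobolev:
  assumes "u \<in> X0"
  shows sobolev_integrable_powr: "integrable lebesgue (\<lambda>x. \<bar>u x\<bar> powr p)"
    and sobolev_inequality: "(\<integral>x. \<bar>u x\<bar> powr p \<partial>lebesgue) \<le> (energy u / c_sob) powr (p / 2)"
proof -
  obtain u' where u': "u' \<in> borel_measurable borel" "\<And>x. x \<notin> \<Omega> \<Longrightarrow> u' x = 0"
    and ae: "AE x in lebesgue. u x = u' x" and e: "(\<integral>\<^sup>+x. local_energy u' x \<partial>lborel) = ennreal (energy u)"
    using X0_borel_representative[OF assms] by blast
  have [measurable]: "u \<in> borel_measurable lebesgue" using assms by (rule X0_measurable)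
  have [measurable]: "u' \<in> borel_measurable borel" by fact
  have l: "(\<lambda>x. \<bar>u' x\<bar> powr p) \<in> borel_measurable lborel" by measurable
  have l': "(\<lambda>x. \<bar>u' x\<bar> powr p) \<in> borel_measurable lebesgue" by (rule measurable_completion[OF l])
  have ae': "AE x in lebesgue. \<bar>u' x\<bar> powr p = \<bar>u x\<bar> powr p" using ae by eventually_elim simp
  have "integrable lborel (\<lambda>x. \<bar>u' x\<bar> powr p)"
    using e by (intro sobolev_borel[OF u' _ energy_nonneg]) auto
  then have "integrable lebesgue (\<lambda>x. \<bar>u' x\<bar> powr p)" using l by (simp add: integrable_completion)
  then show "integrable lebesgue (\<lambda>x. \<bar>u x\<bar> powr p)"
    using integrable_cong_AE[OF l' _ ae'] by simp
  have "(\<integral>x. \<bar>u' x\<bar> powr p \<partial>lborel) \<le> (energy u / c_sob) powr (p / 2)"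
    using e by (intro sobolev_borel[OF u' _ energy_nonneg]) auto
  then show "(\<integral>x. \<bar>u x\<bar> powr p \<partial>lebesgue) \<le> (energy u / c_sob) powr (p / 2)"
    using integral_cong_AE[OF l' _ ae'] l by (simp add: integral_completion)
qed

lemma integrable_incr_mult:
  assumes "u \<in> X0" "v \<in> X0"
  shows "integrable K_measure (\<lambda>z. incr u z * incr v z)"
proof (rule Bochner_Integration.integrable_bound)
  show "integrable K_measure (\<lambda>z. (incr u z)\<^sup>2 + (incr v z)\<^sup>2)"
    using assms X0_integrable by auto
  show "(\<lambda>z. incr u z * incr v z) \<in> borel_measurable K_measure"
    using assms[THEN X0_measurable] by measurable
  have "\<bar>a * b\<bar> \<le> a\<^sup>2 + b\<^sup>2" for a b :: real
  proof -
    have "2 * \<bar>a\<bar> * \<bar>b\<bar> \<le> \<bar>a\<bar>\<^sup>2 + \<bar>b\<bar>\<^sup>2" by (rule sum_squares_bound)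
    moreover have "0 \<le> \<bar>a\<bar> * \<bar>b\<bar>" by simp
    ultimately show ?thesis unfolding abs_mult power2_abs by linarith
  qed
  then show "AE z in K_measure. norm (incr u z * incr v z) \<le> norm ((incr u z)\<^sup>2 + (incr v z)\<^sup>2)"
    by auto
qed

lemma incr_add_scaled: "incr (\<lambda>x. u x + c * v x) z = incr u z + c * incr v z"
  by (simp add: incr_def algebra_simps)

lemma X0_add_scaled:
  assumes "u \<in> X0" "v \<in> X0"
  shows "(\<lambda>x. u x + c * v x) \<in> X0"
    and energy_add_scaled: "energy (\<lambda>x. u x + c * v x) = energy u + 2 * c * form u v + c\<^sup>2 * energy v"
proof -
  have eq: "(incr (\<lambda>x. u x + c * v x) z)\<^sup>2 = (incr u z)\<^sup>2 + (2 * c) * (incr u z * incr v z) + c\<^sup>2 * (incr v z)\<^sup>2" for z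
    unfolding incr_add_scaled by (simp add: power2_eq_square algebra_simps)
  have i: "integrable K_measure (\<lambda>z. (incr u z)\<^sup>2)" "integrable K_measure (\<lambda>z. (incr v z)\<^sup>2)"
     "integrable K_measure (\<lambda>z. incr u z * incr v z)"
    using assms X0_integrable integrable_incr_mult by auto
  have "AE x in lebesgue. x \<notin> \<Omega> \<longrightarrow> u x + c * v x = 0"
    using X0_off[OF assms(1)] X0_off[OF assms(2)] by eventually_elim auto
  then show "(\<lambda>x. u x + c * v x) \<in> X0"
    using i assms[THEN X0_measurable] by (simp add: X0_def eq)
  show "energy (\<lambda>x. u x + c * v x) = energy u + 2 * c * form u v + c\<^sup>2 * energy v"
    unfolding energy_def eq form_def using i by simp
qed

lemma energy_diff_le:
  assumes "u \<in> X0" "v \<in> X0" "energy u \<le> E0" "energy v \<le> E0"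
  shows "energy (\<lambda>x. u x + (-1) * v x) \<le> 4 * E0"
proof -
  \<comment> \<open>the parallelogram law\<close>
  have "0 \<le> energy (\<lambda>x. u x + 1 * v x)" by (rule energy_nonneg)
  then show ?thesis unfolding energy_add_scaled[OF assms(1,2)] using assms(3,4) by simp
qed

text \<open>
  Absolute values and positive parts stay in the space and do not increase the energy, because they
  contract distances between values and fix \<open>0\<close>.
\<close>

lemma X0_contraction:
  assumes v: "v \<in> X0" and u: "u \<in> borel_measurable lebesgue"
    and le: "\<And>x y. \<bar>u x - u y\<bar> \<le> \<bar>v x - v y\<bar>" and z: "\<And>x. v x = 0 \<Longrightarrow> u x = 0"
  shows "u \<in> X0" and energy_contraction: "energy u \<le> energy v"
proof -
  have "(incr u z)\<^sup>2 \<le> (incr v z)\<^sup>2" for z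
    using le[of "fst z" "snd z"] by (simp add: incr_def abs_le_square_iff)
  note * = this
  have i: "integrable K_measure (\<lambda>z. (incr u z)\<^sup>2)"
    using u * by (intro Bochner_Integration.integrable_bound[OF X0_integrable[OF v]]) auto
  have "AE x in lebesgue. x \<notin> \<Omega> \<longrightarrow> u x = 0"
    using X0_off[OF v] z by (auto elim!: eventually_mono)
  then show "u \<in> X0" using u i by (simp add: X0_def)
  show "energy u \<le> energy v"
    unfolding energy_def using i X0_integrable[OF v] * by (intro integral_mono) auto
qed

lemma X0_abs: "v \<in> X0 \<Longrightarrow> (\<lambda>x. \<bar>v x\<bar>) \<in> X0"
  by (rule X0_contraction[where v = v]) (simp_all add: X0_measurable borel_measurable_abs)

lemma X0_pos_part:
  assumes "v \<in> X0"
  shows "(\<lambda>x. max 0 (v x)) \<in> X0" and energy_pos_part: "energy (\<lambda>x. max 0 (v x)) \<le> energy v"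
proof -
  have m: "(\<lambda>x. max 0 (v x)) \<in> borel_measurable lebesgue"
    by (intro borel_measurable_max X0_measurable[OF assms]) simp
  show "(\<lambda>x. max 0 (v x)) \<in> X0" by (rule X0_contraction[OF assms m]) auto
  show "energy (\<lambda>x. max 0 (v x)) \<le> energy v" by (rule energy_contraction[OF assms m]) auto
qed

lemma zero_X0: "(\<lambda>x. 0) \<in> X0" by (simp add: X0_def incr_def)

lemma energy_zero: "energy (\<lambda>x. 0) = 0" by (simp add: energy_def incr_def)

lemma X0_L1:
  assumes "u \<in> X0"
  shows "integrable lebesgue u" and "(\<integral>x. \<bar>u x\<bar> \<partial>lebesgue) \<le> measure lebesgue \<Omega> + (energy u / c_sob) powr (p / 2)"
proof -
  have fin: "integrable lebesgue (indicator \<Omega> :: 'a \<Rightarrow> real)"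
    using \<Omega>_fin by (auto simp: integrable_indicator_iff)
  have i: "integrable lebesgue (\<lambda>x. indicator \<Omega> x + \<bar>u x\<bar> powr p)"
    using fin sobolev_integrable_powr[OF assms] by simp
  have le: "AE x in lebesgue. \<bar>u x\<bar> \<le> indicator \<Omega> x + \<bar>u x\<bar> powr p"
    using X0_off[OF assms]
  proof eventually_elim
    case (elim x)
    have "\<bar>u x\<bar> \<le> 1 + \<bar>u x\<bar> powr p"
    proof (cases "\<bar>u x\<bar> \<le> 1")
      case False
      then have "\<bar>u x\<bar> powr 1 \<le> \<bar>u x\<bar> powr p" using p_gt2 by (intro powr_mono) auto
      then show ?thesis using False by simp
    qed (simp add: add_increasing2)
    then show ?case using elim by (auto simp: indicator_def)
  qed
  then have "AE x in lebesgue. norm (u x) \<le> norm (indicator \<Omega> x + \<bar>u x\<bar> powr p)"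
    by eventually_elim auto
  with i show "integrable lebesgue u"
    by (rule Bochner_Integration.integrable_bound[OF _ X0_measurable[OF assms]])
  then have "(\<integral>x. \<bar>u x\<bar> \<partial>lebesgue) \<le> (\<integral>x. indicator \<Omega> x + \<bar>u x\<bar> powr p \<partial>lebesgue)"
    using i le by (intro integral_mono_AE) auto
  also have "\<dots> \<le> measure lebesgue \<Omega> + (energy u / c_sob) powr (p / 2)"
    using fin sobolev_integrable_powr[OF assms] sobolev_inequality[OF assms] by simp
  finally show "(\<integral>x. \<bar>u x\<bar> \<partial>lebesgue) \<le> measure lebesgue \<Omega> + (energy u / c_sob) powr (p / 2)" .
qed

text \<open>
  Fatou's lemma makes balls of the space closed under almost everywhere convergence; this takes the
  place of weak compactness in the Hilbert space.
\<close>

lemma X0_closed_AE: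
  assumes U: "\<And>j. U j \<in> X0" and e: "\<And>j. energy (U j) \<le> E0"
    and u: "u \<in> borel_measurable lebesgue" and lim: "AE x in lebesgue. (\<lambda>j. U j x) \<longlonglongrightarrow> u x"
  shows "u \<in> X0" "energy u \<le> E0"
proof -
  have E0: "0 \<le> E0" using e[of 0] energy_nonneg[of "U 0"] by linarith
  have [measurable]: "incr u \<in> borel_measurable K_measure" "\<And>j. incr (U j) \<in> borel_measurable K_measure"
    using incr_measurable[OF u] incr_measurable[OF X0_measurable[OF U]] by auto
  have *: "(\<integral>\<^sup>+z. ennreal ((incr u z)\<^sup>2) \<partial>K_measure) \<le> ennreal E0"
  proof (rule nn_integral_Fatou_bound[where f = "\<lambda>j z. (incr (U j) z)\<^sup>2"])
    show "AE z in K_measure. (\<lambda>j. (incr (U j) z)\<^sup>2) \<longlonglongrightarrow> (incr u z)\<^sup>2"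
      using AE_K_measure_pair[OF lim] unfolding incr_def
      by eventually_elim (intro tendsto_power tendsto_diff; simp)
    show "\<forall>\<^sub>F j in sequentially. (\<integral>\<^sup>+z. ennreal ((incr (U j) z)\<^sup>2) \<partial>K_measure) \<le> ennreal E0"
      using e by (auto simp: nn_energy[OF U] intro!: always_eventually ennreal_leI)
  qed simp
  have i: "integrable K_measure (\<lambda>z. (incr u z)\<^sup>2)"
    using * by (intro integrableI_bounded) (auto simp: le_less_trans)
  have "AE x in lebesgue. \<forall>j. x \<notin> \<Omega> \<longrightarrow> U j x = 0"
    unfolding AE_all_countable using X0_off[OF U] by blast
  then have "AE x in lebesgue. x \<notin> \<Omega> \<longrightarrow> u x = 0"
    using lim
  proof eventually_elim
    case (elim x)
    show ?case
    proof
      assume "x \<notin> \<Omega>"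
      then have "(\<lambda>j. U j x) = (\<lambda>j. 0)" using elim by auto
      then show "u x = 0" using elim(2) LIMSEQ_unique[OF _ tendsto_const] by metis
    qed
  qed
  then show uH: "u \<in> X0" using u i by (simp add: X0_def)
  show "energy u \<le> E0" using * E0 by (simp add: nn_energy[OF uH])
qed

section \<open>Compactness almost everywhere\<close>

text \<open>
  The value \<open>w x\<close> differs from the mean over the ball by the mean of \<open>w x - w y\<close>. Young's inequality
  \<open>\<bar>d\<bar> \<le> \<theta> / 2 + d\<^sup>2 / (2 * \<theta>)\<close> turns this mean into squared increments, and inside the ball the kernel
  is at least \<open>k0 * (2 * h) powr - (n + 2 * s)\<close>.
\<close>

lemma pointwise_bound_by_ball_integral:
  assumes w[measurable]: "w \<in> borel_measurable borel" and int: "integrable lborel w"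
    and \<theta>: "0 < \<theta>" and h: "0 < h" and x: "x \<in> ball c h"
  defines "B \<equiv> measure lborel (ball c h)"
  shows "ennreal \<bar>w x\<bar> \<le> ennreal (\<bar>\<integral>y. indicator (ball c h) y * w y \<partial>lborel\<bar> / B + \<theta> / 2)
     + ennreal ((2 * h) powr (n + 2 * s) / (k0 * B) / (2 * \<theta>)) * local_energy w x"
proof -
  define b where "b = (2 * h) powr (n + 2 * s) / (k0 * B) / (2 * \<theta>)"
  have B: "B > 0" unfolding B_def using h by (rule content_ball_pos)
  have b: "b > 0" using B h k0_pos \<theta> by (simp add: b_def)
  have indB: "integrable lborel (indicator (ball c h) :: 'a \<Rightarrow> real)"
    using emeasure_lborel_ball_finite[of c h] by (simp add: integrable_indicator_iff)
  show ?thesis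
  proof (cases "local_energy w x = \<infinity>")
    case True
    then show ?thesis using b unfolding b_def[symmetric] by (simp add: ennreal_mult_top)
  next
    case False
    define f where "f y = (w x - w y)\<^sup>2 * K (x - y)" for y
    have fm[measurable]: "f \<in> borel_measurable lborel" unfolding f_def[abs_def] by measurable
    have f0: "0 \<le> f y" for y using K_nonneg by (simp add: f_def)
    have D: "local_energy w x = (\<integral>\<^sup>+y. ennreal (f y) \<partial>lborel)" by (simp add: local_energy_def f_def)
    then have fi: "integrable lborel f"
      using False f0 by (intro integrableI_nonneg) (auto simp: less_top)
    have Df: "local_energy w x = ennreal (\<integral>y. f y \<partial>lborel)"
      unfolding D using fi f0 by (intro nn_integral_eq_integral) auto
    let ?I = "indicator (ball c h) :: 'a \<Rightarrow> real" and ?q = "(2 * h) powr (n + 2 * s) / k0"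
    let ?A = "\<integral>y. ?I y * w y \<partial>lborel" and ?D = "\<integral>y. ?I y * (w x - w y) \<partial>lborel"
    let ?e = "\<lambda>y. \<theta> / 2 * ?I y + 1 / (2 * \<theta>) * (?q * f y)"
    have sq: "?I y * (w x - w y)\<^sup>2 \<le> ?q * f y" for y
    proof (cases "y \<in> ball c h \<and> x \<noteq> y")
      case True
      have "dist x y \<le> 2 * h" using True x dist_triangle[of x y c] by (simp add: dist_commute)
      then have "k0 * (2 * h) powr - (n + 2 * s) \<le> K (x - y)" using True by (intro K_ball_lower) auto
      then have "k0 / (2 * h) powr (n + 2 * s) \<le> K (x - y)"
        unfolding powr_minus_divide by simp
      moreover have "0 < (2 * h) powr (n + 2 * s)" using h by simp
      ultimately have "1 \<le> ?q * K (x - y)"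
        using k0_pos by (simp add: pos_divide_le_eq pos_le_divide_eq mult.commute)
      then have "(w x - w y)\<^sup>2 * 1 \<le> (w x - w y)\<^sup>2 * (?q * K (x - y))"
        by (intro mult_left_mono) auto
      then show ?thesis using True by (simp add: f_def algebra_simps)
    next
      case False
      have "0 \<le> ?q * f y"
        using f0 k0_pos by (intro mult_nonneg_nonneg divide_nonneg_pos) auto
      moreover have "?I y * (w x - w y)\<^sup>2 = 0" using False by (cases "x = y") (simp_all add: indicator_def)
      ultimately show ?thesis by linarith
    qed
    have wxi: "integrable lborel (\<lambda>y. ?I y * w x)" using indB by simp
    have wi: "integrable lborel (\<lambda>y. ?I y * w y)"
      using int by (intro Bochner_Integration.integrable_bound[OF int]) (auto simp: indicator_def)
    have "B * w x = (\<integral>y. ?I y * w x \<partial>lborel)" using indB by (simp add: B_def)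
    also have "\<dots> = (\<integral>y. ?I y * w y + ?I y * (w x - w y) \<partial>lborel)" by (simp add: algebra_simps)
    also have "\<dots> = ?A + ?D"
      using wxi wi by (intro Bochner_Integration.integral_add) (simp_all add: right_diff_distrib)
    finally have "B * \<bar>w x\<bar> \<le> \<bar>?A\<bar> + \<bar>?D\<bar>"
      using B abs_triangle_ineq[of "?A" "?D"]
      by (simp add: abs_mult[of B, symmetric] abs_mult)
    also have "\<bar>?D\<bar> \<le> (\<integral>y. ?e y \<partial>lborel)"
    proof -
      have "\<bar>?D\<bar> \<le> (\<integral>y. \<bar>?I y * (w x - w y)\<bar> \<partial>lborel)"
        using integral_norm_bound[of lborel "\<lambda>y. ?I y * (w x - w y)"] by simp
      also have "\<dots> \<le> (\<integral>y. ?e y \<partial>lborel)"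
      proof (rule integral_mono)
        show "integrable lborel (\<lambda>y. \<bar>?I y * (w x - w y)\<bar>)"
          using Bochner_Integration.integrable_diff[OF wxi wi]
          by (intro integrable_abs) (simp add: right_diff_distrib)
        show "integrable lborel ?e"
          using indB fi by simp
        fix y
        have "\<bar>d\<bar> \<le> \<theta> / 2 + 1 / (2 * \<theta>) * d\<^sup>2" for d
        proof -
          have "0 \<le> (\<bar>d\<bar> - \<theta>)\<^sup>2" by simp
          then have "2 * \<theta> * \<bar>d\<bar> \<le> \<theta> * \<theta> + d\<^sup>2" by (simp add: power2_eq_square algebra_simps)
          then show ?thesis using \<theta> by (simp add: field_simps)
        qed
        then have "\<bar>?I y * (w x - w y)\<bar> \<le> \<theta> / 2 * ?I y + 1 / (2 * \<theta>) * (?I y * (w x - w y)\<^sup>2)"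
          by (simp add: indicator_def)
        also have "\<dots> \<le> ?e y"
          using sq \<theta> by (intro add_left_mono mult_left_mono) auto
        finally show "\<bar>?I y * (w x - w y)\<bar> \<le> ?e y" .
      qed
      finally show ?thesis .
    qed
    also have "\<dots> = \<theta> / 2 * B + 1 / (2 * \<theta>) * (?q * (\<integral>y. f y \<partial>lborel))"
      using indB fi by (simp add: B_def)
    finally have "\<bar>w x\<bar> \<le> (\<bar>?A\<bar> +
        (\<theta> / 2 * B + 1 / (2 * \<theta>) * (?q * (\<integral>y. f y \<partial>lborel)))) / B"
      using B by (simp add: pos_le_divide_eq mult.commute)
    also have "\<dots> = (\<bar>?A\<bar> / B + \<theta> / 2) + b * (\<integral>y. f y \<partial>lborel)"
      using B by (simp add: b_def add_divide_distrib)
    finally have "\<bar>w x\<bar> \<le> (\<bar>?A\<bar> / B + \<theta> / 2) + b * (\<integral>y. f y \<partial>lborel)" .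
    then have "ennreal \<bar>w x\<bar> \<le> ennreal ((\<bar>?A\<bar> / B + \<theta> / 2) + b * (\<integral>y. f y \<partial>lborel))"
      by (rule ennreal_leI)
    also have "\<dots> = ennreal (\<bar>?A\<bar> / B + \<theta> / 2) + ennreal b * local_energy w x"
    proof -
      have "0 \<le> \<bar>?A\<bar> / B + \<theta> / 2" "0 \<le> b * (\<integral>y. f y \<partial>lborel)"
        using B \<theta> b f0 by (auto intro!: add_nonneg_nonneg mult_nonneg_nonneg)
      from ennreal_plus[OF this] show ?thesis
        unfolding Df using b by (simp only: ennreal_mult')
    qed
    finally show ?thesis unfolding b_def .
  qed
qed

definition ball_int :: "'a \<Rightarrow> real \<Rightarrow> ('a \<Rightarrow> real) \<Rightarrow> real" where
  "ball_int c h u = (\<integral>y. indicator (ball c h) y * u y \<partial>lebesgue)"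

text \<open>
  Balls of the covering may overlap: at each point only one ball that contains it is used, and its
  integral is estimated by the sum of all of them.
\<close>

lemma L1_bound_by_ball_integrals:
  assumes u: "u \<in> X0" and \<theta>: "0 < \<theta>" and h: "0 < h" and T: "finite T" "\<Omega> \<subseteq> (\<Union>c\<in>T. ball c h)"
  defines "B \<equiv> h ^ DIM('a) * measure lborel (ball (0::'a) 1)"
  shows "(\<integral>x. \<bar>u x\<bar> \<partial>lebesgue) \<le> measure lebesgue \<Omega> * ((\<Sum>c\<in>T. \<bar>ball_int c h u\<bar>) / B + \<theta> / 2)
     + (2 * h) powr (n + 2 * s) / (k0 * B) / (2 * \<theta>) * energy u"
proof -
  have Beq: "measure lborel (ball c h) = B" for c :: 'a
    unfolding B_def using content_ball_conv_unit_ball[of h c] h by simp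
  have B: "B > 0" using content_ball_pos[OF h, of "0::'a"] unfolding Beq .
  obtain w where w: "w \<in> borel_measurable borel" "\<And>x. x \<notin> \<Omega> \<Longrightarrow> w x = 0"
    and ae: "AE x in lebesgue. u x = w x" and e: "(\<integral>\<^sup>+x. local_energy w x \<partial>lborel) = ennreal (energy u)"
    using X0_borel_representative[OF u] by blast
  have wm[measurable]: "w \<in> borel_measurable borel" by fact
  have wl[measurable]: "w \<in> borel_measurable lebesgue" using wm by (intro measurable_completion) simp
  have um[measurable]: "u \<in> borel_measurable lebesgue" using u by (rule X0_measurable)
  have wi: "integrable lborel w"
  proof -
    have "integrable lebesgue w" using integrable_cong_AE[OF um wl ae] X0_L1[OF u] by simp
    then show ?thesis by (simp add: integrable_completion)
  qed
  have ball_int: "(\<integral>y. indicator (ball c h) y * w y \<partial>lborel) = ball_int c h u" for c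
  proof -
    have "ball_int c h u = (\<integral>y. indicator (ball c h) y * w y \<partial>lebesgue)"
      unfolding ball_int_def
    proof (rule integral_cong_AE)
      show "AE y in lebesgue. indicator (ball c h) y * u y = indicator (ball c h) y * w y"
        using ae by eventually_elim simp
    qed (intro borel_measurable_times borel_measurable_indicator um wl; simp)+
    also have "\<dots> = (\<integral>y. indicator (ball c h) y * w y \<partial>lborel)"
    proof (rule integral_completion)
      have [measurable]: "ball c h \<in> sets borel" by simp
      show "(\<lambda>y. indicator (ball c h) y * w y) \<in> borel_measurable lborel" by measurable
    qed
    finally show ?thesis ..
  qed
  define a where "a = (\<Sum>c\<in>T. \<bar>ball_int c h u\<bar>) / B + \<theta> / 2"
  define b where "b = (2 * h) powr (n + 2 * s) / (k0 * B) / (2 * \<theta>)"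
  have a: "a \<ge> 0" using B \<theta> by (auto simp: a_def intro!: add_nonneg_nonneg sum_nonneg divide_nonneg_nonneg)
  have b: "b \<ge> 0" using B k0_pos \<theta> by (simp add: b_def)
  have pt: "ennreal \<bar>w x\<bar> \<le> ennreal a * indicator \<Omega> x + ennreal b * local_energy w x" for x
  proof (cases "x \<in> \<Omega>")
    case True
    then obtain c where c: "c \<in> T" "x \<in> ball c h" using T by auto
    have "\<bar>ball_int c h u\<bar> \<le> (\<Sum>c\<in>T. \<bar>ball_int c h u\<bar>)" using c T by (intro member_le_sum) auto
    then have "\<bar>ball_int c h u\<bar> / B + \<theta> / 2 \<le> a" using B by (simp add: a_def divide_right_mono)
    then have "ennreal \<bar>w x\<bar> \<le> ennreal a + ennreal b * local_energy w x"
      using pointwise_bound_by_ball_integral[OF wm wi \<theta> h c(2)] unfolding Beq ball_int b_def[symmetric]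
      by (meson add_right_mono ennreal_leI order_trans)
    then show ?thesis using True by simp
  qed (simp add: w(2))
  have "ennreal (\<integral>x. \<bar>w x\<bar> \<partial>lborel) = (\<integral>\<^sup>+x. ennreal \<bar>w x\<bar> \<partial>lborel)"
    using wi by (intro nn_integral_eq_integral[symmetric]) auto
  also have "\<dots> \<le> (\<integral>\<^sup>+x. ennreal a * indicator \<Omega> x + ennreal b * local_energy w x \<partial>lborel)"
    using pt by (intro nn_integral_mono)
  also have "\<dots> = ennreal a * emeasure lborel \<Omega> + ennreal b * ennreal (energy u)"
    by (subst nn_integral_add) (auto simp: nn_integral_cmult nn_integral_cmult_indicator e)
  also have "emeasure lborel \<Omega> = ennreal (measure lebesgue \<Omega>)"
    using \<Omega>_fin by (simp add: emeasure_eq_ennreal_measure less_top)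
  also have "ennreal a * ennreal (measure lebesgue \<Omega>) + ennreal b * ennreal (energy u) =
      ennreal (a * measure lebesgue \<Omega> + b * energy u)"
  proof -
    have "0 \<le> a * measure lebesgue \<Omega>" "0 \<le> b * energy u" using a b energy_nonneg by auto
    then have "ennreal (a * measure lebesgue \<Omega> + b * energy u)
        = ennreal (a * measure lebesgue \<Omega>) + ennreal (b * energy u)" by (rule ennreal_plus)
    then show ?thesis using a b by (simp only: ennreal_mult')
  qed
  finally have "(\<integral>x. \<bar>w x\<bar> \<partial>lborel) \<le> a * measure lebesgue \<Omega> + b * energy u"
  proof (rule iffD1[OF ennreal_le_iff, rotated])
    show "0 \<le> a * measure lebesgue \<Omega> + b * energy u"
      using a b energy_nonneg by (intro add_nonneg_nonneg mult_nonneg_nonneg) auto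
  qed
  moreover have "(\<integral>x. \<bar>u x\<bar> \<partial>lebesgue) = (\<integral>x. \<bar>w x\<bar> \<partial>lborel)"
  proof -
    have "(\<integral>x. \<bar>u x\<bar> \<partial>lebesgue) = (\<integral>x. \<bar>w x\<bar> \<partial>lebesgue)"
      using ae um wl by (intro integral_cong_AE) auto
    also have "\<dots> = (\<integral>x. \<bar>w x\<bar> \<partial>lborel)" by (rule integral_completion) simp
    finally show ?thesis .
  qed
  ultimately show ?thesis unfolding a_def b_def by (simp only: mult.commute[of _ "measure lebesgue \<Omega>"])
qed

text \<open>
  In the preceding bound the factor of the energy is of order \<open>h powr (2 * s) / \<theta>\<close>; so \<open>\<theta>\<close> is chosen
  first, then \<open>h\<close>, and finally the finite covering by balls of radius \<open>h\<close>.
\<close>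

lemma L1_controlled_by_ball_integrals:
  assumes \<epsilon>: "0 < \<epsilon>" and E0: "0 \<le> E0"
  obtains T :: "'a set" and h C where "finite T" "0 < h" "0 \<le> C"
    "\<And>u. u \<in> X0 \<Longrightarrow> energy u \<le> E0 \<Longrightarrow>
       (\<integral>x. \<bar>u x\<bar> \<partial>lebesgue) \<le> \<epsilon> + C * (\<Sum>c\<in>T. \<bar>ball_int c h u\<bar>)"
proof -
  define V where "V = measure lebesgue \<Omega>"
  have V: "0 \<le> V" by (simp add: V_def)
  define \<omega> where "\<omega> = measure lborel (ball (0::'a) 1)"
  have \<omega>: "\<omega> > 0" unfolding \<omega>_def by (rule unit_ball_pos)
  define \<theta> where "\<theta> = \<epsilon> / (V + 1)"
  have \<theta>: "\<theta> > 0" using \<epsilon> V by (simp add: \<theta>_def)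
  define A where "A = 2 powr (n + 2 * s) / (k0 * \<omega>) / (2 * \<theta>)"
  have A: "A > 0" using \<omega> \<theta> k0_pos by (simp add: A_def)
  \<comment> \<open>solves \<open>A * h powr (2 * s) = \<epsilon> / (2 * (E0 + 1))\<close>\<close>
  define h where "h = (\<epsilon> / (2 * A * (E0 + 1))) powr (1 / (2 * s))"
  have h: "h > 0" using \<epsilon> A E0 by (simp add: h_def)
  have coef: "(2 * h) powr (n + 2 * s) / (k0 * (h ^ DIM('a) * \<omega>)) / (2 * \<theta>) = \<epsilon> / (2 * (E0 + 1))"
  proof -
    have "(2 * h) powr (n + 2 * s) = 2 powr (n + 2 * s) * (h powr n * h powr (2 * s))"
      using h by (simp only: powr_mult powr_add mult_ac)
    moreover have "h ^ DIM('a) = h powr n" using h by (simp add: powr_realpow n_eq)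
    moreover have "h powr n > 0" using h by simp
    ultimately have "(2 * h) powr (n + 2 * s) / (k0 * (h ^ DIM('a) * \<omega>)) / (2 * \<theta>) = A * h powr (2 * s)"
      by (simp add: A_def)
    also have "h powr (2 * s) = \<epsilon> / (2 * A * (E0 + 1))"
      using s01 \<epsilon> A E0 by (simp add: h_def powr_powr)
    also have "A * (\<epsilon> / (2 * A * (E0 + 1))) = \<epsilon> / (2 * (E0 + 1))" using A by simp
    finally show ?thesis .
  qed
  have "seq_compact (closure \<Omega>)" using \<Omega>_bounded compact_closure compact_eq_seq_compact_metric by blast
  from seq_compact_imp_totally_bounded[OF this] h obtain T
    where T: "finite T" "closure \<Omega> \<subseteq> (\<Union>c\<in>T. ball c h)" by blast
  have T': "\<Omega> \<subseteq> (\<Union>c\<in>T. ball c h)" using T closure_subset by blast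
  show thesis
  proof (rule that[of T h "V / (h ^ DIM('a) * \<omega>)"])
    show "finite T" "0 < h" by fact+
    show "0 \<le> V / (h ^ DIM('a) * \<omega>)" using V h \<omega> by simp
    fix u assume u: "u \<in> X0" and eu: "energy u \<le> E0"
    have "\<epsilon> / (2 * (E0 + 1)) * energy u \<le> \<epsilon> / (2 * (E0 + 1)) * (E0 + 1)"
      using eu \<epsilon> E0 by (intro mult_left_mono) auto
    also have "\<dots> = \<epsilon> / 2"
    proof -
      have "E0 + 1 \<noteq> 0" using E0 by simp
      then show ?thesis by (simp add: divide_simps)
    qed
    finally have 1: "\<epsilon> / (2 * (E0 + 1)) * energy u \<le> \<epsilon> / 2" .
    have "V * (\<theta> / 2) \<le> (V + 1) * (\<theta> / 2)" using \<theta> by (intro mult_right_mono) auto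
    also have "\<dots> = \<epsilon> / 2"
    proof -
      have "V + 1 \<noteq> 0" using V by simp
      then show ?thesis by (simp add: \<theta>_def divide_simps)
    qed
    finally have 2: "V * (\<theta> / 2) \<le> \<epsilon> / 2" .
    have "(\<integral>x. \<bar>u x\<bar> \<partial>lebesgue) \<le> V * ((\<Sum>c\<in>T. \<bar>ball_int c h u\<bar>) / (h ^ DIM('a) * \<omega>) + \<theta> / 2)
       + \<epsilon> / (2 * (E0 + 1)) * energy u"
      using L1_bound_by_ball_integrals[OF u \<theta> h T(1) T'] unfolding V_def[symmetric] \<omega>_def[symmetric] coef .
    also have "\<dots> = V * (\<Sum>c\<in>T. \<bar>ball_int c h u\<bar>) / (h ^ DIM('a) * \<omega>) + V * (\<theta> / 2) + \<epsilon> / (2 * (E0 + 1)) * energy u"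
      by (simp add: distrib_left)
    finally have "(\<integral>x. \<bar>u x\<bar> \<partial>lebesgue) \<le> \<epsilon> + V * (\<Sum>c\<in>T. \<bar>ball_int c h u\<bar>) / (h ^ DIM('a) * \<omega>)"
      using 1 2 by linarith
    then show "(\<integral>x. \<bar>u x\<bar> \<partial>lebesgue) \<le> \<epsilon> + V / (h ^ DIM('a) * \<omega>) * (\<Sum>c\<in>T. \<bar>ball_int c h u\<bar>)"
      by simp
  qed
qed

lemma ball_int_integrable:
  assumes "u \<in> X0"
  shows "integrable lebesgue (\<lambda>y. indicator (ball c h) y * u y)"
proof (rule Bochner_Integration.integrable_bound[OF X0_L1(1)[OF assms]])
  show "(\<lambda>y. indicator (ball c h) y * u y) \<in> borel_measurable lebesgue"
    by (intro borel_measurable_times borel_measurable_indicator X0_measurable assms) simp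
qed (simp add: indicator_def)

lemma ball_int_diff:
  assumes "u \<in> X0" "v \<in> X0"
  shows "ball_int c h (\<lambda>x. u x + (-1) * v x) = ball_int c h u - ball_int c h v"
proof -
  have "ball_int c h (\<lambda>x. u x + (-1) * v x) = (\<integral>y. indicator (ball c h) y * u y - indicator (ball c h) y * v y \<partial>lebesgue)"
    unfolding ball_int_def by (rule Bochner_Integration.integral_cong) (auto simp: algebra_simps)
  then show ?thesis unfolding ball_int_def using ball_int_integrable assms by simp
qed

lemma ball_int_bound:
  assumes "u \<in> X0"
  shows "\<bar>ball_int c h u\<bar> \<le> (\<integral>x. \<bar>u x\<bar> \<partial>lebesgue)"
proof -
  have "\<bar>ball_int c h u\<bar> \<le> (\<integral>y. norm (indicator (ball c h) y * u y) \<partial>lebesgue)"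
    unfolding ball_int_def real_norm_def[symmetric] by (rule integral_norm_bound)
  also have "\<dots> \<le> (\<integral>x. \<bar>u x\<bar> \<partial>lebesgue)"
    using ball_int_integrable[OF assms] X0_L1(1)[OF assms]
    by (intro integral_mono) (auto simp: indicator_def)
  finally show ?thesis .
qed

text \<open>
  Only countably many balls occur in the preceding lemma when \<open>\<epsilon>\<close> runs through the numbers
  \<open>1 / Suc m\<close>. A diagonal subsequence makes all integrals over these balls converge, hence is Cauchy
  in \<open>L\<^sup>1\<close>, and a further subsequence is Cauchy almost everywhere.
\<close>

theorem bounded_energy_AE_Cauchy_subsequence:
  assumes U: "\<And>j. U j \<in> X0" and e: "\<And>j. energy (U j) \<le> E0"
  obtains r where "strict_mono (r :: nat \<Rightarrow> nat)" "AE x in lebesgue. Cauchy (\<lambda>j. U (r j) x)"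
proof -
  have E0: "0 \<le> E0" using e[of 0] energy_nonneg[of "U 0"] by linarith
  define good where "good m T h C \<longleftrightarrow> finite T \<and> 0 < h \<and> 0 \<le> C \<and>
    (\<forall>u. u \<in> X0 \<longrightarrow> energy u \<le> 4 * E0 \<longrightarrow>
       (\<integral>x. \<bar>u x\<bar> \<partial>lebesgue) \<le> 1 / real (Suc m) + C * (\<Sum>c\<in>T. \<bar>ball_int c h u\<bar>))" for m :: nat and T :: "'a set" and h C
  have "\<exists>T h C. good m T h C" for m
  proof -
    have "0 < 1 / real (Suc m)" "0 \<le> 4 * E0" using E0 by auto
    from L1_controlled_by_ball_integrals[OF this] show ?thesis unfolding good_def by metis
  qed
  then obtain T h C where good: "\<And>m. good m (T m) (h m) (C m)" by metis
  define S where "S = (\<Union>m. (\<lambda>c. (c, h m)) ` T m)"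
  have "countable S"
    unfolding S_def
  proof (intro countable_UN[OF countableI_type] countable_image countable_finite)
    show "finite (T m)" for m using good[of m] by (simp add: good_def)
  qed
  define B where "B = measure lebesgue \<Omega> + (E0 / c_sob) powr (p / 2)"
  have "\<bar>ball_int c h (U j)\<bar> \<le> B" for c h j
  proof -
    have "\<bar>ball_int c h (U j)\<bar> \<le> measure lebesgue \<Omega> + (energy (U j) / c_sob) powr (p / 2)"
      using ball_int_bound[OF U] X0_L1(2)[OF U] by (rule order_trans)
    also have "\<dots> \<le> B" unfolding B_def
      using e energy_nonneg c_sob_pos p_gt2 by (intro add_left_mono powr_mono2 divide_right_mono) auto
    finally show ?thesis .
  qed
  then have "norm (ball_int (fst ch) (snd ch) (U j)) \<le> B" for ch j by simp
  from function_convergent_subsequence[OF \<open>countable S\<close>, of "\<lambda>j ch. ball_int (fst ch) (snd ch) (U j)", OF this]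
  obtain k where k: "strict_mono (k :: nat \<Rightarrow> nat)"
    and lim: "\<And>ch. ch \<in> S \<Longrightarrow> \<exists>l. (\<lambda>j. ball_int (fst ch) (snd ch) (U (k j))) \<longlonglongrightarrow> l" by blast
  have L1: "\<exists>N. \<forall>i\<ge>N. \<forall>j\<ge>N. (\<integral>x. norm (U (k i) x - U (k j) x) \<partial>lebesgue) < \<epsilon>" if \<epsilon>: "0 < \<epsilon>" for \<epsilon>
  proof -
    obtain m where m: "1 / real (Suc m) < \<epsilon> / 2" using \<epsilon> nat_approx_posE[of "\<epsilon> / 2"] by (metis half_gt_zero)
    have g: "finite (T m)" "0 \<le> C m" using good[of m] by (auto simp: good_def)
    define \<delta> where "\<delta> = \<epsilon> / (2 * (C m + 1) * (real (card (T m)) + 1))"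
    have \<delta>: "\<delta> > 0" using \<epsilon> g by (simp add: \<delta>_def)
    have "\<exists>N. \<forall>i\<ge>N. \<forall>j\<ge>N. \<bar>ball_int c (h m) (U (k i)) - ball_int c (h m) (U (k j))\<bar> < \<delta>" if "c \<in> T m" for c
    proof -
      have "(c, h m) \<in> S" using that by (auto simp: S_def)
      from lim[OF this] have "Cauchy (\<lambda>j. ball_int c (h m) (U (k j)))"
        by (auto intro: LIMSEQ_imp_Cauchy)
      then show ?thesis using \<delta> unfolding Cauchy_def dist_real_def by blast
    qed
    then obtain N where N: "\<And>c i j. c \<in> T m \<Longrightarrow> i \<ge> N c \<Longrightarrow> j \<ge> N c \<Longrightarrow> \<bar>ball_int c (h m) (U (k i)) - ball_int c (h m) (U (k j))\<bar> < \<delta>"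
      by metis
    define N0 where "N0 = Max (insert 0 (N ` T m))"
    have N0: "N c \<le> N0" if "c \<in> T m" for c using that g by (simp add: N0_def)
    have "(\<integral>x. norm (U (k i) x - U (k j) x) \<partial>lebesgue) < \<epsilon>" if ij: "i \<ge> N0" "j \<ge> N0" for i j
    proof -
      let ?w = "\<lambda>x. U (k i) x + (-1) * U (k j) x"
      have "(\<Sum>c\<in>T m. \<bar>ball_int c (h m) ?w\<bar>) \<le> (\<Sum>c\<in>T m. \<delta>)"
      proof (rule sum_mono)
        fix c assume c: "c \<in> T m"
        show "\<bar>ball_int c (h m) ?w\<bar> \<le> \<delta>"
          using N[OF c, of i j] N0[OF c] ij unfolding ball_int_diff[OF U U] by linarith
      qed
      also have "\<dots> = real (card (T m)) * \<delta>" by simp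
      finally have "C m * (\<Sum>c\<in>T m. \<bar>ball_int c (h m) ?w\<bar>) \<le> C m * (real (card (T m)) * \<delta>)"
        using g by (intro mult_left_mono)
      also have "\<dots> \<le> (C m + 1) * ((real (card (T m)) + 1) * \<delta>)"
        using g \<delta> by (intro mult_mono) auto
      also have "\<dots> = \<epsilon> / 2"
      proof -
        have "C m + 1 \<noteq> 0" "real (card (T m)) + 1 \<noteq> 0" using g by auto
        then show ?thesis by (simp add: \<delta>_def divide_simps)
      qed
      finally have "C m * (\<Sum>c\<in>T m. \<bar>ball_int c (h m) ?w\<bar>) \<le> \<epsilon> / 2" .
      moreover have "(\<integral>x. \<bar>?w x\<bar> \<partial>lebesgue) \<le> 1 / real (Suc m) + C m * (\<Sum>c\<in>T m. \<bar>ball_int c (h m) ?w\<bar>)"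
        using good[of m] X0_add_scaled(1)[OF U U] energy_diff_le[OF U U e e] unfolding good_def by blast
      ultimately show ?thesis using m by simp
    qed
    then show ?thesis by blast
  qed
  have "integrable lebesgue (U (k i))" for i by (rule X0_L1[OF U])
  from cauchy_L1_AE_cauchy_subseq[OF this L1]
  obtain r where r: "strict_mono r" "AE x in lebesgue. Cauchy (\<lambda>i. U (k (r i)) x)" by blast
  show thesis
  proof (rule that[of "k \<circ> r"])
    show "strict_mono (k \<circ> r)" using k r by (simp add: strict_mono_o)
    show "AE x in lebesgue. Cauchy (\<lambda>j. U ((k \<circ> r) j) x)" using r by simp
  qed
qed

section \<open>A positive function of finite energy\<close>

text \<open>
  The distance to the complement is Lipschitz and bounded, which suffices for finite energy because
  \<open>min (norm z\<^sup>2) 1 * K z\<close> is integrable. It is positive exactly on \<open>\<Omega>\<close>, so it shows that the space is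
  nontrivial and serves as the test function that detects zeros of a minimiser.
\<close>

definition bump :: "'a \<Rightarrow> real" where "bump x = infdist x (- \<Omega>)"

lemma compl_\<Omega>_ne: "- \<Omega> \<noteq> {}"
proof
  assume "- \<Omega> = {}"
  then have "\<Omega> = UNIV" by blast
  then show False using \<Omega>_bounded not_bounded_UNIV[where 'a='a] by simp
qed

lemma bump_pos: "x \<in> \<Omega> \<Longrightarrow> 0 < bump x"
  unfolding bump_def using \<Omega>_open compl_\<Omega>_ne by (intro infdist_pos_not_in_closed) auto

lemma bump_off: "x \<notin> \<Omega> \<Longrightarrow> bump x = 0"
  by (simp add: bump_def)

lemma bump_nonneg: "0 \<le> bump x" by (simp add: bump_def infdist_nonneg)

lemma bump_X0: "bump \<in> X0"
proof -
  obtain z where z: "z \<notin> \<Omega>" using compl_\<Omega>_ne by blast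
  obtain b where b: "\<And>x. x \<in> \<Omega> \<Longrightarrow> dist x z \<le> b" "0 \<le> b"
    using \<Omega>_bounded unfolding bounded_any_center[where a=z]
    by (metis dist_commute abs_ge_self abs_ge_zero order_trans)
  have bd: "bump x \<le> b" for x
    using infdist_le[of z "- \<Omega>" x] z b bump_off[of x] unfolding bump_def by (cases "x \<in> \<Omega>") force+
  have m[measurable]: "bump \<in> borel_measurable borel"
    unfolding bump_def[abs_def] by (intro borel_measurable_continuous_onI continuous_intros)
  define g where "g z = ennreal (min ((norm z)\<^sup>2) 1 * K z)" for z
  have gm[measurable]: "g \<in> borel_measurable borel" unfolding g_def[abs_def] by measurable
  have gfin: "(\<integral>\<^sup>+z. g z \<partial>lborel) < \<infinity>"
  proof -
    have "(\<integral>\<^sup>+z. g z \<partial>lebesgue) = (\<integral>\<^sup>+z. norm (min ((norm z)\<^sup>2) 1 * K z) \<partial>lebesgue)"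
      unfolding g_def using K_nonneg by (intro nn_integral_cong) (auto simp: abs_mult)
    also have "\<dots> < \<infinity>" using K_int by (simp add: integrable_iff_bounded)
    finally show ?thesis by (simp add: nn_integral_completion)
  qed
  \<comment> \<open>\<open>(bump x - bump y)\<^sup>2\<close> is at most \<open>norm (x - y)\<^sup>2\<close> and at most \<open>b\<^sup>2\<close>\<close>
  define C where "C = 1 + b\<^sup>2"
  have C: "C > 0" by (simp add: C_def add_pos_nonneg)
  have pt: "ennreal ((bump x - bump y)\<^sup>2 * K (x - y)) \<le> ennreal C * (indicator \<Omega> x * g (x - y)) + ennreal C * (indicator \<Omega> y * g (x - y))" for x y
  proof (cases "x \<in> \<Omega> \<or> y \<in> \<Omega>")
    case True
    have 1: "(bump x - bump y)\<^sup>2 \<le> (norm (x - y))\<^sup>2"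
      using infdist_triangle_abs[of x "- \<Omega>" y] unfolding bump_def dist_norm
      by (simp add: abs_le_square_iff[symmetric])
    have "\<bar>bump x - bump y\<bar> \<le> b" using bd[of x] bd[of y] bump_nonneg[of x] bump_nonneg[of y] by linarith
    then have 2: "(bump x - bump y)\<^sup>2 \<le> b\<^sup>2" using b by (simp add: abs_le_square_iff[symmetric])
    have "(bump x - bump y)\<^sup>2 \<le> C * min ((norm (x - y))\<^sup>2) 1"
    proof (cases "(norm (x - y))\<^sup>2 \<le> 1")
      case True
      have "(norm (x - y))\<^sup>2 * 1 \<le> (norm (x - y))\<^sup>2 * C" by (intro mult_left_mono) (auto simp: C_def)
      then show ?thesis using 1 True by (simp add: mult.commute)
    qed (use 2 in \<open>simp add: C_def\<close>)
    then have "(bump x - bump y)\<^sup>2 * K (x - y) \<le> C * (min ((norm (x - y))\<^sup>2) 1 * K (x - y))"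
      using mult_right_mono[OF _ K_nonneg] by (metis mult.assoc)
    then have "ennreal ((bump x - bump y)\<^sup>2 * K (x - y)) \<le> ennreal C * g (x - y)"
      using C K_nonneg[of "x - y"] unfolding g_def by (subst ennreal_mult'[symmetric]) (auto intro: ennreal_leI)
    then show ?thesis using True
      by (auto simp: indicator_def intro: add_increasing add_increasing2)
  qed (simp add: bump_off)
  have m1: "(\<lambda>y. ennreal C * (indicator \<Omega> x * g (x - y))) \<in> borel_measurable lborel"
    "(\<lambda>y. ennreal C * (indicator \<Omega> y * g (x - y))) \<in> borel_measurable lborel" for x by measurable
  have "(\<integral>\<^sup>+x. local_energy bump x \<partial>lborel) \<le> (\<integral>\<^sup>+x. (\<integral>\<^sup>+y. ennreal C * (indicator \<Omega> x * g (x - y)) \<partial>lborel) + (\<integral>\<^sup>+y. ennreal C * (indicator \<Omega> y * g (x - y)) \<partial>lborel) \<partial>lborel)"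
    unfolding local_energy_def nn_integral_add[OF m1, symmetric] by (intro nn_integral_mono pt)
  also have "\<dots> = (\<integral>\<^sup>+x. (\<integral>\<^sup>+y. ennreal C * (indicator \<Omega> x * g (x - y)) \<partial>lborel) \<partial>lborel) + (\<integral>\<^sup>+x. (\<integral>\<^sup>+y. ennreal C * (indicator \<Omega> y * g (x - y)) \<partial>lborel) \<partial>lborel)"
    by (rule nn_integral_add) measurable
  also have "(\<integral>\<^sup>+x. (\<integral>\<^sup>+y. ennreal C * (indicator \<Omega> y * g (x - y)) \<partial>lborel) \<partial>lborel)
      = (\<integral>\<^sup>+y. (\<integral>\<^sup>+x. ennreal C * (indicator \<Omega> y * g (x - y)) \<partial>lborel) \<partial>lborel)"
    by (rule lborel_pair.Fubini') measurable
  also have "\<dots> = ennreal C * ((\<integral>\<^sup>+z. g z \<partial>lborel) * emeasure lborel \<Omega>)"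
    by (simp add: nn_integral_cmult nn_integral_lborel_translate nn_integral_multc mult.commute)
  also have "(\<integral>\<^sup>+x. (\<integral>\<^sup>+y. ennreal C * (indicator \<Omega> x * g (x - y)) \<partial>lborel) \<partial>lborel)
      = ennreal C * ((\<integral>\<^sup>+z. g z \<partial>lborel) * emeasure lborel \<Omega>)"
    by (simp add: nn_integral_cmult nn_integral_lborel_reflect nn_integral_multc mult.commute)
  also have "\<dots> + \<dots> < \<infinity>"
    using gfin \<Omega>_fin by (auto simp: ennreal_mult_less_top less_top[symmetric] ennreal_mult_eq_top_iff)
  finally have fin: "(\<integral>\<^sup>+x. local_energy bump x \<partial>lborel) < \<infinity>" .
  have ml: "bump \<in> borel_measurable lebesgue" using m by (intro measurable_completion) simp
  have "integrable K_measure (\<lambda>z. (incr bump z)\<^sup>2)"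
    using fin ml nn_energy_eq_local_energy[OF m] by (intro integrableI_bounded) auto
  then show ?thesis using ml by (simp add: X0_def bump_off)
qed

section \<open>Integrals over the domain\<close>

abbreviation L :: "'a measure" where "L \<equiv> lebesgue_on \<Omega>"

lemma integrable_L:
  fixes f :: "'a \<Rightarrow> real"
  assumes "integrable lebesgue f"
  shows "integrable L f"
  using integrable_mult_indicator[OF _ assms, of \<Omega>] by (subst integrable_restrict_space) auto

lemma measurable_L: "f \<in> borel_measurable lebesgue \<Longrightarrow> f \<in> borel_measurable L"
  by (rule measurable_restrict_space1)

lemma X0_measurable_L: "u \<in> X0 \<Longrightarrow> u \<in> borel_measurable L"
  by (intro measurable_L X0_measurable)

lemma AE_L: "AE x in lebesgue. P x \<Longrightarrow> AE x in L. P x"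
  by (subst AE_restrict_space_iff) auto

lemma AE_L_iff: "(AE x in L. P x) \<longleftrightarrow> (AE x in lebesgue. x \<in> \<Omega> \<longrightarrow> P x)"
  by (subst AE_restrict_space_iff) auto

lemma emeasure_L: "emeasure L (space L) = emeasure lborel \<Omega>"
  by (simp add: emeasure_restrict_space space_restrict_space)

lemma integrable_L_const: "integrable L (\<lambda>x. c :: real)"
proof -
  have "finite_measure L"
    by (rule finite_measureI) (use \<Omega>_fin emeasure_L in simp)
  then show ?thesis by (rule finite_measure.integrable_const)
qed

lemma integral_L_const: "(\<integral>x. c \<partial>L) = c * measure lebesgue \<Omega>" for c :: real
  by (simp add: measure_restrict_space space_restrict_space)

lemma sobolev_L:
  assumes "u \<in> X0"
  shows "integrable L (\<lambda>x. \<bar>u x\<bar> powr p)" "(\<integral>x. \<bar>u x\<bar> powr p \<partial>L) \<le> (energy u / c_sob) powr (p / 2)"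
proof -
  show i: "integrable L (\<lambda>x. \<bar>u x\<bar> powr p)" by (rule integrable_L[OF sobolev_integrable_powr[OF assms]])
  have "(\<integral>x. \<bar>u x\<bar> powr p \<partial>L) = (\<integral>x. indicator \<Omega> x *\<^sub>R \<bar>u x\<bar> powr p \<partial>lebesgue)"
    by (rule integral_restrict_space) simp
  also have "\<dots> \<le> (\<integral>x. \<bar>u x\<bar> powr p \<partial>lebesgue)"
    using sobolev_integrable_powr[OF assms]
    by (intro integral_mono integrable_mult_indicator) (auto simp: indicator_def)
  also have "\<dots> \<le> (energy u / c_sob) powr (p / 2)" by (rule sobolev_inequality[OF assms])
  finally show "(\<integral>x. \<bar>u x\<bar> powr p \<partial>L) \<le> (energy u / c_sob) powr (p / 2)" .
qed

lemma sobolev_L_le: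
  assumes "u \<in> X0" "energy u \<le> e"
  shows "(\<integral>x. \<bar>u x\<bar> powr p \<partial>L) \<le> (e / c_sob) powr (p / 2)"
proof (rule order_trans[OF sobolev_L(2)[OF assms(1)]])
  show "(energy u / c_sob) powr (p / 2) \<le> (e / c_sob) powr (p / 2)"
    using assms energy_nonneg[of u] c_sob_pos p_gt2 by (intro powr_mono2 divide_right_mono) auto
qed

lemma integrable_L_growth:
  assumes u: "u \<in> X0" and N: "N \<in> borel_measurable borel" and bd: "\<And>t. \<bar>N t\<bar> \<le> c * \<bar>t\<bar> powr p + d"
  shows "integrable L (\<lambda>x. N (u x))"
proof (rule Bochner_Integration.integrable_bound)
  show "integrable L (\<lambda>x. c * \<bar>u x\<bar> powr p + d)"
    using sobolev_L(1)[OF u] integrable_L_const by simp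
  show "(\<lambda>x. N (u x)) \<in> borel_measurable L"
    by (rule measurable_compose[OF measurable_L[OF X0_measurable[OF u]] N])
  show "AE x in L. norm (N (u x)) \<le> norm (c * \<bar>u x\<bar> powr p + d)"
    by (intro AE_I2) (use bd in \<open>simp add: order_trans[OF bd abs_ge_self]\<close>)
qed

lemma integrable_powr_mult:
  assumes u: "u \<in> X0" "\<And>x. 0 \<le> u x" and v: "v \<in> X0"
  shows "integrable L (\<lambda>x. u x powr (p - 1) * v x)"
proof (rule Bochner_Integration.integrable_bound)
  show "integrable L (\<lambda>x. \<bar>u x + 1 * \<bar>v x\<bar>\<bar> powr p)"
    by (rule sobolev_L(1)[OF X0_add_scaled(1)[OF u(1) X0_abs[OF v]]])
  have [measurable]: "u \<in> borel_measurable L" "v \<in> borel_measurable L"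
    using u v by (auto intro: X0_measurable_L)
  show "(\<lambda>x. u x powr (p - 1) * v x) \<in> borel_measurable L" by measurable
  show "AE x in L. norm (u x powr (p - 1) * v x) \<le> norm (\<bar>u x + 1 * \<bar>v x\<bar>\<bar> powr p)"
  proof (intro AE_I2)
    fix x
    have "u x powr (p - 1) * \<bar>v x\<bar> \<le> (u x + \<bar>v x\<bar>) powr (p - 1) * (u x + \<bar>v x\<bar>)"
      using u(2)[of x] p_gt2 by (intro mult_mono powr_mono2) auto
    also have "\<dots> = (u x + \<bar>v x\<bar>) powr p" using u(2)[of x] by (intro powr_mult_self) auto
    finally show "norm (u x powr (p - 1) * v x) \<le> norm (\<bar>u x + 1 * \<bar>v x\<bar>\<bar> powr p)"
      using u(2)[of x] by (simp add: abs_mult)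
  qed
qed

section \<open>Minimisers in a small ball of the positive cone\<close>

text \<open>
  Bounded energy and convergence almost everywhere imply weak convergence in the Hilbert space.
\<close>

lemma weakly_null_form:
  assumes U: "\<And>j. W j \<in> X0" and e: "\<And>j. energy (W j) \<le> E1" and u: "u \<in> X0"
    and lim: "AE x in lebesgue. (\<lambda>j. W j x) \<longlonglongrightarrow> 0"
  shows "(\<lambda>j. form u (W j)) \<longlonglongrightarrow> 0"
  unfolding form_def
proof (rule almost_dominated_convergence(2)[where P = "\<lambda>j z. (incr (W j) z)\<^sup>2" and C = E1])
  show "(\<lambda>z. incr u z * incr (W j) z) \<in> borel_measurable K_measure" for j
    using integrable_incr_mult[OF u U] by auto
  show "AE z in K_measure. (\<lambda>j. incr u z * incr (W j) z) \<longlonglongrightarrow> 0"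
    using AE_K_measure_pair[OF lim]
  proof eventually_elim
    case (elim z)
    then have "(\<lambda>j. incr u z * (W j (fst z) - W j (snd z))) \<longlonglongrightarrow> incr u z * (0 - 0)"
      by (intro tendsto_intros) auto
    then show ?case by (simp add: incr_def)
  qed
  show "integrable K_measure (\<lambda>z. (incr (W j) z)\<^sup>2)" for j by (rule X0_integrable[OF U])
  show "(\<integral>z. (incr (W j) z)\<^sup>2 \<partial>K_measure) \<le> E1" for j using e[of j] by (simp add: energy_def)
  fix \<epsilon> :: real assume \<epsilon>: "\<epsilon> > 0"
  show "\<exists>R. integrable K_measure R \<and> (\<forall>j. AE z in K_measure. \<bar>incr u z * incr (W j) z\<bar> \<le> \<epsilon> * (incr (W j) z)\<^sup>2 + R z)"
  proof (intro exI conjI allI AE_I2)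
    show "integrable K_measure (\<lambda>z. 1 / (4 * \<epsilon>) * (incr u z)\<^sup>2)" using X0_integrable[OF u] by simp
    fix j z
    have "\<bar>a * b\<bar> \<le> \<epsilon> * b\<^sup>2 + 1 / (4 * \<epsilon>) * a\<^sup>2" for a b :: real
    proof -
      have "0 \<le> (2 * \<epsilon> * \<bar>b\<bar> - \<bar>a\<bar>)\<^sup>2" by simp
      then have "4 * \<epsilon> * (\<bar>a\<bar> * \<bar>b\<bar>) \<le> 4 * \<epsilon> * (\<epsilon> * b\<^sup>2) + a\<^sup>2"
        by (simp add: power2_eq_square algebra_simps)
      then have "\<bar>a\<bar> * \<bar>b\<bar> \<le> (4 * \<epsilon> * (\<epsilon> * b\<^sup>2) + a\<^sup>2) / (4 * \<epsilon>)"
        using \<epsilon> by (simp add: pos_le_divide_eq mult.commute)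
      also have "\<dots> = \<epsilon> * b\<^sup>2 + 1 / (4 * \<epsilon>) * a\<^sup>2" using \<epsilon> by (simp add: add_divide_distrib)
      finally show ?thesis by (simp add: abs_mult)
    qed
    then show "\<bar>incr u z * incr (W j) z\<bar> \<le> \<epsilon> * (incr (W j) z)\<^sup>2 + 1 / (4 * \<epsilon>) * (incr u z)\<^sup>2" .
  qed
qed simp

lemma brezis_lieb:
  assumes W: "\<And>j. W j \<in> X0" and e: "\<And>j. energy (W j) \<le> E1" and u: "u \<in> X0"
    and lim: "AE x in lebesgue. (\<lambda>j. W j x) \<longlonglongrightarrow> 0"
  shows "(\<lambda>j. \<integral>x. \<bar>u x + W j x\<bar> powr p - \<bar>u x\<bar> powr p - \<bar>W j x\<bar> powr p \<partial>L) \<longlonglongrightarrow> 0"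
proof (rule almost_dominated_convergence(2)[where P = "\<lambda>j x. \<bar>W j x\<bar> powr p" and C = "(E1 / c_sob) powr (p / 2)"])
  show "integrable L (\<lambda>x. \<bar>W j x\<bar> powr p)" for j by (rule sobolev_L(1)[OF W])
  show "(\<integral>x. \<bar>W j x\<bar> powr p \<partial>L) \<le> (E1 / c_sob) powr (p / 2)" for j by (rule sobolev_L_le[OF W e])
  have "integrable L (\<lambda>x. \<bar>u x + W j x\<bar> powr p)" for j
    using sobolev_L(1)[OF X0_add_scaled(1)[OF u W[of j], of 1]] by simp
  then show "(\<lambda>x. \<bar>u x + W j x\<bar> powr p - \<bar>u x\<bar> powr p - \<bar>W j x\<bar> powr p) \<in> borel_measurable L" for j
    using sobolev_L(1)[OF W] sobolev_L(1)[OF u] by (intro borel_measurable_diff borel_measurable_integrable) auto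
  show "AE x in L. (\<lambda>j. \<bar>u x + W j x\<bar> powr p - \<bar>u x\<bar> powr p - \<bar>W j x\<bar> powr p) \<longlonglongrightarrow> 0"
    using AE_L[OF lim]
  proof eventually_elim
    case (elim x)
    have "(\<lambda>j. \<bar>u x + W j x\<bar> powr p - \<bar>u x\<bar> powr p - \<bar>W j x\<bar> powr p) \<longlonglongrightarrow> \<bar>u x + 0\<bar> powr p - \<bar>u x\<bar> powr p - \<bar>0\<bar> powr p"
      using elim p_gt2
      by (intro tendsto_diff tendsto_powr' tendsto_rabs tendsto_add tendsto_const) auto
    then show ?case by simp
  qed
  fix \<epsilon> :: real assume \<epsilon>: "\<epsilon> > 0"
  obtain C where C: "\<And>a b. \<bar>\<bar>a + b\<bar> powr p - \<bar>a\<bar> powr p - \<bar>b\<bar> powr p\<bar> \<le> \<epsilon> * \<bar>b\<bar> powr p + C * \<bar>a\<bar> powr p"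
    by (rule brezis_lieb_scalar[OF _ \<epsilon>, of p]) (use p_gt2 in auto)
  show "\<exists>R. integrable L R \<and> (\<forall>j. AE x in L. \<bar>\<bar>u x + W j x\<bar> powr p - \<bar>u x\<bar> powr p - \<bar>W j x\<bar> powr p\<bar> \<le> \<epsilon> * \<bar>W j x\<bar> powr p + R x)"
  proof (intro exI conjI allI AE_I2)
    show "integrable L (\<lambda>x. C * \<bar>u x\<bar> powr p)" using sobolev_L(1)[OF u] by simp
  qed (rule C)
qed simp

lemma subcritical_convergence:
  assumes U: "\<And>j. U j \<in> X0" and e: "\<And>j. energy (U j) \<le> E0" and u: "u \<in> X0"
    and lim: "AE x in lebesgue. (\<lambda>j. U j x) \<longlonglongrightarrow> u x"
    and N: "continuous_on UNIV N" "\<And>t. 0 \<le> N t" "\<And>\<epsilon>. 0 < \<epsilon> \<Longrightarrow> \<exists>C. \<forall>t. N t \<le> \<epsilon> * \<bar>t\<bar> powr p + C"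
  shows "(\<lambda>j. \<integral>x. N (U j x) - N (u x) \<partial>L) \<longlonglongrightarrow> 0"
proof (rule almost_dominated_convergence(2)[where P = "\<lambda>j x. \<bar>U j x\<bar> powr p" and C = "(E0 / c_sob) powr (p / 2)"])
  obtain C1 where C1: "\<And>t. N t \<le> 1 * \<bar>t\<bar> powr p + C1" using N(3)[of 1] by auto
  have Nm: "N \<in> borel_measurable borel" by (rule borel_measurable_continuous_onI[OF N(1)])
  have Ni: "integrable L (\<lambda>x. N (v x))" if "v \<in> X0" for v
    using C1 N(2) by (intro integrable_L_growth[OF that Nm, of 1 C1]) simp
  show "integrable L (\<lambda>x. \<bar>U j x\<bar> powr p)" for j by (rule sobolev_L(1)[OF U])
  show "(\<integral>x. \<bar>U j x\<bar> powr p \<partial>L) \<le> (E0 / c_sob) powr (p / 2)" for j by (rule sobolev_L_le[OF U e])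
  show "(\<lambda>x. N (U j x) - N (u x)) \<in> borel_measurable L" for j
    using Ni[OF U] Ni[OF u] by auto
  show "AE x in L. (\<lambda>j. N (U j x) - N (u x)) \<longlonglongrightarrow> 0"
    using AE_L[OF lim]
  proof eventually_elim
    case (elim x)
    have "isCont N (u x)" using N(1) by (simp add: continuous_on_eq_continuous_at)
    then have "(\<lambda>j. N (U j x)) \<longlonglongrightarrow> N (u x)" using elim by (rule isCont_tendsto_compose)
    then show ?case by (rule LIM_zero)
  qed
  fix \<epsilon> :: real assume \<epsilon>: "\<epsilon> > 0"
  obtain C where C: "\<And>t. N t \<le> \<epsilon> * \<bar>t\<bar> powr p + C" using N(3)[OF \<epsilon>] by auto
  show "\<exists>R. integrable L R \<and> (\<forall>j. AE x in L. \<bar>N (U j x) - N (u x)\<bar> \<le> \<epsilon> * \<bar>U j x\<bar> powr p + R x)"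
  proof (intro exI conjI allI AE_I2)
    show "integrable L (\<lambda>x. C + N (u x))" using Ni[OF u] integrable_L_const by simp
    show "\<bar>N (U j x) - N (u x)\<bar> \<le> \<epsilon> * \<bar>U j x\<bar> powr p + (C + N (u x))" for j x
      using C[of "U j x"] N(2)[of "U j x"] N(2)[of "u x"] by linarith
  qed
qed simp

definition J :: "real \<Rightarrow> (real \<Rightarrow> real) \<Rightarrow> ('a \<Rightarrow> real) \<Rightarrow> real" where
  "J \<mu> N u = energy u / 2 - \<mu> / p * (\<integral>x. \<bar>u x\<bar> powr p \<partial>L) - (\<integral>x. N (u x) \<partial>L)"

definition cone_ball :: "real \<Rightarrow> ('a \<Rightarrow> real) set" where
  "cone_ball E0 = {u \<in> X0. (\<forall>x. 0 \<le> u x) \<and> energy u \<le> E0}"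

text \<open>
  The smallness condition compares the critical term with a quarter of the energy up to \<open>4 * E0\<close>,
  since the differences \<open>W j\<close> of two elements of the ball have energy at most \<open>4 * E0\<close>.
\<close>

lemma minimiser_exists:
  assumes E0: "0 \<le> E0" and \<mu>: "0 \<le> \<mu>"
    and small: "\<And>e. 0 \<le> e \<Longrightarrow> e \<le> 4 * E0 \<Longrightarrow> \<mu> / p * (e / c_sob) powr (p / 2) \<le> e / 4"
    and N: "continuous_on UNIV N" "\<And>t. 0 \<le> N t" "\<And>\<epsilon>. 0 < \<epsilon> \<Longrightarrow> \<exists>C. \<forall>t. N t \<le> \<epsilon> * \<bar>t\<bar> powr p + C"
  obtains u where "u \<in> cone_ball E0" "\<And>w. w \<in> cone_ball E0 \<Longrightarrow> J \<mu> N u \<le> J \<mu> N w"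
proof -
  obtain C1 where C1: "\<And>t. N t \<le> 1 * \<bar>t\<bar> powr p + C1" using N(3)[of 1] by auto
  have Nm: "N \<in> borel_measurable borel" by (rule borel_measurable_continuous_onI[OF N(1)])
  have Ni: "integrable L (\<lambda>x. N (v x))" if "v \<in> X0" for v
    using C1 N(2) by (intro integrable_L_growth[OF that Nm, of 1 C1]) simp
  define B where "B = (E0 / c_sob) powr (p / 2)"
  have lower: "- (\<mu> / p * B) - (B + C1 * measure lebesgue \<Omega>) \<le> J \<mu> N w" if w: "w \<in> cone_ball E0" for w
  proof -
    have wH: "w \<in> X0" "energy w \<le> E0" using w by (auto simp: cone_ball_def)
    have b: "(\<integral>x. \<bar>w x\<bar> powr p \<partial>L) \<le> B" unfolding B_def by (rule sobolev_L_le[OF wH])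
    have "(\<integral>x. N (w x) \<partial>L) \<le> (\<integral>x. \<bar>w x\<bar> powr p + C1 \<partial>L)"
      using Ni[OF wH(1)] sobolev_L(1)[OF wH(1)] integrable_L_const C1 by (intro integral_mono) auto
    also have "\<dots> = (\<integral>x. \<bar>w x\<bar> powr p \<partial>L) + (\<integral>x. C1 \<partial>L)"
      using sobolev_L(1)[OF wH(1)] integrable_L_const by (rule Bochner_Integration.integral_add)
    also have "\<dots> \<le> B + C1 * measure lebesgue \<Omega>"
      using b by (simp only: integral_L_const)
    finally have 1: "(\<integral>x. N (w x) \<partial>L) \<le> B + C1 * measure lebesgue \<Omega>" .
    have "\<mu> / p * (\<integral>x. \<bar>w x\<bar> powr p \<partial>L) \<le> \<mu> / p * B"
      using b \<mu> p_gt2 by (intro mult_left_mono) auto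
    then show ?thesis unfolding J_def using 1 energy_nonneg[of w] by linarith
  qed
  define m where "m = Inf (J \<mu> N ` cone_ball E0)"
  have ne: "J \<mu> N ` cone_ball E0 \<noteq> {}" using zero_X0 energy_zero E0 by (auto simp: cone_ball_def)
  have bdd: "bdd_below (J \<mu> N ` cone_ball E0)" using lower by (auto intro!: bdd_belowI2)
  have m: "m \<le> J \<mu> N w" if "w \<in> cone_ball E0" for w unfolding m_def using bdd that by (intro cINF_lower)
  have "\<exists>w \<in> cone_ball E0. J \<mu> N w < m + 1 / real (Suc j)" for j
  proof -
    have "m < m + 1 / real (Suc j)" by simp
    then show ?thesis unfolding m_def using cInf_less_iff[OF ne bdd] by blast
  qed
  then obtain U0 where U0: "\<And>j. U0 j \<in> cone_ball E0" "\<And>j. J \<mu> N (U0 j) < m + 1 / real (Suc j)" by metis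
  have U0H: "U0 j \<in> X0" "energy (U0 j) \<le> E0" "0 \<le> U0 j x" for j x using U0(1)[of j] by (auto simp: cone_ball_def)
  obtain r where r: "strict_mono (r :: nat \<Rightarrow> nat)" "AE x in lebesgue. Cauchy (\<lambda>j. U0 (r j) x)"
    by (rule bounded_energy_AE_Cauchy_subsequence[OF U0H(1,2)])
  define U where "U j = U0 (r j)" for j
  have UH: "U j \<in> X0" "energy (U j) \<le> E0" "0 \<le> U j x" "U j \<in> cone_ball E0" for j x
    using U0H U0 by (auto simp: U_def)
  have JU: "(\<lambda>j. J \<mu> N (U j)) \<longlonglongrightarrow> m"
  proof (rule tendsto_sandwich[OF _ _ tendsto_const])
    have "(\<lambda>j. 1 / real (Suc (r j))) \<longlonglongrightarrow> 0"
      using LIMSEQ_subseq_LIMSEQ[OF LIMSEQ_inverse_real_of_nat r(1)]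
      by (simp add: o_def inverse_eq_divide)
    then have "(\<lambda>j. m + 1 / real (Suc (r j))) \<longlonglongrightarrow> m + 0" by (intro tendsto_intros)
    then show "(\<lambda>j. m + 1 / real (Suc (r j))) \<longlonglongrightarrow> m" by simp
    show "\<forall>\<^sub>F j in sequentially. m \<le> J \<mu> N (U j)" using m UH by simp
    show "\<forall>\<^sub>F j in sequentially. J \<mu> N (U j) \<le> m + 1 / real (Suc (r j))"
      using U0(2) by (auto simp: U_def intro!: always_eventually less_imp_le)
  qed
  \<comment> \<open>the cut-off at \<open>0\<close> covers the null set on which the limit does not exist\<close>
  define u where "u x = max 0 (lim (\<lambda>j. U j x))" for x
  have um: "u \<in> borel_measurable lebesgue"
    unfolding u_def[abs_def]
    by (intro borel_measurable_max borel_measurable_const borel_measurable_lim_metric X0_measurable UH)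
  have lim: "AE x in lebesgue. (\<lambda>j. U j x) \<longlonglongrightarrow> u x"
    using r(2)
  proof eventually_elim
    case (elim x)
    then have l: "(\<lambda>j. U j x) \<longlonglongrightarrow> lim (\<lambda>j. U j x)"
      by (simp add: U_def Cauchy_convergent_iff convergent_LIMSEQ_iff)
    then have "0 \<le> lim (\<lambda>j. U j x)" using UH(3) by (intro LIMSEQ_le_const) auto
    then show ?case using l by (simp add: u_def)
  qed
  have uH: "u \<in> X0" "energy u \<le> E0" using X0_closed_AE[OF UH(1,2) um lim] by auto
  have uA: "u \<in> cone_ball E0" using uH by (simp add: cone_ball_def u_def)
  define W where "W j = (\<lambda>x. U j x + (-1) * u x)" for j
  have WH: "W j \<in> X0" for j unfolding W_def by (intro X0_add_scaled UH uH)
  have We: "energy (W j) \<le> 4 * E0" for j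
    unfolding W_def by (rule energy_diff_le[OF UH(1) uH(1) UH(2) uH(2)])
  have Wlim: "AE x in lebesgue. (\<lambda>j. W j x) \<longlonglongrightarrow> 0"
    using lim
  proof eventually_elim
    case (elim x)
    then have "(\<lambda>j. U j x - u x) \<longlonglongrightarrow> u x - u x" by (intro tendsto_intros)
    then show ?case by (simp add: W_def)
  qed
  have UW: "U j = (\<lambda>x. u x + 1 * W j x)" for j by (auto simp: W_def)
  define a where "a j = form u (W j)" for j
  define b where "b j = (\<integral>x. \<bar>u x + W j x\<bar> powr p - \<bar>u x\<bar> powr p - \<bar>W j x\<bar> powr p \<partial>L)" for j
  define c where "c j = (\<integral>x. N (U j x) - N (u x) \<partial>L)" for j
  have abc: "a \<longlonglongrightarrow> 0" "b \<longlonglongrightarrow> 0" "c \<longlonglongrightarrow> 0"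
    unfolding a_def b_def c_def
    using weakly_null_form[OF WH We uH(1) Wlim] brezis_lieb[OF WH We uH(1) Wlim]
      subcritical_convergence[OF UH(1,2) uH(1) lim N] by auto
  \<comment> \<open>what is lost in the limit is the functional of \<open>W j\<close> without its subcritical part,
    and that is nonnegative in the ball of radius \<open>4 * E0\<close>\<close>
  have "J \<mu> N u + (a j - \<mu> / p * b j - c j) \<le> J \<mu> N (U j)" for j
  proof -
    have e: "energy (U j) = energy u + 2 * a j + energy (W j)"
      unfolding UW energy_add_scaled[OF uH(1) WH] a_def by simp
    have i: "integrable L (\<lambda>x. \<bar>u x + W j x\<bar> powr p)"
      using sobolev_L(1)[OF UH(1)[of j]] unfolding UW by simp
    have pp: "(\<integral>x. \<bar>U j x\<bar> powr p \<partial>L) = (\<integral>x. \<bar>u x\<bar> powr p \<partial>L) + (\<integral>x. \<bar>W j x\<bar> powr p \<partial>L) + b j"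
      unfolding UW b_def using i sobolev_L(1)[OF uH(1)] sobolev_L(1)[OF WH] by simp
    have nn: "(\<integral>x. N (U j x) \<partial>L) = (\<integral>x. N (u x) \<partial>L) + c j"
      unfolding c_def using Ni[OF UH(1)] Ni[OF uH(1)] by simp
    have "\<mu> / p * (\<integral>x. \<bar>W j x\<bar> powr p \<partial>L) \<le> \<mu> / p * (energy (W j) / c_sob) powr (p / 2)"
      using sobolev_L(2)[OF WH] \<mu> p_gt2 by (intro mult_left_mono) auto
    also have "\<dots> \<le> energy (W j) / 4" by (rule small[OF energy_nonneg We])
    finally have "\<mu> / p * (\<integral>x. \<bar>W j x\<bar> powr p \<partial>L) \<le> energy (W j) / 2"
      using energy_nonneg[of "W j"] by linarith
    then show ?thesis unfolding J_def e pp nn by (simp add: distrib_left add_divide_distrib)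
  qed
  moreover have "(\<lambda>j. J \<mu> N u + (a j - \<mu> / p * b j - c j)) \<longlonglongrightarrow> J \<mu> N u + (0 - \<mu> / p * 0 - 0)"
    using abc by (intro tendsto_intros)
  ultimately have "J \<mu> N u + (0 - \<mu> / p * 0 - 0) \<le> m"
    using JU by (intro LIMSEQ_le) auto
  then have "J \<mu> N u \<le> m" by simp
  then have "J \<mu> N u \<le> J \<mu> N w" if "w \<in> cone_ball E0" for w using m[OF that] by linarith
  then show thesis by (rule that[OF uA])
qed

text \<open>
  As \<open>p > 2\<close>, the critical term is of higher order than the energy.
\<close>

lemma small_ball_radius:
  assumes \<mu>: "0 < \<mu>"
  obtains E0 where "0 < E0"
    "\<And>e. 0 \<le> e \<Longrightarrow> e \<le> 4 * E0 \<Longrightarrow> \<mu> / p * (e / c_sob) powr (p / 2) \<le> e / 4"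
proof -
  define k where "k = \<mu> / p / c_sob powr (p / 2)"
  have k: "0 < k" using \<mu> p_gt2 c_sob_pos by (simp add: k_def)
  \<comment> \<open>the largest value of \<open>e\<close>, namely the solution of \<open>k * e powr (p / 2) = e / 4\<close>\<close>
  define X where "X = (1 / (4 * k)) powr (1 / (p / 2 - 1))"
  have X: "0 < X" using k by (simp add: X_def)
  show thesis
  proof (rule that[of "X / 4"])
    fix e :: real assume e: "0 \<le> e" "e \<le> 4 * (X / 4)"
    have eq: "\<mu> / p * (e / c_sob) powr (p / 2) = k * e powr (p / 2)"
      by (simp add: k_def powr_divide)
    have "e powr (p / 2 - 1) \<le> X powr (p / 2 - 1)" using e p_gt2 by (intro powr_mono2) auto
    also have "\<dots> = 1 / (4 * k)" using k p_gt2 by (simp add: X_def powr_powr)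
    finally have "k * (e powr (p / 2 - 1) * e) \<le> k * (1 / (4 * k) * e)"
      using e k by (intro mult_left_mono mult_right_mono) auto
    also have "\<dots> = e / 4" using k by simp
    finally show "\<mu> / p * (e / c_sob) powr (p / 2) \<le> e / 4"
      unfolding eq using powr_mult_self[OF e(1), of "p / 2"] by simp
  qed (use X in simp)
qed

section \<open>The Euler-Lagrange equation of a minimiser\<close>

lemma inverse_Suc_tendsto: "(\<lambda>k. 1 / real (Suc k)) \<longlonglongrightarrow> 0"
  using LIMSEQ_inverse_real_of_nat by (simp add: inverse_eq_divide)

lemma eventually_admissible:
  assumes "u \<in> X0" "v \<in> X0" "energy u < E0"
  shows "\<forall>\<^sub>F k in sequentially. energy (\<lambda>x. u x + 1 / real (Suc k) * v x) \<le> E0"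
proof -
  have "(\<lambda>k. energy u + 2 * (1 / real (Suc k)) * form u v + (1 / real (Suc k))\<^sup>2 * energy v)
    \<longlonglongrightarrow> energy u + 2 * 0 * form u v + 0\<^sup>2 * energy v"
    by (intro tendsto_intros inverse_Suc_tendsto)
  then have "(\<lambda>k. energy (\<lambda>x. u x + 1 / real (Suc k) * v x)) \<longlonglongrightarrow> energy u"
    unfolding energy_add_scaled[OF assms(1,2)] by simp
  then have "\<forall>\<^sub>F k in sequentially. energy (\<lambda>x. u x + 1 / real (Suc k) * v x) < E0"
    using assms(3) by (rule order_tendstoD)
  then show ?thesis by (rule eventually_mono) simp
qed

text \<open>
  The hypotheses on \<open>u\<close> express interior minimality for \<open>energy u / 2 - \<integral>\<Psi>(u)\<close>; here \<open>\<Psi>\<close> stands for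
  the critical, the singular and the subcritical potential together.
\<close>

context
  fixes \<Psi> :: "real \<Rightarrow> real" and c d E0 :: real and u :: "'a \<Rightarrow> real"
  assumes \<Psi>: "\<Psi> \<in> borel_measurable borel" "\<And>t. \<bar>\<Psi> t\<bar> \<le> c * \<bar>t\<bar> powr p + d"
    and u: "u \<in> cone_ball E0" "energy u < E0"
    and min: "\<And>w. w \<in> cone_ball E0 \<Longrightarrow>
      (\<integral>x. \<Psi> (w x) \<partial>L) - (\<integral>x. \<Psi> (u x) \<partial>L) \<le> (energy w - energy u) / 2"
begin

text \<open>
  Minimality bounds the increase of \<open>\<integral>\<Psi>\<close> from \<open>u\<close> to \<open>u + t v\<close> by half the increase of the energy.
  After division by \<open>t\<close> the right-hand side stays bounded as \<open>t\<close> tends to \<open>0\<close>.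
\<close>

lemma singular_difference_bound:
  assumes l: "0 < l"
    and lower: "\<And>a h. 0 \<le> a \<Longrightarrow> 0 \<le> h \<Longrightarrow> l * ((a + h) powr (r - 1) * h) \<le> \<Psi> (a + h) - \<Psi> a"
    and v: "v \<in> X0" "\<And>x. 0 \<le> v x" and t: "0 < t" "energy (\<lambda>x. u x + t * v x) \<le> E0"
  shows "integrable L (\<lambda>x. (u x + t * v x) powr (r - 1) * v x)"
    and "(\<integral>x. (u x + t * v x) powr (r - 1) * v x \<partial>L) \<le> (form u v + t / 2 * energy v) / l"
proof -
  have uH: "u \<in> X0" "\<And>x. 0 \<le> u x" using u(1) by (auto simp: cone_ball_def)
  let ?w = "\<lambda>x. u x + t * v x"
  have wH: "?w \<in> X0" by (intro X0_add_scaled uH v)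
  have w: "?w \<in> cone_ball E0" using wH uH v t by (simp add: cone_ball_def)
  have i: "integrable L (\<lambda>x. \<Psi> (?w x))" "integrable L (\<lambda>x. \<Psi> (u x))"
    by (intro integrable_L_growth[OF wH \<Psi>] integrable_L_growth[OF uH(1) \<Psi>])+
  have le: "(l * t) * ((u x + t * v x) powr (r - 1) * v x) \<le> \<Psi> (?w x) - \<Psi> (u x)" for x
    using lower[of "u x" "t * v x"] uH(2)[of x] v(2)[of x] t by (simp add: mult_ac)
  have um: "u \<in> borel_measurable L" and vm: "v \<in> borel_measurable L"
    using uH v by (auto intro: X0_measurable_L)
  have m: "(\<lambda>x. (u x + t * v x) powr (r - 1) * v x) \<in> borel_measurable L"
    using um vm by measurable
  have "integrable L (\<lambda>x. (l * t) * ((u x + t * v x) powr (r - 1) * v x))"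
  proof (rule Bochner_Integration.integrable_bound[OF Bochner_Integration.integrable_diff[OF i]])
    show "(\<lambda>x. (l * t) * ((u x + t * v x) powr (r - 1) * v x)) \<in> borel_measurable L" using m by measurable
    show "AE x in L. norm ((l * t) * ((u x + t * v x) powr (r - 1) * v x)) \<le> norm (\<Psi> (?w x) - \<Psi> (u x))"
    proof (intro AE_I2)
      fix x
      have "0 \<le> (l * t) * ((u x + t * v x) powr (r - 1) * v x)" using l t v(2) by simp
      then show "norm ((l * t) * ((u x + t * v x) powr (r - 1) * v x)) \<le> norm (\<Psi> (?w x) - \<Psi> (u x))"
        unfolding real_norm_def using le[of x] by linarith
    qed
  qed
  then show int: "integrable L (\<lambda>x. (u x + t * v x) powr (r - 1) * v x)" using l t by simp
  have "(l * t) * (\<integral>x. (u x + t * v x) powr (r - 1) * v x \<partial>L) = (\<integral>x. (l * t) * ((u x + t * v x) powr (r - 1) * v x) \<partial>L)"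
    by (rule integral_mult_right_zero[symmetric])
  also have "\<dots> \<le> (\<integral>x. \<Psi> (?w x) - \<Psi> (u x) \<partial>L)"
    using int i le by (intro integral_mono) auto
  also have "\<dots> = (\<integral>x. \<Psi> (?w x) \<partial>L) - (\<integral>x. \<Psi> (u x) \<partial>L)" using i by simp
  also have "\<dots> \<le> (energy ?w - energy u) / 2" by (rule min[OF w])
  also have "\<dots> = t * (form u v + t / 2 * energy v)"
    unfolding energy_add_scaled[OF uH(1) v(1)] by (simp add: power2_eq_square algebra_simps)
  finally have "t * (l * (\<integral>x. (u x + t * v x) powr (r - 1) * v x \<partial>L)) \<le> t * (form u v + t / 2 * energy v)"
    by (simp add: mult_ac)
  then have "l * (\<integral>x. (u x + t * v x) powr (r - 1) * v x \<partial>L) \<le> form u v + t / 2 * energy v"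
    using t by (simp only: mult_le_cancel_left_pos)
  then show "(\<integral>x. (u x + t * v x) powr (r - 1) * v x \<partial>L) \<le> (form u v + t / 2 * energy v) / l"
    using l by (simp add: pos_le_divide_eq mult.commute)
qed

text \<open>
  Where \<open>u\<close> vanishes, the function of \<open>singular_difference_bound\<close> is \<open>t powr (r - 1) * v powr r\<close>,
  which blows up as \<open>t\<close> tends to \<open>0\<close>; with \<open>v = bump\<close> this leaves no room for zeros of \<open>u\<close> in \<open>\<Omega>\<close>.
  Once \<open>u > 0\<close> is known, Fatou's lemma yields the integrability for \<open>v \<ge> 0\<close>, and the absolute value
  reduces the general case to it.
\<close>

lemma minimiser_positive:
  assumes l: "0 < l" and r: "0 < r" "r < 1"
    and lower: "\<And>a h. 0 \<le> a \<Longrightarrow> 0 \<le> h \<Longrightarrow> l * ((a + h) powr (r - 1) * h) \<le> \<Psi> (a + h) - \<Psi> a"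
  shows "AE x in L. 0 < u x"
    and "\<And>v. v \<in> X0 \<Longrightarrow> integrable L (\<lambda>x. u x powr (r - 1) * v x)"
proof -
  have uH: "u \<in> X0" "\<And>x. 0 \<le> u x" using u(1) by (auto simp: cone_ball_def)
  have um[measurable]: "u \<in> borel_measurable L" using uH by (auto intro: X0_measurable_L)
  define t where "t k = 1 / real (Suc k)" for k
  have t: "0 < t k" "t k \<le> 1" for k by (auto simp: t_def)
  have t0: "t \<longlonglongrightarrow> 0" unfolding t_def by (rule inverse_Suc_tendsto)
  define B where "B v = (\<bar>form u v\<bar> + energy v) / l" for v
  have key: "\<forall>\<^sub>F k in sequentially. integrable L (\<lambda>x. (u x + t k * v x) powr (r - 1) * v x) \<and>
      (\<integral>x. (u x + t k * v x) powr (r - 1) * v x \<partial>L) \<le> B v" if v: "v \<in> X0" "\<And>x. 0 \<le> v x" for v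
    using eventually_admissible[OF uH(1) v(1) u(2)]
  proof eventually_elim
    case (elim k)
    note sd = singular_difference_bound[OF l lower v t(1)[of k], OF _ _ elim[folded t_def]]
    have "t k / 2 * energy v \<le> 1 * energy v" using t[of k] energy_nonneg[of v] by (intro mult_right_mono) auto
    then have "(form u v + t k / 2 * energy v) / l \<le> B v"
      unfolding B_def using l by (intro divide_right_mono) auto
    then show ?case using sd by fastforce
  qed
  have bm[measurable]: "bump \<in> borel_measurable L" using bump_X0 by (auto intro: X0_measurable_L)
  \<comment> \<open>equal to \<open>bump powr r\<close> on the zero set of \<open>u\<close>; to be shown to vanish\<close>
  define Z where "Z x = (if u x = 0 then bump x powr r else 0)" for x
  have Zm[measurable]: "Z \<in> borel_measurable L" unfolding Z_def[abs_def] by measurable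
  have Z0: "0 \<le> Z x" for x by (simp add: Z_def)
  have Zle: "Z x \<le> t k powr (1 - r) * ((u x + t k * bump x) powr (r - 1) * bump x)" for x k
  proof (cases "u x = 0 \<and> bump x \<noteq> 0")
    case True
    then have b: "0 < bump x" using bump_nonneg[of x] by simp
    have "t k powr (1 - r) * ((t k * bump x) powr (r - 1) * bump x) = (t k powr (1 - r) * t k powr (r - 1)) * (bump x powr (r - 1) * bump x)"
      by (simp add: powr_mult)
    also have "t k powr (1 - r) * t k powr (r - 1) = 1"
      using t(1)[of k] by (subst powr_add[symmetric]) simp
    also have "bump x powr (r - 1) * bump x = bump x powr r" using b by (simp add: powr_mult_self)
    finally show ?thesis using True by (simp add: Z_def)
  next
    case False
    then have "Z x = 0" by (auto simp: Z_def)
    then show ?thesis using bump_nonneg[of x] by simp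
  qed
  have Zint: "integrable L Z \<and> (\<integral>x. Z x \<partial>L) \<le> t k powr (1 - r) * B bump"
    if k: "integrable L (\<lambda>x. (u x + t k * bump x) powr (r - 1) * bump x)"
      "(\<integral>x. (u x + t k * bump x) powr (r - 1) * bump x \<partial>L) \<le> B bump" for k
  proof
    have i: "integrable L (\<lambda>x. t k powr (1 - r) * ((u x + t k * bump x) powr (r - 1) * bump x))"
      using k(1) by simp
    show Zi: "integrable L Z"
    proof (rule Bochner_Integration.integrable_bound[OF i Zm], intro AE_I2)
      show "norm (Z x) \<le> norm (t k powr (1 - r) * ((u x + t k * bump x) powr (r - 1) * bump x))" for x
        using Z0[of x] Zle[of x k] by simp
    qed
    have "(\<integral>x. Z x \<partial>L) \<le> (\<integral>x. t k powr (1 - r) * ((u x + t k * bump x) powr (r - 1) * bump x) \<partial>L)"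
      using Zi i Zle by (intro integral_mono) auto
    also have "\<dots> = t k powr (1 - r) * (\<integral>x. (u x + t k * bump x) powr (r - 1) * bump x \<partial>L)"
      by (rule integral_mult_right_zero)
    also have "\<dots> \<le> t k powr (1 - r) * B bump" using k(2) by (intro mult_left_mono) auto
    finally show "(\<integral>x. Z x \<partial>L) \<le> t k powr (1 - r) * B bump" .
  qed
  have ev: "\<forall>\<^sub>F k in sequentially. integrable L Z \<and> (\<integral>x. Z x \<partial>L) \<le> t k powr (1 - r) * B bump"
    using key[OF bump_X0 bump_nonneg] by (rule eventually_mono) (use Zint in blast)
  have "(\<lambda>k. t k powr (1 - r) * B bump) \<longlonglongrightarrow> 0 powr (1 - r) * B bump"
    using t0 r t by (intro tendsto_intros tendsto_powr') (auto simp: less_imp_le)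
  then have "(\<integral>x. Z x \<partial>L) \<le> 0 powr (1 - r) * B bump"
    by (rule tendsto_lowerbound) (use ev in \<open>auto elim: eventually_mono\<close>)
  moreover have Zi: "integrable L Z" using eventually_happens[OF ev] by auto
  moreover have "0 \<le> (\<integral>x. Z x \<partial>L)" by (rule integral_nonneg_AE) (simp add: Z0)
  ultimately have "(\<integral>x. Z x \<partial>L) = 0" by simp
  then have "AE x in L. Z x = 0" using Zi Z0 integral_nonneg_eq_0_iff_AE[of L Z] by auto
  moreover have "AE x in L. x \<in> \<Omega>" by (rule AE_I2) (simp add: space_restrict_space)
  ultimately show upos: "AE x in L. 0 < u x"
  proof eventually_elim
    case (elim x)
    then have "0 < bump x" by (intro bump_pos)
    then show ?case using elim uH(2)[of x] by (auto simp: Z_def less_le)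
  qed
  have nonneg: "integrable L (\<lambda>x. u x powr (r - 1) * v x)" if v: "v \<in> X0" "\<And>x. 0 \<le> v x" for v
  proof -
    have vm[measurable]: "v \<in> borel_measurable L" using v by (auto intro: X0_measurable_L)
    let ?f = "\<lambda>k x. (u x + t k * v x) powr (r - 1) * v x"
    have "(\<integral>\<^sup>+x. ennreal (u x powr (r - 1) * v x) \<partial>L) \<le> ennreal (B v)"
    proof (rule nn_integral_Fatou_bound[where f = ?f])
      show "AE x in L. (\<lambda>k. ?f k x) \<longlonglongrightarrow> u x powr (r - 1) * v x"
        using upos
      proof eventually_elim
        case (elim x)
        have "(\<lambda>k. ?f k x) \<longlonglongrightarrow> (u x + 0 * v x) powr (r - 1) * v x"
          using elim t0 by (intro tendsto_intros) auto
        then show ?case by simp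
      qed
      show "\<forall>\<^sub>F k in sequentially. (\<integral>\<^sup>+x. ennreal (?f k x) \<partial>L) \<le> ennreal (B v)"
        using key[OF v]
      proof eventually_elim
        case (elim k)
        then have "(\<integral>\<^sup>+x. ennreal (?f k x) \<partial>L) = ennreal (\<integral>x. ?f k x \<partial>L)"
          using v(2) by (intro nn_integral_eq_integral) auto
        then show ?case using elim by (simp add: ennreal_leI)
      qed
    qed measurable
    then have "(\<integral>\<^sup>+x. ennreal (u x powr (r - 1) * v x) \<partial>L) < \<infinity>" by (simp add: le_less_trans)
    then show ?thesis using v(2) by (intro integrableI_nonneg) auto
  qed
  fix v assume v: "v \<in> X0"
  have vm[measurable]: "v \<in> borel_measurable L" using v by (auto intro: X0_measurable_L)
  have "integrable L (\<lambda>x. u x powr (r - 1) * \<bar>v x\<bar>)" by (rule nonneg[OF X0_abs[OF v]]) simp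
  then show "integrable L (\<lambda>x. u x powr (r - 1) * v x)"
    by (rule Bochner_Integration.integrable_bound) (auto simp: abs_mult)
qed

text \<open>
  The competitor is the positive part of \<open>u + t v\<close> for small \<open>t\<close>; passing to the positive part does
  not increase the energy. The hypothesis on \<open>\<bar>\<Psi> (max 0 (a + h)) - \<Psi> a\<bar>\<close> dominates the
  difference quotients, so the derivative can be taken under the integral.
\<close>

lemma euler_lagrange:
  fixes \<psi> :: "real \<Rightarrow> real"
  assumes upper: "\<And>a h. 0 < a \<Longrightarrow> \<bar>\<Psi> (max 0 (a + h)) - \<Psi> a\<bar>
       \<le> A * (\<bar>h\<bar> * (a powr (r - 1) + 1 + (a + \<bar>h\<bar>) powr (p - 1)))"
    and A: "0 \<le> A"
    and der: "\<And>a. 0 < a \<Longrightarrow> (\<Psi> has_real_derivative \<psi> a) (at a)"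
    and \<psi>: "\<psi> \<in> borel_measurable borel"
    and pos: "AE x in L. 0 < u x" and sing: "\<And>v. v \<in> X0 \<Longrightarrow> integrable L (\<lambda>x. u x powr (r - 1) * v x)"
    and v: "v \<in> X0"
  shows "form u v = (\<integral>x. \<psi> (u x) * v x \<partial>L)"
proof -
  have uH: "u \<in> X0" "\<And>x. 0 \<le> u x" using u(1) by (auto simp: cone_ball_def)
  have um[measurable]: "u \<in> borel_measurable L" using uH by (auto intro: X0_measurable_L)
  have [measurable]: "\<Psi> \<in> borel_measurable borel" "\<psi> \<in> borel_measurable borel" by fact+
  define t where "t k = 1 / real (Suc k)" for k
  have t: "0 < t k" "t k \<le> 1" for k by (auto simp: t_def)
  have t0: "t \<longlonglongrightarrow> 0" unfolding t_def by (rule inverse_Suc_tendsto)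
  \<comment> \<open>the one-sided derivative along \<open>v\<close>\<close>
  have half: "(\<integral>x. \<psi> (u x) * v x \<partial>L) \<le> form u v" if v: "v \<in> X0" for v
  proof -
    have vm[measurable]: "v \<in> borel_measurable L" using v by (auto intro: X0_measurable_L)
    define w where "w k x = max 0 (u x + t k * v x)" for k x
    have w: "w k \<in> X0" "energy (w k) \<le> energy (\<lambda>x. u x + t k * v x)" "0 \<le> w k x" for k x
      unfolding w_def using X0_pos_part energy_pos_part X0_add_scaled(1)[OF uH(1) v] by auto
    have wm[measurable]: "w k \<in> borel_measurable L" for k using w by (auto intro: X0_measurable_L)
    let ?q = "\<lambda>k x. (\<Psi> (w k x) - \<Psi> (u x)) / t k"
    let ?R = "\<lambda>x. A * (u x powr (r - 1) * \<bar>v x\<bar> + \<bar>v x\<bar> + \<bar>u x + 1 * \<bar>v x\<bar>\<bar> powr p)"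
    have Ri: "integrable L ?R"
      using sing[OF X0_abs[OF v]] integrable_L[OF X0_L1(1)[OF X0_abs[OF v]]]
        sobolev_L(1)[OF X0_add_scaled(1)[OF uH(1) X0_abs[OF v], of 1]] by simp
    have "(\<lambda>k. \<integral>x. ?q k x \<partial>L) \<longlonglongrightarrow> (\<integral>x. \<psi> (u x) * v x \<partial>L)"
    proof (rule integral_dominated_convergence[OF _ _ Ri])
      show "AE x in L. (\<lambda>k. ?q k x) \<longlonglongrightarrow> \<psi> (u x) * v x"
        using pos
      proof eventually_elim
        case (elim x)
        have "((\<lambda>h. \<Psi> (u x + h * v x)) has_real_derivative \<psi> (u x) * v x) (at 0)"
        proof -
          have "(\<Psi> has_real_derivative \<psi> (u x)) (at (u x + 0 * v x))" using der[OF elim] by simp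
          moreover have "((\<lambda>h. u x + h * v x) has_real_derivative v x) (at 0)"
            by (auto intro!: derivative_eq_intros)
          ultimately show ?thesis using DERIV_chain2[of \<Psi> "\<psi> (u x)" "\<lambda>h. u x + h * v x" 0 "v x"] by simp
        qed
        then have "(\<lambda>h. (\<Psi> (u x + h * v x) - \<Psi> (u x)) / h) \<midarrow>0\<rightarrow> \<psi> (u x) * v x"
          unfolding DERIV_def by simp
        moreover have "filterlim t (at 0) sequentially"
          using t0 t(1) by (auto simp: filterlim_at less_imp_neq[symmetric])
        ultimately have "(\<lambda>k. (\<Psi> (u x + t k * v x) - \<Psi> (u x)) / t k) \<longlonglongrightarrow> \<psi> (u x) * v x"
          by (rule filterlim_compose)
        moreover have "\<forall>\<^sub>F k in sequentially. (\<Psi> (u x + t k * v x) - \<Psi> (u x)) / t k = ?q k x"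
        proof -
          have "(\<lambda>k. u x + t k * v x) \<longlonglongrightarrow> u x + 0 * v x" by (intro tendsto_intros t0)
          then have "\<forall>\<^sub>F k in sequentially. 0 < u x + t k * v x"
            using elim by (intro order_tendstoD) auto
          then show ?thesis by (rule eventually_mono) (simp add: w_def)
        qed
        ultimately show ?case by (rule Lim_transform_eventually)
      qed
      show "AE x in L. norm (?q k x) \<le> ?R x" for k
        using pos
      proof eventually_elim
        case (elim x)
        have th: "\<bar>t k * v x\<bar> \<le> \<bar>v x\<bar>" using t[of k] by (simp add: abs_mult mult_left_le_one_le)
        let ?Y = "u x powr (r - 1) + 1 + (u x + \<bar>v x\<bar>) powr (p - 1)"
        have "\<bar>\<Psi> (w k x) - \<Psi> (u x)\<bar> \<le> A * (\<bar>t k * v x\<bar> * (u x powr (r - 1) + 1 + (u x + \<bar>t k * v x\<bar>) powr (p - 1)))"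
          unfolding w_def by (rule upper[OF elim])
        also have "\<dots> \<le> A * (\<bar>t k * v x\<bar> * ?Y)"
          using A th elim p_gt2 by (intro mult_left_mono add_left_mono powr_mono2) auto
        also have "\<dots> = t k * (A * (\<bar>v x\<bar> * ?Y))"
          using t(1)[of k] by (simp add: abs_mult mult_ac)
        finally have "\<bar>?q k x\<bar> \<le> A * (\<bar>v x\<bar> * ?Y)"
          using t(1)[of k] by (simp add: abs_divide pos_divide_le_eq mult.commute)
        also have "\<dots> \<le> ?R x"
        proof (intro mult_left_mono A)
          have "(u x + \<bar>v x\<bar>) powr (p - 1) * \<bar>v x\<bar> \<le> (u x + \<bar>v x\<bar>) powr (p - 1) * (u x + \<bar>v x\<bar>)"
            using elim by (intro mult_left_mono) auto
          also have "\<dots> = (u x + \<bar>v x\<bar>) powr p" using elim by (intro powr_mult_self) auto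
          also have "\<dots> = \<bar>u x + 1 * \<bar>v x\<bar>\<bar> powr p" using elim by simp
          finally show "\<bar>v x\<bar> * ?Y
             \<le> u x powr (r - 1) * \<bar>v x\<bar> + \<bar>v x\<bar> + \<bar>u x + 1 * \<bar>v x\<bar>\<bar> powr p"
            by (simp only: distrib_left mult_1_right mult.commute[of "\<bar>v x\<bar>"])
        qed
        finally show ?case by simp
      qed
    qed measurable
    moreover have "(\<lambda>k. form u v + t k / 2 * energy v) \<longlonglongrightarrow> form u v + 0 / 2 * energy v"
      by (intro tendsto_intros t0) auto
    moreover have "\<forall>\<^sub>F k in sequentially. (\<integral>x. ?q k x \<partial>L) \<le> form u v + t k / 2 * energy v"
      using eventually_admissible[OF uH(1) v u(2)]
    proof eventually_elim
      case (elim k)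
      have wk: "w k \<in> cone_ball E0"
        using w[of k] elim by (auto simp: cone_ball_def t_def)
      have i: "integrable L (\<lambda>x. \<Psi> (w k x))" "integrable L (\<lambda>x. \<Psi> (u x))"
        by (intro integrable_L_growth[OF w(1) \<Psi>] integrable_L_growth[OF uH(1) \<Psi>])+
      have "(\<integral>x. ?q k x \<partial>L) = ((\<integral>x. \<Psi> (w k x) \<partial>L) - (\<integral>x. \<Psi> (u x) \<partial>L)) / t k"
        using i by simp
      also have "\<dots> \<le> ((energy (\<lambda>x. u x + t k * v x) - energy u) / 2) / t k"
        using min[OF wk] w(2)[of k] t(1)[of k] by (intro divide_right_mono) auto
      also have "\<dots> = form u v + t k / 2 * energy v"
        unfolding energy_add_scaled[OF uH(1) v] using t(1)[of k] by (simp add: power2_eq_square add_divide_distrib)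
      finally show ?case .
    qed
    ultimately show ?thesis
      using tendsto_le[OF sequentially_bot] by fastforce
  qed
  have nv: "(\<lambda>x. 0 + (-1) * v x) \<in> X0" by (intro X0_add_scaled zero_X0 v)
  have "form u (\<lambda>x. 0 + (-1) * v x) = - form u v"
    unfolding form_def by (simp add: incr_def algebra_simps flip: Bochner_Integration.integral_minus)
  moreover have "(\<integral>x. \<psi> (u x) * (0 + (-1) * v x) \<partial>L) = - (\<integral>x. \<psi> (u x) * v x \<partial>L)"
    by simp
  ultimately have "form u v \<le> (\<integral>x. \<psi> (u x) * v x \<partial>L)" using half[OF nv] by linarith
  then show ?thesis using half[OF v] by linarith
qed

end

end

section \<open>Primitive of the perturbation\<close>

text \<open>
  Extending \<open>g\<close> by \<open>g 0\<close> to the left of \<open>0\<close> gives a primitive with a two-sided derivative at \<open>0\<close> as well.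
\<close>

lemma primitive_exists:
  fixes g :: "real \<Rightarrow> real"
  assumes "continuous_on {0..} g"
  obtains G where "G 0 = 0" "\<And>t. 0 \<le> t \<Longrightarrow> (G has_real_derivative g t) (at t)"
proof -
  define g' where "g' t = g (max 0 t)" for t
  have c: "continuous_on S g'" for S
    unfolding g'_def by (rule continuous_on_compose2[OF assms]) (auto intro!: continuous_intros)
  define F where "F t = integral {-1..t} g'" for t
  show thesis
  proof (rule that[of "\<lambda>t. F t - F 0"])
    fix t :: real assume t: "0 \<le> t"
    have "(F has_real_derivative g' t) (at t within {-1..t + 1})"
      unfolding F_def using t by (intro integral_has_real_derivative c) auto
    moreover have "at t within {-1..t + 1} = at t" using t by (intro at_within_Icc_at) auto
    ultimately have "(F has_real_derivative g' t) (at t)" by simp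
    then show "((\<lambda>t. F t - F 0) has_real_derivative g t) (at t)"
      using t by (auto intro!: derivative_eq_intros simp: g'_def)
  qed simp
qed

lemma primitive_mvt:
  fixes G g :: "real \<Rightarrow> real"
  assumes G: "\<And>t. 0 \<le> t \<Longrightarrow> (G has_real_derivative g t) (at t)" and "0 \<le> a" "a < b"
  obtains z where "a < z" "z < b" "G b - G a = g z * (b - a)"
proof -
  have D: "(G has_derivative (*) (g z)) (at z)" if "a < z" "z < b" for z
    using G[of z] that \<open>0 \<le> a\<close> unfolding has_field_derivative_def by simp
  have cont: "continuous_on {a..b} G"
  proof (intro continuous_at_imp_continuous_on ballI)
    show "isCont G x" if "x \<in> {a..b}" for x using G[of x] that \<open>0 \<le> a\<close> by (intro DERIV_isCont) auto
  qed
  show thesis by (rule mvt[OF \<open>a < b\<close> cont D]) (use that in blast)+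
qed

lemma primitive_mono:
  fixes G g :: "real \<Rightarrow> real"
  assumes G: "\<And>t. 0 \<le> t \<Longrightarrow> (G has_real_derivative g t) (at t)"
    and g0: "\<And>t. 0 \<le> t \<Longrightarrow> 0 \<le> g t" and "0 \<le> x" "x \<le> y"
  shows "G x \<le> G y"
proof (cases "x = y")
  case False
  then have "x < y" using \<open>x \<le> y\<close> by simp
  from primitive_mvt[OF G \<open>0 \<le> x\<close> this] obtain z where "x < z" "z < y" "G y - G x = g z * (y - x)"
    by blast
  moreover have "0 \<le> g z * (y - x)" using g0[of z] calculation \<open>0 \<le> x\<close> by simp
  ultimately show ?thesis by linarith
qed simp

lemma primitive_lipschitz:
  fixes G g :: "real \<Rightarrow> real"
  assumes G: "\<And>t. 0 \<le> t \<Longrightarrow> (G has_real_derivative g t) (at t)"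
    and g0: "\<And>t. 0 \<le> t \<Longrightarrow> 0 \<le> g t" and g: "\<And>t. 0 \<le> t \<Longrightarrow> g t \<le> C * (1 + t powr e)"
    and e: "0 \<le> e" and C: "0 \<le> C"
    and xy: "0 \<le> x" "0 \<le> y" "x \<le> Z" "y \<le> Z"
  shows "\<bar>G x - G y\<bar> \<le> C * (1 + Z powr e) * \<bar>x - y\<bar>"
proof -
  have *: "G y - G x \<le> C * (1 + Z powr e) * (y - x)" if ord: "0 \<le> x" "x < y" "y \<le> Z" for x y
  proof -
    obtain z where z: "x < z" "z < y" "G y - G x = g z * (y - x)"
      using primitive_mvt[OF G ord(1,2)] by blast
    have "g z \<le> C * (1 + z powr e)" using z ord by (intro g) auto
    also have "\<dots> \<le> C * (1 + Z powr e)"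
      using z ord C e by (intro mult_left_mono add_left_mono powr_mono2) auto
    finally show ?thesis unfolding z(3) using ord by (intro mult_right_mono) auto
  qed
  consider "x < y" | "x = y" | "y < x" by linarith
  then show ?thesis
  proof cases
    case 1
    then show ?thesis using *[of x y] primitive_mono[OF G g0, of x y] xy by simp
  next
    case 3
    then show ?thesis using *[of y x] primitive_mono[OF G g0, of y x] xy by simp
  qed simp
qed

lemma rpow_le: "0 \<le> t \<Longrightarrow> rpow t e \<le> 1 + t powr e"
  by (simp add: rpow_def)

lemma perturbation_growth:
  fixes g :: "real \<Rightarrow> real"
  assumes growth: "\<And>t. 0 \<le> t \<Longrightarrow> g t \<le> a1 + a2 * rpow t (q - 1)"
    and a: "0 \<le> a1" "0 \<le> a2" and q: "1 \<le> q" "q < p" and t: "0 \<le> t"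
  shows "g t \<le> (a1 + a2) + a2 * t powr (q - 1)"
    and "g t \<le> (a1 + 2 * a2) * (1 + t powr (p - 1))"
proof -
  have "a2 * rpow t (q - 1) \<le> a2 * (1 + t powr (q - 1))" using rpow_le[OF t] a by (intro mult_left_mono)
  then show gq: "g t \<le> (a1 + a2) + a2 * t powr (q - 1)" using growth[OF t] by (simp add: distrib_left)
  have "t powr (q - 1) \<le> 1 + t powr (p - 1)"
  proof (cases "t \<le> 1")
    case True
    then have "t powr (q - 1) \<le> 1 powr (q - 1)" using t q by (intro powr_mono2) auto
    then show ?thesis by (simp add: add_increasing2)
  next
    case False
    then have "t powr (q - 1) \<le> t powr (p - 1)" using q by (intro powr_mono) auto
    then show ?thesis by simp
  qed
  then have "a2 * t powr (q - 1) \<le> a2 * (1 + t powr (p - 1))" using a by (intro mult_left_mono)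
  moreover have "0 \<le> (a1 + a2) * t powr (p - 1)" using a by simp
  ultimately show "g t \<le> (a1 + 2 * a2) * (1 + t powr (p - 1))" using gq by (simp add: algebra_simps)
qed

text \<open>
  All three exponents \<open>r\<close>, \<open>1\<close> and \<open>q\<close> in the bound of the potential lie strictly between \<open>0\<close> and \<open>p\<close>.
\<close>

lemma potential_subcritical:
  fixes G g :: "real \<Rightarrow> real"
  assumes G0: "G 0 = 0" and G: "\<And>t. 0 \<le> t \<Longrightarrow> (G has_real_derivative g t) (at t)"
    and r: "0 < r" "r < 1" and p: "1 < p" and q: "1 \<le> q" "q < p" and a: "0 \<le> a1 \<and> 0 \<le> a2"
    and growth: "\<And>t. 0 \<le> t \<Longrightarrow> g t \<le> a1 + a2 * rpow t (q - 1)" and \<epsilon>: "0 < \<epsilon>"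
  shows "\<exists>C\<ge>0. \<forall>t. (max 0 t) powr r / r + G (max 0 t) \<le> \<epsilon> * \<bar>t\<bar> powr p + C"
proof -
  define k where "k = 1 / r + a1 + a2 + a2"
  have "0 < 1 / r" using r by simp
  then have k: "0 < k" using a unfolding k_def by linarith
  define \<epsilon>' where "\<epsilon>' = \<epsilon> / (3 * k)"
  have \<epsilon>': "0 < \<epsilon>'" using \<epsilon> k by (simp add: \<epsilon>'_def)
  obtain C1 where C1: "\<And>t. 0 \<le> t \<Longrightarrow> t powr r \<le> \<epsilon>' * t powr p + C1" "0 \<le> C1"
    by (rule powr_subcritical[OF r(1) _ \<epsilon>', of p]) (use r p in auto)
  obtain C2 where C2: "\<And>t. 0 \<le> t \<Longrightarrow> t powr 1 \<le> \<epsilon>' * t powr p + C2" "0 \<le> C2"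
    by (rule powr_subcritical[OF _ _ \<epsilon>', of 1 p]) (use p in auto)
  obtain C3 where C3: "\<And>t. 0 \<le> t \<Longrightarrow> t powr q \<le> \<epsilon>' * t powr p + C3" "0 \<le> C3"
    by (rule powr_subcritical[OF _ q(2) \<epsilon>']) (use q in auto)
  define C where "C = C1 + C2 + C3"
  have "(max 0 t) powr r / r + G (max 0 t) \<le> \<epsilon> * \<bar>t\<bar> powr p + k * C" for t
  proof -
    define m where "m = max 0 t"
    have m: "0 \<le> m" "m \<le> \<bar>t\<bar>" by (auto simp: m_def)
    have Gm: "G m \<le> (a1 + a2) * m + a2 * m powr q"
    proof (cases "m = 0")
      case False
      then have "0 < m" using m by simp
      from primitive_mvt[OF G order_refl this] obtain z where z: "0 < z" "z < m" "G m - G 0 = g z * (m - 0)"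
        by blast
      have "g z \<le> (a1 + a2) + a2 * z powr (q - 1)"
        using perturbation_growth(1)[of g a1 a2 q p z] growth a q z by auto
      also have "\<dots> \<le> (a1 + a2) + a2 * m powr (q - 1)"
        using z a q by (intro add_left_mono mult_left_mono powr_mono2) auto
      finally have "g z * m \<le> ((a1 + a2) + a2 * m powr (q - 1)) * m" using m by (intro mult_right_mono)
      then have "g z * m \<le> (a1 + a2) * m + a2 * (m powr (q - 1) * m)" by (simp add: algebra_simps)
      then show ?thesis using z G0 powr_mult_self[OF m(1), of q] by simp
    qed (simp add: G0)
    have "m powr r / r + G m \<le> 1 / r * m powr r + ((a1 + a2) * m powr 1 + a2 * m powr q)"
      using Gm m by simp
    also have "\<dots> \<le> k * m powr r + (k * m powr 1 + k * m powr q)"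
      using a r by (intro add_mono mult_right_mono) (auto simp: k_def)
    also have "\<dots> \<le> k * (\<epsilon>' * m powr p + C1) + (k * (\<epsilon>' * m powr p + C2) + k * (\<epsilon>' * m powr p + C3))"
      using C1(1)[OF m(1)] C2(1)[OF m(1)] C3(1)[OF m(1)] k by (intro add_mono mult_left_mono) auto
    also have "\<dots> = (3 * k * \<epsilon>') * m powr p + k * C" by (simp add: C_def algebra_simps)
    also have "3 * k * \<epsilon>' = \<epsilon>" using k by (simp add: \<epsilon>'_def)
    also have "\<epsilon> * m powr p \<le> \<epsilon> * \<bar>t\<bar> powr p" using m \<epsilon> p by (intro mult_left_mono powr_mono2) auto
    finally show ?thesis by (simp add: m_def)
  qed
  moreover have "0 \<le> k * C" using k C1 C2 C3 by (simp add: C_def)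
  ultimately show ?thesis by blast
qed

section \<open>The function spaces of the problem\<close>

context fractional_kernel
begin

lemma Qset_sets: "Qset \<Omega> \<in> sets (lebesgue :: ('a \<times> 'a) measure)"
proof -
  have "closed ((- \<Omega>) \<times> (- \<Omega>))" using \<Omega>_open by (intro closed_Times) auto
  then have "open (Qset \<Omega>)" by (simp add: Qset_def open_Compl)
  then show ?thesis by simp
qed

lemma integrable_K_measure_iff:
  fixes f :: "'a \<times> 'a \<Rightarrow> real"
  assumes "f \<in> borel_measurable lebesgue"
  shows "integrable K_measure f \<longleftrightarrow> integrable lebesgue (\<lambda>z. K (fst z - snd z) * f z)"
  unfolding K_measure_def using assms K_nonneg K_difference_lebesgue by (subst integrable_density) auto

lemma integral_K_measure:
  fixes f :: "'a \<times> 'a \<Rightarrow> real"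
  assumes "f \<in> borel_measurable lebesgue"
  shows "(\<integral>z. f z \<partial>K_measure) = (\<integral>z. K (fst z - snd z) * f z \<partial>lebesgue)"
  unfolding K_measure_def using assms K_nonneg K_difference_lebesgue by (subst integral_density) auto

lemma incr_lebesgue: "u \<in> borel_measurable lebesgue \<Longrightarrow> incr u \<in> borel_measurable lebesgue"
  unfolding incr_def[abs_def]
  by (intro borel_measurable_diff borel_measurable_lebesgue_fst borel_measurable_lebesgue_snd)

lemma incr_vanishes_off_Qset:
  assumes "AE x in lebesgue. x \<notin> \<Omega> \<longrightarrow> u x = 0"
  shows "AE z in lebesgue. z \<notin> Qset \<Omega> \<longrightarrow> incr u z = 0"
  using AE_lebesgue_fst[OF assms] AE_lebesgue_snd[OF assms]
  by eventually_elim (auto simp: Qset_def incr_def)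

text \<open>
  The kernel \<open>K\<close> of the locale is a Borel function with its lower bound everywhere; the kernel \<open>K'\<close> of
  the problem agrees with it only almost everywhere. Spaces and scalar products do not see the
  difference, because the set where \<open>K (x - y) \<noteq> K' (x - y)\<close> is null in the product space.
\<close>

context
  fixes K' :: "'a \<Rightarrow> real"
  assumes K'_meas: "K' \<in> borel_measurable lebesgue" and K'_AE: "AE x in lebesgue. K x = K' x"
begin

lemma X0_inner_eq_form:
  assumes u: "u \<in> X0" and v: "v \<in> X0"
  shows "X0_inner K' \<Omega> u v = form u v"
proof -
  let ?f = "\<lambda>z. incr u z * incr v z"
  have m: "incr u \<in> borel_measurable lebesgue" "incr v \<in> borel_measurable lebesgue"
    using u v by (auto intro: incr_lebesgue X0_measurable)
  have "X0_inner K' \<Omega> u v = (\<integral>z. ?f z * K' (fst z - snd z) \<partial>lebesgue_on (Qset \<Omega>))"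
    unfolding X0_inner_def by (simp add: case_prod_unfold incr_def)
  also have "\<dots> = (\<integral>z. indicator (Qset \<Omega>) z *\<^sub>R (?f z * K' (fst z - snd z)) \<partial>lebesgue)"
    by (rule integral_restrict_space) (use Qset_sets in simp)
  also have "\<dots> = (\<integral>z. K (fst z - snd z) * ?f z \<partial>lebesgue)"
  proof (rule integral_cong_AE)
    show "(\<lambda>z. indicator (Qset \<Omega>) z *\<^sub>R (?f z * K' (fst z - snd z))) \<in> borel_measurable lebesgue"
      by (intro borel_measurable_scaleR borel_measurable_indicator borel_measurable_times m
          borel_measurable_lebesgue_diff K'_meas Qset_sets)
    show "(\<lambda>z. K (fst z - snd z) * ?f z) \<in> borel_measurable lebesgue"
      by (intro borel_measurable_times m K_difference_lebesgue)
    show "AE z in lebesgue. indicator (Qset \<Omega>) z *\<^sub>R (?f z * K' (fst z - snd z)) = K (fst z - snd z) * ?f z"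
      using AE_lebesgue_diff[OF K'_AE] incr_vanishes_off_Qset[OF X0_off[OF u]]
      by eventually_elim (auto simp: indicator_def)
  qed
  also have "\<dots> = form u v"
    unfolding form_def by (rule integral_K_measure[symmetric]) (intro borel_measurable_times m)
  finally show ?thesis .
qed

lemma X0_space_eq: "X0_space K' \<Omega> = X0"
proof (intro set_eqI iffI)
  let ?F = "\<lambda>u z. incr u z * sqrt (K' (fst z - snd z))"
  have F: "(\<lambda>(x, y). (u x - u y) * sqrt (K' (x - y))) = ?F u" for u :: "'a \<Rightarrow> real"
    by (auto simp: incr_def)
  have Fm: "?F u \<in> borel_measurable lebesgue" if "u \<in> borel_measurable lebesgue" for u
    by (intro borel_measurable_times incr_lebesgue that measurable_compose[OF borel_measurable_lebesgue_diff[OF K'_meas] borel_measurable_sqrt])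
  have iff: "integrable (lebesgue_on (Qset \<Omega>)) (\<lambda>z. (?F u z)\<^sup>2) \<longleftrightarrow> integrable K_measure (\<lambda>z. (incr u z)\<^sup>2)"
    if u: "u \<in> borel_measurable lebesgue" and off: "AE x in lebesgue. x \<notin> \<Omega> \<longrightarrow> u x = 0" for u
  proof -
    have im: "(\<lambda>z. (incr u z)\<^sup>2) \<in> borel_measurable lebesgue"
      by (intro borel_measurable_power incr_lebesgue u)
    have "integrable (lebesgue_on (Qset \<Omega>)) (\<lambda>z. (?F u z)\<^sup>2) \<longleftrightarrow>
        integrable lebesgue (\<lambda>z. indicator (Qset \<Omega>) z *\<^sub>R (?F u z)\<^sup>2)"
      by (rule integrable_restrict_space) (use Qset_sets in simp)
    also have "\<dots> \<longleftrightarrow> integrable lebesgue (\<lambda>z. K (fst z - snd z) * (incr u z)\<^sup>2)"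
    proof (rule integrable_cong_AE)
      show "(\<lambda>z. indicator (Qset \<Omega>) z *\<^sub>R (?F u z)\<^sup>2) \<in> borel_measurable lebesgue"
        by (intro borel_measurable_scaleR borel_measurable_indicator borel_measurable_power Fm u Qset_sets)
      show "(\<lambda>z. K (fst z - snd z) * (incr u z)\<^sup>2) \<in> borel_measurable lebesgue"
        by (intro borel_measurable_times K_difference_lebesgue im)
      show "AE z in lebesgue. indicator (Qset \<Omega>) z *\<^sub>R (?F u z)\<^sup>2 = K (fst z - snd z) * (incr u z)\<^sup>2"
        using AE_lebesgue_diff[OF K'_AE] incr_vanishes_off_Qset[OF off]
      proof eventually_elim
        case (elim z)
        have "(sqrt (K' (fst z - snd z)))\<^sup>2 = K (fst z - snd z)" using elim K_nonneg[of "fst z - snd z"] by simp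
        then show ?case using elim(2) by (auto simp: indicator_def power_mult_distrib)
      qed
    qed
    also have "\<dots> \<longleftrightarrow> integrable K_measure (\<lambda>z. (incr u z)\<^sup>2)"
      by (rule integrable_K_measure_iff[OF im, symmetric])
    finally show ?thesis .
  qed
  {
    fix u assume "u \<in> X0_space K' \<Omega>"
    then show "u \<in> X0"
      using iff[of u] by (auto simp: X0_space_def X_space_def L2_on_def F X0_def)
  next
    fix u assume u: "u \<in> X0"
    have um: "u \<in> borel_measurable lebesgue" and off: "AE x in lebesgue. x \<notin> \<Omega> \<longrightarrow> u x = 0"
      using u by (auto intro: X0_measurable X0_off)
    have "integrable L (\<lambda>x. (u x)\<^sup>2)"
    proof (rule integrable_L_growth[OF u, where c = 1 and d = 1])
      show "\<bar>t\<^sup>2\<bar> \<le> 1 * \<bar>t\<bar> powr p + 1" for t :: real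
      proof (cases "\<bar>t\<bar> \<le> 1")
        case True
        then have "t\<^sup>2 \<le> 1" by (simp add: abs_square_le_1)
        then show ?thesis by (simp add: add_increasing)
      next
        case False
        have "\<bar>t\<bar> powr 2 \<le> \<bar>t\<bar> powr p" using False p_gt2 by (intro powr_mono) auto
        then show ?thesis using False by simp
      qed
    qed measurable
    then show "u \<in> X0_space K' \<Omega>"
      using um off iff[OF um off] X0_integrable[OF u] measurable_L[OF um] measurable_restrict_space1[OF Fm[OF um]]
      by (simp add: X0_space_def X_space_def L2_on_def F)
  }
qed

text \<open>
  The Sobolev inequality bounds the quotients, so that the supremum is a genuine least upper bound; it
  is positive because it is at least the quotient of \<open>bump\<close>.
\<close>

lemma embedding_const_pos: "0 < embedding_const K' \<Omega> p"
proof -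
  let ?S = "{u \<in> X0. \<not> (AE x in lebesgue. u x = 0)}"
  let ?q = "\<lambda>u. Lp_norm p u / X0_norm K' \<Omega> u"
  have norm: "X0_norm K' \<Omega> u = sqrt (energy u)" if "u \<in> X0" for u
    unfolding X0_norm_def X0_inner_eq_form[OF that that] energy_form ..
  have "?q u \<le> 1 / sqrt c_sob" if u: "u \<in> ?S" for u
  proof -
    have uH: "u \<in> X0" using u by simp
    have "Lp_norm p u \<le> ((energy u / c_sob) powr (p / 2)) powr (1 / p)"
      unfolding Lp_norm_def using sobolev_inequality[OF uH] p_gt2 by (intro powr_mono2) auto
    also have "\<dots> = (energy u / c_sob) powr (1 / 2)" using p_gt2 by (simp add: powr_powr)
    also have "\<dots> = sqrt (energy u) / sqrt c_sob"
      using energy_nonneg[of u] c_sob_pos by (simp add: powr_half_sqrt real_sqrt_divide)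
    finally have le: "Lp_norm p u \<le> sqrt (energy u) * (1 / sqrt c_sob)" by simp
    \<comment> \<open>for energy \<open>0\<close> the quotient is \<open>x / 0 = 0\<close>\<close>
    show ?thesis
    proof (cases "energy u = 0")
      case False
      then have "0 < sqrt (energy u)" using energy_nonneg[of u] by simp
      then show ?thesis unfolding norm[OF uH] using le by (simp add: pos_divide_le_eq mult.commute)
    qed (use c_sob_pos in \<open>simp add: norm[OF uH]\<close>)
  qed
  then have bdd: "bdd_above (?q ` ?S)" by (auto intro!: bdd_aboveI2)
  have bm: "bump \<in> borel_measurable lebesgue" by (rule X0_measurable[OF bump_X0])
  have notAE: "\<not> (AE x in lebesgue. bump x = 0)"
  proof
    assume "AE x in lebesgue. bump x = 0"
    then have "AE x in lebesgue. x \<notin> \<Omega>"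
      by eventually_elim (use bump_pos in force)
    then have "\<Omega> \<in> null_sets lebesgue"
      by (subst (asm) AE_iff_null_sets[symmetric]) auto
    then have "negligible \<Omega>" by (simp add: negligible_iff_null_sets)
    then show False using \<Omega>_open \<Omega>_ne open_not_negligible by blast
  qed
  have I: "0 < (\<integral>x. \<bar>bump x\<bar> powr p \<partial>lebesgue)"
  proof (rule ccontr)
    assume "\<not> ?thesis"
    moreover have "0 \<le> (\<integral>x. \<bar>bump x\<bar> powr p \<partial>lebesgue)" by (rule integral_nonneg_AE) simp
    ultimately have "(\<integral>x. \<bar>bump x\<bar> powr p \<partial>lebesgue) = 0" by linarith
    then have "AE x in lebesgue. \<bar>bump x\<bar> powr p = 0"
      using integral_nonneg_eq_0_iff_AE[OF sobolev_integrable_powr[OF bump_X0]] by simp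
    then have "AE x in lebesgue. bump x = 0" by eventually_elim simp
    then show False using notAE by blast
  qed
  then have "0 < Lp_norm p bump" by (simp add: Lp_norm_def)
  moreover have "0 < energy bump"
  proof (rule ccontr)
    assume "\<not> ?thesis"
    then have "energy bump = 0" using energy_nonneg[of bump] by linarith
    then show False using I sobolev_inequality[OF bump_X0] by simp
  qed
  ultimately have "0 < ?q bump" by (simp add: norm[OF bump_X0])
  also have "\<dots> \<le> (SUP u\<in>?S. ?q u)"
    by (rule cSUP_upper[OF _ bdd]) (use bump_X0 notAE in simp)
  also have "\<dots> = embedding_const K' \<Omega> p" by (simp add: embedding_const_def X0_space_eq)
  finally show ?thesis .
qed

section \<open>Solutions for small parameters\<close>

text \<open>
  The ball is fixed by \<open>\<mu>\<close> alone. On its boundary the quadratic part minus the critical part is at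
  least \<open>E0 / 4\<close>, while the remaining term is at most \<open>l * B\<close>; the bound on \<open>l\<close> makes the functional
  positive there, which pushes the minimiser into the interior.
\<close>

theorem small_parameter_solution:
  fixes g :: "real \<Rightarrow> real" and \<mu> r q a1 a2 :: real
  assumes \<mu>: "0 < \<mu>" and r: "0 < r" "r < 1"
    and gc: "continuous_on {0..} g" and g0: "\<And>t. 0 \<le> t \<Longrightarrow> 0 \<le> g t"
    and a: "0 \<le> a1" "0 \<le> a2" and q: "1 \<le> q" "q < p"
    and growth: "\<And>t. 0 \<le> t \<Longrightarrow> g t \<le> a1 + a2 * rpow t (q - 1)"
  obtains ls where "0 < ls"
    "\<And>l. 0 < l \<Longrightarrow> l < ls \<Longrightarrow> \<exists>u. weak_solution K' \<Omega> p r g \<mu> l u"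
proof -
  obtain G where G0: "G 0 = 0" and G: "\<And>t. 0 \<le> t \<Longrightarrow> (G has_real_derivative g t) (at t)"
    by (rule primitive_exists[OF gc]) auto
  define Cg where "Cg = a1 + 2 * a2"
  have Cg: "0 \<le> Cg" using a by (simp add: Cg_def)
  have gp: "g t \<le> Cg * (1 + t powr (p - 1))" if "0 \<le> t" for t
    unfolding Cg_def using perturbation_growth(2)[of g a1 a2 q p t] growth a q that by auto
  have Gmono: "G x \<le> G y" if "0 \<le> x" "x \<le> y" for x y
    by (rule primitive_mono[OF G g0 that])
  have Gnn: "0 \<le> G x" if "0 \<le> x" for x using Gmono[OF _ that] G0 by simp
  have Glip: "\<bar>G x - G y\<bar> \<le> Cg * (1 + Z powr (p - 1)) * \<bar>x - y\<bar>"
    if "0 \<le> x" "0 \<le> y" "x \<le> Z" "y \<le> Z" for x y Z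
    using primitive_lipschitz[OF G g0 gp _ Cg that] p_gt2 by simp
  \<comment> \<open>extended by \<open>0\<close> to the negative axis\<close>
  define N where "N t = (max 0 t) powr r / r + G (max 0 t)" for t
  have Nnn: "0 \<le> N t" for t unfolding N_def using r Gnn by simp
  have Nc: "continuous_on UNIV N"
  proof -
    have "continuous_on {0..} G"
      using G by (intro continuous_at_imp_continuous_on ballI) (auto intro: DERIV_isCont)
    then have "continuous_on UNIV (\<lambda>t. G (max 0 t))"
      by (rule continuous_on_compose2) (auto intro!: continuous_intros)
    moreover have "continuous_on UNIV (\<lambda>t::real. (max 0 t) powr r)"
      using r by (intro continuous_on_powr' continuous_intros) auto
    ultimately show ?thesis
      unfolding N_def using r by (intro continuous_on_add continuous_on_divide continuous_on_const) auto
  qed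
  have Ng: "\<exists>C\<ge>0. \<forall>t. N t \<le> \<epsilon> * \<bar>t\<bar> powr p + C" if "0 < \<epsilon>" for \<epsilon>
    unfolding N_def using r q p_gt2 a that
    by (intro potential_subcritical[OF G0 G _ _ _ _ _ _ growth]) auto
  obtain C1 where C1: "0 \<le> C1" "\<And>t. N t \<le> 1 * \<bar>t\<bar> powr p + C1" using Ng[of 1] by auto
  obtain E0 where E0: "0 < E0"
    and small: "\<And>e. 0 \<le> e \<Longrightarrow> e \<le> 4 * E0 \<Longrightarrow> \<mu> / p * (e / c_sob) powr (p / 2) \<le> e / 4"
    using small_ball_radius[OF \<mu>] by blast
  define B where "B = (E0 / c_sob) powr (p / 2) + C1 * measure lebesgue \<Omega>"
  have B: "0 \<le> B" using C1 by (simp add: B_def)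
  show thesis
  proof (rule that[of "E0 / (4 * (B + 1))"])
    show "0 < E0 / (4 * (B + 1))" using E0 B by simp
    fix l assume l: "0 < l" "l < E0 / (4 * (B + 1))"
    define N' where "N' t = l * N t" for t
    have N': "continuous_on UNIV N'" "0 \<le> N' t" for t
      unfolding N'_def[abs_def] using Nc Nnn l by (auto intro!: continuous_intros)
    have N'g: "\<exists>C. \<forall>t. N' t \<le> \<epsilon> * \<bar>t\<bar> powr p + C" if \<epsilon>: "0 < \<epsilon>" for \<epsilon>
    proof -
      obtain C where "\<And>t. N t \<le> \<epsilon> / l * \<bar>t\<bar> powr p + C" using Ng[of "\<epsilon> / l"] \<epsilon> l by auto
      then have "l * N t \<le> l * (\<epsilon> / l * \<bar>t\<bar> powr p + C)" for t using l by (intro mult_left_mono) auto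
      then have "N' t \<le> \<epsilon> * \<bar>t\<bar> powr p + l * C" for t using l by (simp add: N'_def distrib_left)
      then show ?thesis by blast
    qed
    obtain u where u: "u \<in> cone_ball E0" and umin: "\<And>w. w \<in> cone_ball E0 \<Longrightarrow> J \<mu> N' u \<le> J \<mu> N' w"
      using minimiser_exists[OF less_imp_le[OF E0] less_imp_le[OF \<mu>] small N' N'g] by blast
    have uH: "u \<in> X0" "\<And>x. 0 \<le> u x" "energy u \<le> E0" using u by (auto simp: cone_ball_def)
    have N'm: "N' \<in> borel_measurable borel" by (rule borel_measurable_continuous_onI[OF N'(1)])
    have N'b: "\<bar>N' t\<bar> \<le> l * \<bar>t\<bar> powr p + l * C1" for t
    proof -
      have "l * N t \<le> l * (1 * \<bar>t\<bar> powr p + C1)" using C1(2) l by (intro mult_left_mono) auto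
      then show ?thesis using N'(2)[of t] by (simp add: N'_def distrib_left)
    qed
    have N'i: "integrable L (\<lambda>x. N' (w x))" if "w \<in> X0" for w
      by (rule integrable_L_growth[OF that N'm N'b])
    have "energy u \<noteq> E0"
    proof
      assume e: "energy u = E0"
      have "(\<integral>x. N' (u x) \<partial>L) \<le> (\<integral>x. l * (\<bar>u x\<bar> powr p + C1) \<partial>L)"
        using N'i[OF uH(1)] N'b sobolev_L(1)[OF uH(1)] integrable_L_const
        by (intro integral_mono) (auto simp: distrib_left intro: order_trans[OF abs_ge_self])
      also have "\<dots> = l * ((\<integral>x. \<bar>u x\<bar> powr p \<partial>L) + C1 * measure lebesgue \<Omega>)"
        using Bochner_Integration.integral_add[OF sobolev_L(1)[OF uH(1)] integrable_L_const[of C1]]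
        by (simp only: integral_mult_right_zero integral_L_const)
      also have "\<dots> \<le> l * B"
        unfolding B_def using sobolev_L_le[OF uH(1,3)] l by (intro mult_left_mono) auto
      also have "\<dots> < E0 / 4"
      proof -
        have "l * B \<le> l * (B + 1)" using l by (intro mult_left_mono) auto
        moreover have "l * (B + 1) < E0 / 4" using l(2) B by (simp add: pos_less_divide_eq mult_ac)
        ultimately show ?thesis by linarith
      qed
      finally have 1: "(\<integral>x. N' (u x) \<partial>L) < E0 / 4" .
      have "\<mu> / p * (\<integral>x. \<bar>u x\<bar> powr p \<partial>L) \<le> \<mu> / p * (E0 / c_sob) powr (p / 2)"
        using sobolev_L_le[OF uH(1,3)] \<mu> p_gt2 by (intro mult_left_mono) auto
      also have "\<dots> \<le> E0 / 4" using E0 by (intro small) auto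
      finally have 2: "\<mu> / p * (\<integral>x. \<bar>u x\<bar> powr p \<partial>L) \<le> E0 / 4" .
      have "0 < J \<mu> N' u" unfolding J_def e using 1 2 by linarith
      moreover have "J \<mu> N' (\<lambda>x. 0) = 0"
        by (simp add: J_def energy_zero N'_def N_def G0)
      moreover have "J \<mu> N' u \<le> J \<mu> N' (\<lambda>x. 0)"
        using zero_X0 energy_zero E0 by (intro umin) (simp add: cone_ball_def)
      ultimately show False by linarith
    qed
    then have ue: "energy u < E0" using uH(3) by simp
    define \<Psi> where "\<Psi> t = \<mu> / p * \<bar>t\<bar> powr p + N' t" for t
    \<comment> \<open>the derivative of \<open>\<Psi>\<close> on the positive axis; \<open>max 0 t\<close> makes it Borel on the whole line\<close>
    define \<psi> where "\<psi> t = \<mu> * t powr (p - 1) + l * (t powr (r - 1) + g (max 0 t))" for t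
    have \<Psi>m: "\<Psi> \<in> borel_measurable borel" unfolding \<Psi>_def[abs_def] using N'm by measurable
    have \<Psi>b: "\<bar>\<Psi> t\<bar> \<le> (\<mu> / p + l) * \<bar>t\<bar> powr p + l * C1" for t
    proof -
      have "0 \<le> \<mu> / p * \<bar>t\<bar> powr p" using \<mu> p_gt2 by simp
      then show ?thesis using N'b[of t] N'(2)[of t] by (simp add: \<Psi>_def distrib_right)
    qed
    have "continuous_on UNIV (\<lambda>t. g (max 0 t))"
      by (rule continuous_on_compose2[OF gc]) (auto intro!: continuous_intros)
    then have [measurable]: "(\<lambda>t. g (max 0 t)) \<in> borel_measurable borel" by (rule borel_measurable_continuous_onI)
    have \<psi>m[measurable]: "\<psi> \<in> borel_measurable borel" unfolding \<psi>_def[abs_def] by measurable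
    have lower: "l * ((a + h) powr (r - 1) * h) \<le> \<Psi> (a + h) - \<Psi> a" if ah: "0 \<le> a" "0 \<le> h" for a h
    proof -
      have "r * (a + h) powr (r - 1) * h \<le> (a + h) powr r - a powr r"
        by (rule powr_concave_lower[OF ah r])
      then have "(a + h) powr (r - 1) * h \<le> ((a + h) powr r - a powr r) / r"
        using r by (simp add: pos_le_divide_eq mult_ac)
      moreover have "G a \<le> G (a + h)" using ah by (intro Gmono) auto
      ultimately have "(a + h) powr (r - 1) * h \<le> N (a + h) - N a"
        using ah by (simp add: N_def diff_divide_distrib)
      then have "l * ((a + h) powr (r - 1) * h) \<le> l * (N (a + h) - N a)" using l by (intro mult_left_mono) auto
      moreover have "\<mu> / p * \<bar>a\<bar> powr p \<le> \<mu> / p * \<bar>a + h\<bar> powr p"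
        using ah \<mu> p_gt2 by (intro mult_left_mono powr_mono2) auto
      ultimately show ?thesis by (simp add: \<Psi>_def N'_def right_diff_distrib)
    qed
    define A where "A = \<mu> + l / r + l * Cg"
    have A: "0 \<le> A" using \<mu> l r Cg by (simp add: A_def)
    have upper: "\<bar>\<Psi> (max 0 (a + h)) - \<Psi> a\<bar> \<le> A * (\<bar>h\<bar> * (a powr (r - 1) + 1 + (a + \<bar>h\<bar>) powr (p - 1)))"
      if a: "0 < a" for a h
    proof -
      define m where "m = max 0 (a + h)"
      define Y where "Y = (a + \<bar>h\<bar>) powr (p - 1)"
      let ?Z = "\<bar>h\<bar> * (a powr (r - 1) + 1 + Y)"
      have m: "0 \<le> m" "m \<le> a + \<bar>h\<bar>" "\<bar>m - a\<bar> \<le> \<bar>h\<bar>" using a by (auto simp: m_def)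
      have Y: "0 \<le> Y" by (simp add: Y_def)
      have "(max m a) powr (p - 1) \<le> Y" unfolding Y_def using m a p_gt2 by (intro powr_mono2) auto
      then have Z: "(max m a) powr (p - 1) \<le> a powr (r - 1) + 1 + Y" by (rule add_increasing[rotated]) simp
      have "\<bar>m powr p - a powr p\<bar> \<le> p * (max m a) powr (p - 1) * \<bar>m - a\<bar>"
        using m a p_gt2 by (intro powr_diff_le) auto
      also have "\<dots> \<le> p * (a powr (r - 1) + 1 + Y) * \<bar>h\<bar>"
        using m Z Y p_gt2 by (intro mult_mono mult_left_mono) auto
      finally have "\<mu> / p * \<bar>m powr p - a powr p\<bar> \<le> \<mu> / p * (p * (a powr (r - 1) + 1 + Y) * \<bar>h\<bar>)"
        using \<mu> p_gt2 by (intro mult_left_mono) auto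
      then have 1: "\<mu> / p * \<bar>m powr p - a powr p\<bar> \<le> \<mu> * ?Z" using p_gt2 by (simp add: mult_ac)
      have "\<bar>m powr r - a powr r\<bar> \<le> a powr (r - 1) * \<bar>h\<bar>"
        unfolding m_def by (rule powr_concave_upper[OF a r])
      also have "\<dots> \<le> ?Z" using Y by (simp add: mult.commute mult_left_mono)
      finally have 2: "l / r * \<bar>m powr r - a powr r\<bar> \<le> l / r * ?Z" using l r by (intro mult_left_mono) auto
      have "\<bar>G m - G a\<bar> \<le> Cg * (1 + Y) * \<bar>m - a\<bar>" unfolding Y_def using m a by (intro Glip) auto
      also have "\<dots> \<le> Cg * (a powr (r - 1) + 1 + Y) * \<bar>h\<bar>" using m Cg Y by (intro mult_mono) auto
      finally have "l * \<bar>G m - G a\<bar> \<le> l * (Cg * (a powr (r - 1) + 1 + Y) * \<bar>h\<bar>)"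
        using l by (intro mult_left_mono) auto
      then have 3: "l * \<bar>G m - G a\<bar> \<le> l * Cg * ?Z" by (simp add: mult_ac)
      have "\<Psi> m - \<Psi> a = \<mu> / p * (m powr p - a powr p) + (l / r * (m powr r - a powr r) + l * (G m - G a))"
        using m a by (simp add: \<Psi>_def N'_def N_def algebra_simps diff_divide_distrib)
      also have "\<bar>\<dots>\<bar> \<le> \<mu> / p * \<bar>m powr p - a powr p\<bar> + (l / r * \<bar>m powr r - a powr r\<bar> + l * \<bar>G m - G a\<bar>)"
        using \<mu> p_gt2 l r
        by (intro order_trans[OF abs_triangle_ineq] add_mono) (simp_all add: abs_mult)
      also have "\<dots> \<le> \<mu> * ?Z + (l / r * ?Z + l * Cg * ?Z)" using 1 2 3 by (intro add_mono)
      also have "\<dots> = A * ?Z" by (simp add: A_def distrib_right)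
      finally show ?thesis unfolding m_def Y_def .
    qed
    have der: "(\<Psi> has_real_derivative \<psi> a) (at a)" if a: "0 < a" for a
    proof -
      have "((\<lambda>t. \<mu> / p * t powr p + l * (t powr r / r + G t)) has_real_derivative
          \<mu> / p * (p * a powr (p - 1)) + l * (r * a powr (r - 1) / r + g a)) (at a)"
        using a r by (intro DERIV_add DERIV_cmult DERIV_cdivide G has_real_derivative_powr) auto
      also have "\<mu> / p * (p * a powr (p - 1)) + l * (r * a powr (r - 1) / r + g a) = \<psi> a"
        using a p_gt2 r by (simp add: \<psi>_def)
      finally show ?thesis
        by (rule has_field_derivative_transform_within_open[where S = "{0<..}"])
          (use a in \<open>auto simp: \<Psi>_def N'_def N_def\<close>)
    qed
    have min: "(\<integral>x. \<Psi> (w x) \<partial>L) - (\<integral>x. \<Psi> (u x) \<partial>L) \<le> (energy w - energy u) / 2" if w: "w \<in> cone_ball E0" for w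
    proof -
      have wH: "w \<in> X0" using w by (simp add: cone_ball_def)
      have eq: "(\<integral>x. \<Psi> (w x) \<partial>L) = \<mu> / p * (\<integral>x. \<bar>w x\<bar> powr p \<partial>L) + (\<integral>x. N' (w x) \<partial>L)" if "w \<in> X0" for w
      proof -
        have "integrable L (\<lambda>x. \<mu> / p * \<bar>w x\<bar> powr p)" using sobolev_L(1)[OF that] by simp
        from Bochner_Integration.integral_add[OF this N'i[OF that]] show ?thesis
          unfolding \<Psi>_def by (simp only: integral_mult_right_zero)
      qed
      show ?thesis using umin[OF w] unfolding J_def eq[OF wH] eq[OF uH(1)] by (simp add: diff_divide_distrib)
    qed
    have pos: "AE x in L. 0 < u x"
      by (rule minimiser_positive(1)[OF \<Psi>m \<Psi>b u ue min l(1) r lower])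
    have sing: "integrable L (\<lambda>x. u x powr (r - 1) * v x)" if "v \<in> X0" for v
      by (rule minimiser_positive(2)[OF \<Psi>m \<Psi>b u ue min l(1) r lower that])
    have eq: "form u v = \<mu> * (\<integral>x. u x powr (p - 1) * v x \<partial>L)
           + l * (\<integral>x. (u x powr (r - 1) + g (u x)) * v x \<partial>L)" if v: "v \<in> X0" for v
    proof -
      have i1: "integrable L (\<lambda>x. u x powr (p - 1) * v x)" by (rule integrable_powr_mult[OF uH(1,2) v])
      have [measurable]: "u \<in> borel_measurable L" "v \<in> borel_measurable L"
        using uH v by (auto intro: X0_measurable_L)
      have i2: "integrable L (\<lambda>x. g (u x) * v x)"
      proof (rule Bochner_Integration.integrable_bound)
        show "integrable L (\<lambda>x. Cg * (\<bar>v x\<bar> + u x powr (p - 1) * \<bar>v x\<bar>))"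
          using integrable_L[OF X0_L1(1)[OF X0_abs[OF v]]] integrable_powr_mult[OF uH(1,2) X0_abs[OF v]] by simp
        have "(\<lambda>x. g (max 0 (u x)) * v x) \<in> borel_measurable L" by measurable
        then show "(\<lambda>x. g (u x) * v x) \<in> borel_measurable L" using uH(2) by (simp add: max_absorb2)
        show "AE x in L. norm (g (u x) * v x) \<le> norm (Cg * (\<bar>v x\<bar> + u x powr (p - 1) * \<bar>v x\<bar>))"
        proof (intro AE_I2)
          fix x
          have "g (u x) * \<bar>v x\<bar> \<le> Cg * (1 + u x powr (p - 1)) * \<bar>v x\<bar>"
            using gp[OF uH(2)] by (intro mult_right_mono) auto
          also have "\<dots> = Cg * (\<bar>v x\<bar> + u x powr (p - 1) * \<bar>v x\<bar>)" by (simp add: distrib_right mult.assoc)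
          finally show "norm (g (u x) * v x) \<le> norm (Cg * (\<bar>v x\<bar> + u x powr (p - 1) * \<bar>v x\<bar>))"
            using g0[OF uH(2)[of x]] Cg by (simp add: abs_mult)
        qed
      qed
      have i3: "integrable L (\<lambda>x. (u x powr (r - 1) + g (u x)) * v x)"
        using Bochner_Integration.integrable_add[OF sing[OF v] i2] by (simp add: distrib_right)
      have "form u v = (\<integral>x. \<psi> (u x) * v x \<partial>L)"
        by (rule euler_lagrange[OF \<Psi>m \<Psi>b u ue min upper A der \<psi>m pos sing v])
      also have "\<dots> = (\<integral>x. \<mu> * (u x powr (p - 1) * v x) + l * ((u x powr (r - 1) + g (u x)) * v x) \<partial>L)"
        using uH(2) by (intro Bochner_Integration.integral_cong) (auto simp: \<psi>_def max_absorb2 algebra_simps)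
      also have "\<dots> = (\<integral>x. \<mu> * (u x powr (p - 1) * v x) \<partial>L) + (\<integral>x. l * ((u x powr (r - 1) + g (u x)) * v x) \<partial>L)"
        using i1 i3 by (intro Bochner_Integration.integral_add) auto
      also have "\<dots> = \<mu> * (\<integral>x. u x powr (p - 1) * v x \<partial>L)
           + l * (\<integral>x. (u x powr (r - 1) + g (u x)) * v x \<partial>L)"
        by (simp only: integral_mult_right_zero)
      finally show ?thesis .
    qed
    have "weak_solution K' \<Omega> p r g \<mu> l u"
      unfolding weak_solution_def X0_space_eq
      using uH(1) pos sing eq by (simp add: AE_L_iff X0_inner_eq_form)
    then show "\<exists>u. weak_solution K' \<Omega> p r g \<mu> l u" by blast
  qed
qed

end

lemma measure_\<Omega>_pos: "0 < measure lebesgue \<Omega>"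
proof -
  have "\<not> negligible \<Omega>" using \<Omega>_open \<Omega>_ne open_not_negligible by blast
  then have "emeasure lebesgue \<Omega> \<noteq> 0"
    by (simp add: negligible_iff_null_sets null_sets_def)
  then have "emeasure lborel \<Omega> \<noteq> 0" by simp
  then show ?thesis using \<Omega>_fin by (simp add: measure_def enn2real_positive_iff less_top zero_less_iff_neq_zero)
qed

end

section \<open>The maximum of the auxiliary function and the theorem\<close>

text \<open>
  The denominator is positive, and the numerator \<open>t powr (2 - r) * (1 - b * t powr (p - 2))\<close> is positive
  exactly for \<open>t\<close> between \<open>0\<close> and \<open>T\<close>; so the maximum over the compact interval is the global one.
\<close>

lemma k_fun_attains_max:
  fixes p c V r q a1 a2 \<mu> :: real
  assumes p: "2 < p" and c: "0 < c" and V: "0 < V" and r: "0 < r" "r < 1" and q: "1 \<le> q"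
    and a: "0 \<le> a1" "0 \<le> a2" and \<mu>: "0 < \<mu>"
  obtains t0 where "0 \<le> t0" "\<And>t. 0 \<le> t \<Longrightarrow> k_fun p c V r q a1 a2 \<mu> t \<le> k_fun p c V r q a1 a2 \<mu> t0"
    "0 < k_fun p c V r q a1 a2 \<mu> t0"
proof -
  let ?k = "k_fun p c V r q a1 a2 \<mu>"
  define b where "b = \<mu> * c powr p"
  have b: "0 < b" using \<mu> c by (simp add: b_def)
  define Dn where "Dn t = c powr r * V powr ((p - r) / p)
      + a1 * c * V powr ((p - 1) / p) * t powr (1 - r)
      + a2 * c powr q * V powr ((p - q) / p) * t powr (q - r)" for t
  have Dn: "0 < Dn t" for t
  proof -
    have "0 < c powr r * V powr ((p - r) / p)" using c V by simp
    moreover have "0 \<le> a1 * c * V powr ((p - 1) / p) * t powr (1 - r)" using a c by simp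
    moreover have "0 \<le> a2 * c powr q * V powr ((p - q) / p) * t powr (q - r)" using a by simp
    ultimately show ?thesis unfolding Dn_def by linarith
  qed
  have k: "?k t = (t powr (2 - r) - b * t powr (p - r)) / Dn t" for t
    by (simp add: k_fun_def Dn_def b_def)
  \<comment> \<open>the positive zero of the numerator\<close>
  define T where "T = (1 / b) powr (1 / (p - 2))"
  have T: "0 < T" using b by (simp add: T_def)
  have Tp: "T powr (p - 2) = 1 / b" using b p by (simp add: T_def powr_powr)
  have num: "t powr (2 - r) - b * t powr (p - r) = t powr (2 - r) * (1 - b * t powr (p - 2))" if "0 < t" for t
  proof -
    have "t powr (p - r) = t powr (2 - r) * t powr (p - 2)" using that by (simp add: powr_add[symmetric])
    then show ?thesis by (simp add: algebra_simps)
  qed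
  have neg: "?k t \<le> 0" if t: "T \<le> t" for t
  proof -
    have "1 / b \<le> t powr (p - 2)" unfolding Tp[symmetric] using t T p by (intro powr_mono2) auto
    then have "1 - b * t powr (p - 2) \<le> 0" using b by (simp add: pos_divide_le_eq mult.commute)
    then have "t powr (2 - r) * (1 - b * t powr (p - 2)) \<le> 0" by (intro mult_nonneg_nonpos) auto
    then show ?thesis unfolding k using num[of t] t T Dn[of t] by (simp add: divide_nonpos_pos)
  qed
  have pos: "0 < ?k (T / 2)"
  proof -
    have "(T / 2) powr (p - 2) < T powr (p - 2)" using T p by (intro powr_less_mono2) auto
    then have "0 < 1 - b * (T / 2) powr (p - 2)" using b unfolding Tp by (simp add: pos_less_divide_eq mult.commute)
    then have "0 < (T / 2) powr (2 - r) * (1 - b * (T / 2) powr (p - 2))" using T by simp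
    then show ?thesis unfolding k using num[of "T / 2"] T Dn[of "T / 2"] by simp
  qed
  have pw: "continuous_on {0..T} (\<lambda>t. t powr e)" if "0 < e" for e :: real
    using that by (intro continuous_on_powr' continuous_intros) auto
  have cont: "continuous_on {0..T} ?k"
  proof -
    have "Dn t \<noteq> 0" for t using Dn[of t] by simp
    then have "continuous_on {0..T} (\<lambda>t. (t powr (2 - r) - b * t powr (p - r)) / Dn t)"
      using r p q unfolding Dn_def
      by (intro continuous_on_divide continuous_on_diff continuous_on_add continuous_on_mult
          continuous_on_const pw ballI) auto
    then show ?thesis by (simp add: k)
  qed
  have "compact {0..T}" "{0..T} \<noteq> {}" using T by auto
  from continuous_attains_sup[OF this cont] obtain t0
    where t0: "t0 \<in> {0..T}" "\<And>t. t \<in> {0..T} \<Longrightarrow> ?k t \<le> ?k t0" by blast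
  have "?k (T / 2) \<le> ?k t0" using t0(2)[of "T / 2"] T by simp
  with pos have p0: "0 < ?k t0" by linarith
  have "?k t \<le> ?k t0" if "0 \<le> t" for t
    using t0(2)[of t] neg[of t] p0 that by (cases "t \<le> T") auto
  with t0 p0 show thesis by (intro that) auto
qed

text \<open>
  Dividing by the weight shows that \<open>K\<close> is measurable; taking the maximum of a Borel representative with
  the lower bound makes the bound hold everywhere without changing \<open>K\<close> off a null set.
\<close>

lemma borel_kernel_representative:
  fixes K :: "'a::euclidean_space \<Rightarrow> real" and k0 e :: real
  assumes int: "integrable lebesgue (\<lambda>x. min ((norm x)\<^sup>2) 1 * K x)"
    and lower: "\<And>x. x \<noteq> 0 \<Longrightarrow> k0 * norm x powr - e \<le> K x"
  obtains K' where "K' \<in> borel_measurable borel" "AE x in lebesgue. K' x = K x"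
    "\<And>x. k0 * norm x powr - e \<le> K' x"
    "K \<in> borel_measurable lebesgue" "integrable lebesgue (\<lambda>x. min ((norm x)\<^sup>2) 1 * K' x)"
proof -
  have ne: "AE x in lebesgue. x \<noteq> (0::'a)"
  proof -
    have "{0::'a} \<in> null_sets lborel" by (simp add: null_sets_def)
    then have "AE x in lborel. x \<notin> {0::'a}" by (rule AE_not_in)
    then show ?thesis by (simp add: AE_completion_iff)
  qed
  have Km: "K \<in> borel_measurable lebesgue"
  proof (rule borel_measurable_AE)
    have wm: "(\<lambda>x::'a. min ((norm x)\<^sup>2) 1) \<in> borel_measurable lebesgue"
      by (intro measurable_completion) simp
    show "(\<lambda>x. (min ((norm x)\<^sup>2) 1 * K x) / min ((norm x)\<^sup>2) 1) \<in> borel_measurable lebesgue"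
      using int wm by (intro borel_measurable_divide) auto
    show "AE x in lebesgue. (min ((norm x)\<^sup>2) 1 * K x) / min ((norm x)\<^sup>2) 1 = K x"
      using ne by eventually_elim (auto simp: min_def)
  qed
  obtain K1 where K1[measurable]: "K1 \<in> borel_measurable borel" and ae: "AE x in lebesgue. K x = K1 x"
    by (rule lebesgue_ex_borel[OF Km])
  define K' where "K' x = max (K1 x) (k0 * norm x powr - e)" for x
  have ae': "AE x in lebesgue. K' x = K x"
    using ae ne
  proof eventually_elim
    case (elim x)
    then show ?case using lower[OF elim(2)] by (simp add: K'_def max_def)
  qed
  have K'm[measurable]: "K' \<in> borel_measurable borel" unfolding K'_def[abs_def] by measurable
  show thesis
  proof (rule that[OF K'm ae' _ Km])
    show "k0 * norm x powr - e \<le> K' x" for x by (simp add: K'_def)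
    have "integrable lebesgue (\<lambda>x. min ((norm x)\<^sup>2) 1 * K x) \<longleftrightarrow> integrable lebesgue (\<lambda>x. min ((norm x)\<^sup>2) 1 * K' x)"
    proof (rule integrable_cong_AE)
      show "(\<lambda>x. min ((norm x)\<^sup>2) 1 * K' x) \<in> borel_measurable lebesgue"
        by (intro measurable_completion) simp
      show "AE x in lebesgue. min ((norm x)\<^sup>2) 1 * K x = min ((norm x)\<^sup>2) 1 * K' x"
        using ae' by eventually_elim simp
    qed (use int in auto)
    then show "integrable lebesgue (\<lambda>x. min ((norm x)\<^sup>2) 1 * K' x)" using int by simp
  qed
qed

theorem theorem7:
  fixes s r q a1 a2 :: real
    and \<Omega> :: "'a::euclidean_space set"
    and K :: "'a \<Rightarrow> real"
    and g :: "real \<Rightarrow> real"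
  assumes "0 < s" and "s < 1" and "2 * s < real DIM('a)"
    and "open \<Omega>" and "bounded \<Omega>" and "\<Omega> \<noteq> {}" and "lipschitz_boundary \<Omega>"
    and "\<And>x. x \<noteq> 0 \<Longrightarrow> 0 < K x"
    and "integrable lebesgue (\<lambda>x. min ((norm x)\<^sup>2) 1 * K x)"
    and "\<exists>k0>0. \<forall>x. x \<noteq> 0 \<longrightarrow> k0 * norm x powr (- (real DIM('a) + 2 * s)) \<le> K x"
    and "0 < r" and "r < 1"
    and "continuous_on {0..} g" and "\<And>t. 0 \<le> t \<Longrightarrow> 0 \<le> g t"
    and "0 \<le> a1" and "0 \<le> a2" and "1 \<le> q" and "q < crit_exp DIM('a) s"
    and "\<And>t. 0 \<le> t \<Longrightarrow> g t \<le> a1 + a2 * rpow t (q - 1)"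
  shows "\<forall>\<mu>>0.
    let p = crit_exp DIM('a) s;
        k = k_fun p (embedding_const K \<Omega> p) (measure lebesgue \<Omega>) r q a1 a2 \<mu>
    in \<exists>t0\<ge>0. (\<forall>t\<ge>0. k t \<le> k t0) \<and>
       (\<exists>a b. a < b \<and> {a<..<b} \<subseteq> {0<..<k t0} \<and>
          (\<forall>l\<in>{a<..<b}. \<exists>u. weak_solution K \<Omega> p r g \<mu> l u))"
proof (intro allI impI)
  fix \<mu> :: real assume \<mu>: "0 < \<mu>"
  define p where "p = crit_exp DIM('a) s"
  obtain k0 where k0: "0 < k0" "\<And>x. x \<noteq> 0 \<Longrightarrow> k0 * norm x powr - (real DIM('a) + 2 * s) \<le> K x"
    using assms(10) by blast
  obtain K' where K': "K' \<in> borel_measurable borel" "AE x in lebesgue. K' x = K x"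
    "\<And>x. k0 * norm x powr - (real DIM('a) + 2 * s) \<le> K' x"
    "K \<in> borel_measurable lebesgue" "integrable lebesgue (\<lambda>x. min ((norm x)\<^sup>2) 1 * K' x)"
    using borel_kernel_representative[OF assms(9) k0(2)] by blast
  \<comment> \<open>the analysis is carried out for a Borel kernel that equals \<open>K\<close> almost everywhere\<close>
  interpret fractional_kernel s "real DIM('a)" p k0 \<Omega> K'
    by unfold_locales (use assms K' k0 in \<open>auto simp: p_def\<close>)
  define k where "k = k_fun p (embedding_const K \<Omega> p) (measure lebesgue \<Omega>) r q a1 a2 \<mu>"
  obtain t0 where t0: "0 \<le> t0" "\<And>t. 0 \<le> t \<Longrightarrow> k t \<le> k t0" "0 < k t0"
    using k_fun_attains_max[OF p_gt2 embedding_const_pos[OF K'(4,2)] measure_\<Omega>_pos assms(11,12,17,15,16) \<mu>]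
    unfolding k_def by blast
  have q: "q < p" using assms(18) by (simp add: p_def)
  obtain ls where ls: "0 < ls" "\<And>l. 0 < l \<Longrightarrow> l < ls \<Longrightarrow> \<exists>u. weak_solution K \<Omega> p r g \<mu> l u"
    using small_parameter_solution[OF K'(4,2) \<mu> assms(11-17) q assms(19)] by blast
  show "let p = crit_exp DIM('a) s;
        k = k_fun p (embedding_const K \<Omega> p) (measure lebesgue \<Omega>) r q a1 a2 \<mu>
    in \<exists>t0\<ge>0. (\<forall>t\<ge>0. k t \<le> k t0) \<and>
       (\<exists>a b. a < b \<and> {a<..<b} \<subseteq> {0<..<k t0} \<and>
          (\<forall>l\<in>{a<..<b}. \<exists>u. weak_solution K \<Omega> p r g \<mu> l u))"
    unfolding Let_def p_def[symmetric] k_def[symmetric]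
    using t0 ls by (intro exI[of _ t0] conjI allI impI exI[of _ 0] exI[of _ "min (k t0) ls"]) auto
qed

end
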